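(* Let $n\ge1$ and let $\alpha,\beta\in\mathbb C^n$ satisfy $\Re\alpha_j+\Re\beta_j>-1$ and $\alpha_j,\beta_j\notin\{-1,-2,\ldots\}$ for all $1\le j\le n$. Assume $u$ is a separately $(\alpha,\beta)$-harmonic function on $\mathbb D^n$ such that $$\sup_{0\le r<1}\int_{\mathbb T^n}|u(r\zeta)|\,dm_n(\zeta)<\infty.$$ Then there is a unique complex Borel measure $\mu$ on $\mathbb T^n$ such that $u=P_{\alpha,\beta}[d\mu]$.
   Context: $\mathbb D$ is the open unit disc and $\mathbb T$ the unit circle; $m_n$ is the normalized Haar measure on $\mathbb T^n$. For $1\le j\le n$, $$L_{\alpha_j,\beta_j}=(1-|z_j|^2)\frac{\partial^2}{\partial z_j\partial\overline{z_j}}+\alpha_jz_j\frac{\partial}{\partial z_j}+\beta_j\overline{z_j}\frac{\partial}{\partial\overline{z_j}}-\alpha_j\beta_j .$$ A function $u\in C^2(\mathbb D^n)$ (complex valued) is separately $(\alpha,\beta)$-harmonic if $L_{\alpha_j,\beta_j}u=0$ on $\mathbb D^n$ for all $1\le j\le n$. The $(\alpha,\beta)$-Poisson kernel is, for $z\in\mathbb D^n$, $\zeta\in\mathbb T^n$ (principal branches of powers), $$P_{\alpha,\beta}(z,\zeta)=\prod_{j=1}^n c_{\alpha_j,\beta_j}\frac{(1-|z_j|^2)^{\alpha_j+\beta_j+1}}{(1-z_j\overline{\zeta_j})^{\alpha_j+1}(1-\overline{z_j}\zeta_j)^{\beta_j+1}},\qquad c_{a,b}=\frac{\Gamma(a+1)\Gamma(b+1)}{\Gamma(a+b+1)},$$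 and $P_{\alpha,\beta}[d\mu](z)=\int_{\mathbb T^n}P_{\alpha,\beta}(z,\zeta)\,d\mu(\zeta)$, $z\in\mathbb D^n$, for a complex Borel measure $\mu$ on $\mathbb T^n$. *)

theory Defs
  imports "HOL-Analysis.Analysis"
begin

definition polydisc :: "(complex ^ 'n::finite) set" where
  "polydisc = {z. \<forall>j. norm (z $ j) < 1}"

definition torus :: "(complex ^ 'n::finite) set" where
  "torus = {z. \<forall>j. norm (z $ j) = 1}"

abbreviation torus_borel :: "(complex ^ 'n::finite) measure" where
  "torus_borel \<equiv> restrict_space borel torus"

text \<open>The normalized Haar measure of the torus, as the image of the uniform distribution on
  the cube of angles.\<close>

definition torus_haar :: "(complex ^ 'n::finite) measure" where
  "torus_haar = distr (uniform_measure lborel (cbox (0 :: real ^ 'n) (\<chi> j. 2 * pi)))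
     torus_borel (\<lambda>\<theta>. \<chi> j. cis (\<theta> $ j))"

lemma cis_vec_measurable:
  "(\<lambda>\<theta> :: real ^ 'n::finite. \<chi> j. cis (\<theta> $ j)) \<in> borel \<rightarrow>\<^sub>M torus_borel"
proof (rule measurable_restrict_space2)
  have "continuous_on UNIV (\<lambda>\<theta> :: real ^ 'n. \<chi> j. cis (\<theta> $ j))"
    by (intro continuous_intros)
  then show "(\<lambda>\<theta> :: real ^ 'n. \<chi> j. cis (\<theta> $ j)) \<in> borel \<rightarrow>\<^sub>M borel"
    by (rule borel_measurable_continuous_onI)
qed (simp add: torus_def)

lemma emeasure_torus_haar_space:
  "emeasure (torus_haar :: (complex ^ 'n::finite) measure) torus = 1"
proof -
  let ?C = "cbox (0 :: real ^ 'n) (\<chi> j. 2 * pi)"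
  let ?U = "uniform_measure lborel ?C"
  let ?g = "\<lambda>\<theta> :: real ^ 'n. \<chi> j. cis (\<theta> $ j)"
  have "measure lborel ?C > 0"
    by (auto simp: content_pos_lt_eq Basis_vec_def inner_axis)
  then have ne: "emeasure lborel ?C \<noteq> 0"
    by (metis Sigma_Algebra.measure_def enn2real_0 less_irrefl)
  have fin: "emeasure lborel ?C \<noteq> \<infinity>"
    using emeasure_lborel_cbox_finite[of "0 :: real ^ 'n" "\<chi> j. 2 * pi"] by simp
  have g: "?g \<in> ?U \<rightarrow>\<^sub>M torus_borel"
    using cis_vec_measurable by (simp cong: measurable_cong_sets)
  have "?g -` torus \<inter> space ?U = UNIV"
    by (auto simp: torus_def)
  moreover have "torus \<in> sets (torus_borel :: (complex ^ 'n) measure)"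
    using sets.top[of "torus_borel :: (complex ^ 'n) measure"] by (simp add: space_restrict_space)
  ultimately have "emeasure (torus_haar :: (complex ^ 'n) measure) torus = emeasure ?U UNIV"
    unfolding torus_haar_def using g by (simp add: emeasure_distr)
  also have "\<dots> = 1"
    using ne fin by (simp add: ennreal_divide_self top.not_eq_extremum)
  finally show ?thesis .
qed

text \<open>\<open>C\<^sup>2\<close> in the real sense, on an open set \<open>S\<close>.\<close>

definition C2_on :: "('a::real_normed_vector \<Rightarrow> 'b::real_normed_vector) \<Rightarrow> 'a set \<Rightarrow> bool" where
  "C2_on f S \<longleftrightarrow>
     (\<exists>(f' :: 'a \<Rightarrow> 'a \<Rightarrow>\<^sub>L 'b) (f'' :: 'a \<Rightarrow> 'a \<Rightarrow>\<^sub>L ('a \<Rightarrow>\<^sub>L 'b)).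
        (\<forall>x\<in>S. (f has_derivative blinfun_apply (f' x)) (at x)) \<and>
        (\<forall>x\<in>S. (f' has_derivative blinfun_apply (f'' x)) (at x)) \<and>
        continuous_on S f'')"

text \<open>Partial derivatives with respect to the real coordinates in \<open>z\<^sub>j = x\<^sub>j + \<i> y\<^sub>j\<close>, and the
  Wirtinger derivatives built from them.\<close>

definition partial_x :: "'n::finite \<Rightarrow> (complex ^ 'n \<Rightarrow> complex) \<Rightarrow> complex ^ 'n \<Rightarrow> complex" where
  "partial_x j f z = vector_derivative (\<lambda>t. f (z + axis j (of_real t))) (at 0)"

definition partial_y :: "'n::finite \<Rightarrow> (complex ^ 'n \<Rightarrow> complex) \<Rightarrow> complex ^ 'n \<Rightarrow> complex" where
  "partial_y j f z = vector_derivative (\<lambda>t. f (z + axis j (\<i> * of_real t))) (at 0)"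

definition dz :: "'n::finite \<Rightarrow> (complex ^ 'n \<Rightarrow> complex) \<Rightarrow> complex ^ 'n \<Rightarrow> complex" where
  "dz j f z = (partial_x j f z - \<i> * partial_y j f z) / 2"

definition dzbar :: "'n::finite \<Rightarrow> (complex ^ 'n \<Rightarrow> complex) \<Rightarrow> complex ^ 'n \<Rightarrow> complex" where
  "dzbar j f z = (partial_x j f z + \<i> * partial_y j f z) / 2"

definition L_op ::
  "'n::finite \<Rightarrow> complex \<Rightarrow> complex \<Rightarrow> (complex ^ 'n \<Rightarrow> complex) \<Rightarrow> complex ^ 'n \<Rightarrow> complex" where
  "L_op j a b u z =
     of_real (1 - (norm (z $ j))\<^sup>2) * dz j (dzbar j u) z
     + a * (z $ j) * dz j u z + b * cnj (z $ j) * dzbar j u z - a * b * u z"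

definition separately_harmonic ::
  "complex ^ 'n::finite \<Rightarrow> complex ^ 'n \<Rightarrow> (complex ^ 'n \<Rightarrow> complex) \<Rightarrow> bool" where
  "separately_harmonic \<alpha> \<beta> u \<longleftrightarrow>
     C2_on u polydisc \<and> (\<forall>j. \<forall>z\<in>polydisc. L_op j (\<alpha> $ j) (\<beta> $ j) u z = 0)"

definition c_const :: "complex \<Rightarrow> complex \<Rightarrow> complex" where
  "c_const a b = Gamma (a + 1) * Gamma (b + 1) / Gamma (a + b + 1)"

definition poisson_kernel ::
  "complex ^ 'n::finite \<Rightarrow> complex ^ 'n \<Rightarrow> complex ^ 'n \<Rightarrow> complex ^ 'n \<Rightarrow> complex" where
  "poisson_kernel \<alpha> \<beta> z \<zeta> =
     (\<Prod>j\<in>UNIV. c_const (\<alpha> $ j) (\<beta> $ j) *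
        (of_real (1 - (norm (z $ j))\<^sup>2) powr (\<alpha> $ j + \<beta> $ j + 1) /
         ((1 - z $ j * cnj (\<zeta> $ j)) powr (\<alpha> $ j + 1) *
          (1 - cnj (z $ j) * \<zeta> $ j) powr (\<beta> $ j + 1))))"

text \<open>A complex measure on the measurable space \<open>M\<close> (only the space and the sigma-algebra of
  \<open>M\<close> matter) is a countably additive function on \<open>sets M\<close>. As for \<open>emeasure\<close>, the value
  outside \<open>sets M\<close> is fixed to be 0, so that equality of functions is equality of measures.\<close>

definition complex_measure :: "'a measure \<Rightarrow> ('a set \<Rightarrow> complex) \<Rightarrow> bool" where
  "complex_measure M \<mu> \<longleftrightarrow>
     (\<forall>A :: nat \<Rightarrow> 'a set. range A \<subseteq> sets M \<longrightarrow> disjoint_family A \<longrightarrow>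
        (\<lambda>i. \<mu> (A i)) sums \<mu> (\<Union>i. A i)) \<and>
     (\<forall>A. A \<notin> sets M \<longrightarrow> \<mu> A = 0)"

text \<open>The positive part in the Jordan decomposition of a finite signed measure \<open>\<nu>\<close>:
  its value at \<open>A\<close> is the supremum of \<open>\<nu> B\<close> over measurable \<open>B \<subseteq> A\<close>. (Negative values
  are truncated by \<open>ennreal\<close>, which is harmless since \<open>B = {}\<close> contributes 0.)
  The negative part is the positive part of \<open>-\<nu>\<close>.\<close>

definition jordan_pos :: "'a measure \<Rightarrow> ('a set \<Rightarrow> real) \<Rightarrow> 'a measure" where
  "jordan_pos M \<nu> = measure_of (space M) (sets M)
     (\<lambda>A. SUP B\<in>{B \<in> sets M. B \<subseteq> A}. ennreal (\<nu> B))"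

definition complex_measure_integral ::
  "'a measure \<Rightarrow> ('a set \<Rightarrow> complex) \<Rightarrow> ('a \<Rightarrow> complex) \<Rightarrow> complex" where
  "complex_measure_integral M \<mu> f =
     (\<integral>x. f x \<partial>jordan_pos M (\<lambda>A. Re (\<mu> A))) - (\<integral>x. f x \<partial>jordan_pos M (\<lambda>A. - Re (\<mu> A)))
     + \<i> * ((\<integral>x. f x \<partial>jordan_pos M (\<lambda>A. Im (\<mu> A))) - (\<integral>x. f x \<partial>jordan_pos M (\<lambda>A. - Im (\<mu> A))))"

definition poisson_integral ::
  "complex ^ 'n::finite \<Rightarrow> complex ^ 'n \<Rightarrow> ((complex ^ 'n) set \<Rightarrow> complex) \<Rightarrow> complex ^ 'n \<Rightarrow> complex"
  where
  "poisson_integral \<alpha> \<beta> \<mu> z =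
     complex_measure_integral torus_borel \<mu> (\<lambda>\<zeta>. poisson_kernel \<alpha> \<beta> z \<zeta>)"

end

theory Submission
  imports Defs "HOL-Probability.Probability"
begin

text \<open>
  The proof is Fourier analysis on the torus, one polyradius at a time. Write \<open>u\<^sub>k(r)\<close> for the
  coefficient of \<open>\<zeta>\<^sup>k\<close> in the Fourier series of \<open>\<zeta> \<mapsto> u(r\<^sub>1 \<zeta>\<^sub>1, \<dots>, r\<^sub>n \<zeta>\<^sub>n)\<close>. The operator
  \<open>L\<close> in the variable \<open>z\<^sub>j\<close> commutes with rotations, so as a function of the single radius \<open>r\<^sub>j\<close>
  this coefficient solves a linear second order differential equation on \<open>(0,1)\<close>
  (\<open>fourier_coeff_radial_solution\<close>). The equation has a regular singular point at \<open>0\<close>, and its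
  solutions that are smooth there form a line (\<open>radial_solution_proportional\<close>): the Wronskian of
  two of them times \<open>r (1 - r\<^sup>2)\<^bsup>-(\<alpha>+\<beta>)\<^esup>\<close> is constant and vanishes at \<open>0\<close>.

  A spanning element of that line comes from the Poisson kernel itself. Expanding the two powers in
  the kernel by the binomial series shows that its Fourier coefficient of index \<open>k\<close> is a power of
  \<open>1 - r\<^sup>2\<close> times \<open>r\<^bsup>\<bar>k\<bar>\<^esup>\<close> times a hypergeometric series in \<open>r\<^sup>2\<close> (\<open>disc_kernel_coeff\<close>); the
  hypergeometric equation turns into the radial equation (\<open>radial_factor_solution\<close>). The
  asymptotics of the binomial coefficients and an Abelian argument show that this solution tends to
  \<open>1\<close> at \<open>r = 1\<close> (\<open>radial_factor_limit\<close>). The normalizing constant of the kernel is chosen for this, and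
  this is where \<open>\<alpha>\<^sub>j\<close> and \<open>\<beta>\<^sub>j\<close> must avoid the negative integers.
  Call the solution \<open>\<phi>\<^sub>k\<close>; in several variables \<open>\<phi>\<^sub>k(r)\<close> is the product of the \<open>\<phi>\<close> for the
  coordinates.

  Changing one radius after another gives \<open>u\<^sub>k(r) \<phi>\<^sub>k(r') = u\<^sub>k(r') \<phi>\<^sub>k(r)\<close> for all polyradii
  (\<open>fourier_coeff_proportional\<close>). By hypothesis the measures \<open>u(s\<zeta>) dm(\<zeta>)\<close> are bounded in total
  variation, so along a sequence \<open>s \<rightarrow> 1\<close> they converge weakly to some complex measure \<open>\<mu>\<close>
  (\<open>weak_limit_of_dilations\<close>). Taking \<open>r' = (s, \<dots>, s)\<close> in the identity yields
  \<open>u\<^sub>k(r) = \<mu>\<^sub>k \<phi>\<^sub>k(r)\<close>, where \<open>\<mu>\<^sub>k\<close> is the Fourier coefficient of \<open>\<mu>\<close>. The Poisson integral of \<open>\<mu>\<close>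
  has the same coefficients by Fubini (\<open>fourier_poisson_integral\<close>), and a continuous function on
  the torus is determined by its Fourier coefficients; hence \<open>u\<close> is the Poisson integral of \<open>\<mu>\<close>.
  Conversely a Poisson integral determines the products \<open>\<mu>\<^sub>k \<phi>\<^sub>k(r)\<close>, hence all \<open>\<mu>\<^sub>k\<close>, hence \<open>\<mu>\<close>
  (\<open>poisson_measure_unique\<close>).

  Weak compactness on the torus is reduced to Helly's selection theorem on the line. Schoenberg's
  space-filling curve maps the line continuously onto the torus and has a Borel right inverse on
  the angles (\<open>torus_curve_ternary_code\<close>), so measures can be carried to the line and back.
  Integrals against complex measures are defined through Jordan parts; \<open>jordan_decomposition\<close> and
  \<open>integral_diff_eq\<close> allow any other representation by four finite measures to be used instead.
\<close>

section \<open>Jordan parts of a signed measure\<close>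

definition countably_additive_on :: "'a measure \<Rightarrow> ('a set \<Rightarrow> real) \<Rightarrow> bool" where
  "countably_additive_on M \<nu> \<longleftrightarrow>
     (\<forall>A. range A \<subseteq> sets M \<longrightarrow> disjoint_family A \<longrightarrow> (\<lambda>i::nat. \<nu> (A i)) sums \<nu> (\<Union>i. A i))"

context
  fixes M :: "'a measure" and \<nu> :: "'a set \<Rightarrow> real"
  assumes \<nu>: "countably_additive_on M \<nu>"
begin

lemma signed_empty: "\<nu> {} = 0"
proof -
  have "(\<lambda>i::nat. \<nu> {}) sums \<nu> {}"
    using \<nu>[unfolded countably_additive_on_def, rule_format, of "\<lambda>_. {}"]
    by (auto simp: disjoint_family_on_def)
  then have "summable (\<lambda>i::nat. \<nu> {})" by (rule sums_summable)
  then show ?thesis by (simp add: summable_const_iff)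
qed

lemma signed_sums:
  "range A \<subseteq> sets M \<Longrightarrow> disjoint_family A \<Longrightarrow> (\<lambda>i::nat. \<nu> (A i)) sums \<nu> (\<Union>i. A i)"
  using \<nu> by (simp add: countably_additive_on_def)

lemma signed_Un:
  assumes "A \<in> sets M" "B \<in> sets M" "A \<inter> B = {}"
  shows "\<nu> (A \<union> B) = \<nu> A + \<nu> B"
proof -
  have "(\<lambda>i. \<nu> (binaryset A B i)) sums \<nu> (\<Union>i. binaryset A B i)"
    using assms by (intro signed_sums) (auto simp: binaryset_def disjoint_family_on_def)
  moreover have "(\<lambda>i. \<nu> (binaryset A B i)) sums (\<nu> A + \<nu> B)"
    by (rule binaryset_sums) (rule signed_empty)
  ultimately show ?thesis by (simp add: UN_binaryset_eq sums_unique2)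
qed

lemma signed_Diff:
  assumes "A \<in> sets M" "B \<in> sets M" "B \<subseteq> A"
  shows "\<nu> (A - B) = \<nu> A - \<nu> B"
proof -
  have "(A - B) \<union> B = A" using assms by auto
  moreover have "\<nu> ((A - B) \<union> B) = \<nu> (A - B) + \<nu> B" using assms by (intro signed_Un) auto
  ultimately show ?thesis by simp
qed

text \<open>If \<open>\<nu>\<close> were unbounded on the measurable subsets of \<open>A\<close>, then \<open>A\<close> would split into two pieces of
  \<open>\<nu>\<close>-value larger than \<open>1\<close> in modulus, one of which again has unbounded subsets. Iterating produces
  disjoint sets whose values do not tend to \<open>0\<close>, contrary to countable additivity.\<close>

lemma signed_bounded:
  "\<exists>C. \<forall>A\<in>sets M. \<bar>\<nu> A\<bar> \<le> C"
proof (rule ccontr)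
  assume unb: "\<nexists>C. \<forall>A\<in>sets M. \<bar>\<nu> A\<bar> \<le> C"
  define U where "U A \<longleftrightarrow> A \<in> sets M \<and> (\<forall>C. \<exists>B\<in>sets M. B \<subseteq> A \<and> \<bar>\<nu> B\<bar> > C)" for A
  have U0: "U (space M)"
    unfolding U_def
  proof (intro conjI allI)
    fix C
    obtain A where "A \<in> sets M" "\<not> \<bar>\<nu> A\<bar> \<le> C" using unb by blast
    then show "\<exists>B\<in>sets M. B \<subseteq> space M \<and> C < \<bar>\<nu> B\<bar>"
      using sets.sets_into_space by (intro bexI[of _ A]) auto
  qed auto
  \<comment> \<open>If \<open>B\<close> has a large value, so has \<open>A - B\<close>; one of them keeps the unboundedness.\<close>
  have step: "\<exists>B. U B \<and> B \<subseteq> A \<and> \<bar>\<nu> (A - B)\<bar> > 1" if A: "U A" for A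
  proof -
    obtain B where B: "B \<in> sets M" "B \<subseteq> A" "\<bar>\<nu> B\<bar> > 1 + \<bar>\<nu> A\<bar>"
      using A unfolding U_def by blast
    have AM: "A \<in> sets M" using A by (simp add: U_def)
    have d: "\<nu> (A - B) = \<nu> A - \<nu> B" using signed_Diff[OF AM B(1,2)] .
    have "U B \<or> U (A - B)"
    proof (rule ccontr)
      assume "\<not> (U B \<or> U (A - B))"
      then have nU: "\<not> U B" "\<not> U (A - B)" by auto
      obtain C where C: "\<And>E. E \<in> sets M \<Longrightarrow> E \<subseteq> B \<Longrightarrow> \<bar>\<nu> E\<bar> \<le> C"
        using nU(1) B(1) unfolding U_def by (meson not_less)
      have "A - B \<in> sets M" using AM B(1) by auto
      then obtain D where D: "\<And>E. E \<in> sets M \<Longrightarrow> E \<subseteq> A - B \<Longrightarrow> \<bar>\<nu> E\<bar> \<le> D"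
        using nU(2) unfolding U_def by (meson not_less)
      obtain E where E: "E \<in> sets M" "E \<subseteq> A" "\<bar>\<nu> E\<bar> > C + D" using A unfolding U_def by blast
      have "\<nu> E = \<nu> (E \<inter> B) + \<nu> (E - B)"
        using signed_Un[of "E \<inter> B" "E - B"] E B by (auto simp: Int_Diff_Un)
      moreover have "\<bar>\<nu> (E \<inter> B)\<bar> \<le> C" using E B by (intro C) auto
      moreover have "\<bar>\<nu> (E - B)\<bar> \<le> D" using E B by (intro D) auto
      ultimately show False using E(3) by linarith
    qed
    then show ?thesis
    proof
      assume "U B"
      then show ?thesis using B d by (intro exI[of _ B]) auto
    next
      assume "U (A - B)"
      moreover have "A - (A - B) = B" using B by auto
      ultimately show ?thesis using B by (intro exI[of _ "A - B"]) auto
    qed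
  qed
  then obtain S where S: "\<And>A. U A \<Longrightarrow> U (S A) \<and> S A \<subseteq> A \<and> \<bar>\<nu> (A - S A)\<bar> > 1" by metis
  define F where "F n = (S ^^ n) (space M)" for n
  have F: "U (F n)" for n by (induction n) (auto simp: F_def U0 S)
  have FS: "F (Suc n) = S (F n)" for n by (simp add: F_def)
  have dec: "decseq F" by (rule decseq_SucI) (use S F FS in auto)
  have dis: "disjoint_family (\<lambda>n. F n - F (Suc n))"
    unfolding disjoint_family_on_def
  proof (intro ballI impI)
    fix m n :: nat assume "m \<noteq> n"
    then show "(F m - F (Suc m)) \<inter> (F n - F (Suc n)) = {}"
    proof (induction m n rule: linorder_wlog)
      case (le m n)
      then have "F n \<subseteq> F (Suc m)" using dec by (auto simp: decseq_def)
      then show ?case by auto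
    next
      case (sym m n)
      then show ?case by (auto simp: Int_commute)
    qed
  qed
  have "(\<lambda>n. \<nu> (F n - F (Suc n))) sums \<nu> (\<Union>n. F n - F (Suc n))"
    using F dis by (intro signed_sums) (auto simp: U_def)
  then have "(\<lambda>n. \<nu> (F n - F (Suc n))) \<longlonglongrightarrow> 0"
    by (metis sums_summable summable_LIMSEQ_zero)
  then have "\<forall>\<^sub>F n in sequentially. \<bar>\<nu> (F n - F (Suc n))\<bar> < 1"
    using order_tendstoD(2)[OF tendsto_rabs_zero, of "\<lambda>n. \<nu> (F n - F (Suc n))" sequentially 1] by auto
  then obtain n where "\<bar>\<nu> (F n - F (Suc n))\<bar> < 1" by (auto simp: eventually_sequentially)
  with S[OF F[of n]] FS[of n] show False by simp
qed

lemma sets_jordan_pos [simp]: "sets (jordan_pos M \<nu>) = sets M"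
  by (simp add: jordan_pos_def sets.space_closed)

lemma space_jordan_pos [simp]: "space (jordan_pos M \<nu>) = space M"
  by (simp add: jordan_pos_def sets.space_closed)

text \<open>Superadditivity of the supremum gives one inequality. For the other, a set \<open>B\<close> inside a disjoint union is
  cut into its intersections with the pieces, and the partial sums of \<open>\<nu>\<close> are bounded termwise.\<close>

lemma emeasure_jordan_pos:
  assumes "A \<in> sets M"
  shows "emeasure (jordan_pos M \<nu>) A = (SUP B\<in>{B \<in> sets M. B \<subseteq> A}. ennreal (\<nu> B))"
proof (rule emeasure_measure_of[OF jordan_pos_def])
  let ?p = "\<lambda>A. SUP B\<in>{B \<in> sets M. B \<subseteq> A}. ennreal (\<nu> B)"
  show "sets M \<subseteq> Pow (space M)" by (rule sets.space_closed)
  show "A \<in> sets (jordan_pos M \<nu>)" using assms by simp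
  show "positive (sets (jordan_pos M \<nu>)) ?p"
  proof -
    have "{B \<in> sets M. B \<subseteq> {}} = {{}}" by auto
    then show ?thesis by (simp add: positive_def signed_empty)
  qed
  have mono: "?p A \<le> ?p B" if "A \<subseteq> B" for A B
    using that by (intro SUP_subset_mono) auto
  have up: "ennreal (\<nu> B) \<le> ?p A" if "B \<in> sets M" "B \<subseteq> A" for A B
    using that by (intro SUP_upper) auto
  have superadd: "?p A + ?p B \<le> ?p (A \<union> B)" if "A \<in> sets M" "B \<in> sets M" "A \<inter> B = {}" for A B
  proof -
    have ne: "{C \<in> sets M. C \<subseteq> A} \<noteq> {}" "{C \<in> sets M. C \<subseteq> B} \<noteq> {}" by auto
    have one: "ennreal (\<nu> C) + ennreal (\<nu> D) \<le> ?p (A \<union> B)"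
      if C: "C \<in> sets M" "C \<subseteq> A" and D: "D \<in> sets M" "D \<subseteq> B" for C D
    proof -
      have "C \<inter> D = {}" using C D \<open>A \<inter> B = {}\<close> by auto
      then have CD: "\<nu> (C \<union> D) = \<nu> C + \<nu> D" using C D by (intro signed_Un) auto
      have "ennreal (\<nu> C) + ennreal (\<nu> D) \<le> ennreal (\<nu> (C \<union> D)) \<or> \<nu> C \<le> 0 \<or> \<nu> D \<le> 0"
        using ennreal_plus[of "\<nu> C" "\<nu> D"] by (cases "\<nu> C \<le> 0"; cases "\<nu> D \<le> 0") (auto simp: CD)
      then show ?thesis
      proof (elim disjE)
        assume "ennreal (\<nu> C) + ennreal (\<nu> D) \<le> ennreal (\<nu> (C \<union> D))"
        also have "\<dots> \<le> ?p (A \<union> B)" using C D by (intro up) auto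
        finally show ?thesis .
      next
        assume "\<nu> C \<le> 0"
        then show ?thesis using up[of D "A \<union> B"] D by (simp add: ennreal_neg le_supI2)
      next
        assume "\<nu> D \<le> 0"
        then show ?thesis using up[of C "A \<union> B"] C by (simp add: ennreal_neg le_supI1)
      qed
    qed
    have right: "c + ?p B = (SUP D\<in>{C \<in> sets M. C \<subseteq> B}. c + ennreal (\<nu> D))" for c
      using ennreal_SUP_add_right[OF ne(2), of c "\<lambda>D. ennreal (\<nu> D)"] by simp
    have "?p A + ?p B = (SUP C\<in>{C \<in> sets M. C \<subseteq> A}. ennreal (\<nu> C) + ?p B)"
      by (rule ennreal_SUP_add_left[symmetric]) (use ne in auto)
    also have "\<dots> = (SUP C\<in>{C \<in> sets M. C \<subseteq> A}. SUP D\<in>{C \<in> sets M. C \<subseteq> B}. ennreal (\<nu> C) + ennreal (\<nu> D))"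
      unfolding right ..
    also have "\<dots> \<le> ?p (A \<union> B)" using one by (intro SUP_least) auto
    finally show ?thesis .
  qed
  show "countably_additive (sets (jordan_pos M \<nu>)) ?p"
  proof (rule countably_additiveI)
    fix A :: "nat \<Rightarrow> 'a set"
    assume A: "range A \<subseteq> sets (jordan_pos M \<nu>)" and dis: "disjoint_family A"
    then have AM: "\<And>i. A i \<in> sets M" by auto
    show "(\<Sum>i. ?p (A i)) = ?p (\<Union>i. A i)"
    proof (rule antisym)
      have fin: "(\<Sum>i<n. ?p (A i)) \<le> ?p (\<Union>i<n. A i)" for n
      proof (induction n)
        case 0 then show ?case by simp
      next
        case (Suc n)
        have "A i \<inter> A n = {}" if "i < n" for i
          using dis that unfolding disjoint_family_on_def by (metis UNIV_I less_irrefl)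
        then have "(\<Union>i<n. A i) \<inter> A n = {}" by blast
        then have "?p (\<Union>i<n. A i) + ?p (A n) \<le> ?p ((\<Union>i<n. A i) \<union> A n)"
          using AM by (intro superadd) auto
        then show ?case using Suc by (simp add: lessThan_Suc Un_commute add.commute) (meson add_left_mono order_trans)
      qed
      show "(\<Sum>i. ?p (A i)) \<le> ?p (\<Union>i. A i)"
        unfolding suminf_eq_SUP
        by (intro SUP_least order_trans[OF fin] mono) auto
      show "?p (\<Union>i. A i) \<le> (\<Sum>i. ?p (A i))"
      proof (rule SUP_least)
        fix B assume B: "B \<in> {B \<in> sets M. B \<subseteq> (\<Union>i. A i)}"
        have "(\<lambda>i. \<nu> (B \<inter> A i)) sums \<nu> (\<Union>i. B \<inter> A i)"
          using AM B dis by (intro signed_sums) (auto simp: disjoint_family_on_def)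
        moreover have "(\<Union>i. B \<inter> A i) = B" using B by auto
        ultimately have s: "(\<lambda>n. ennreal (\<Sum>i<n. \<nu> (B \<inter> A i))) \<longlonglongrightarrow> ennreal (\<nu> B)"
          by (intro tendsto_ennrealI) (simp add: sums_def)
        show "ennreal (\<nu> B) \<le> (\<Sum>i. ?p (A i))"
        proof (rule LIMSEQ_le_const2[OF s], intro exI allI impI)
          fix n :: nat
          have "ennreal (\<Sum>i<n. \<nu> (B \<inter> A i)) \<le> ennreal (\<Sum>i<n. max 0 (\<nu> (B \<inter> A i)))"
            by (intro ennreal_leI sum_mono) auto
          also have "\<dots> = (\<Sum>i<n. ennreal (max 0 (\<nu> (B \<inter> A i))))" by (subst sum_ennreal) auto
          also have "\<dots> \<le> (\<Sum>i<n. ?p (A i))"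
          proof (rule sum_mono)
            fix i
            have "ennreal (max 0 (\<nu> (B \<inter> A i))) = ennreal (\<nu> (B \<inter> A i))" by (simp add: ennreal_max_0 max_def ennreal_neg)
            also have "\<dots> \<le> ?p (A i)" using B AM by (intro up) auto
            finally show "ennreal (max 0 (\<nu> (B \<inter> A i))) \<le> ?p (A i)" .
          qed
          also have "\<dots> \<le> (\<Sum>i. ?p (A i))" by (rule sum_le_suminf) auto
          finally show "ennreal (\<Sum>i<n. \<nu> (B \<inter> A i)) \<le> (\<Sum>i. ?p (A i))" .
        qed
      qed
    qed
  qed
qed

lemma finite_measure_jordan_pos: "finite_measure (jordan_pos M \<nu>)"
proof
  obtain C where "\<And>A. A \<in> sets M \<Longrightarrow> \<bar>\<nu> A\<bar> \<le> C" using signed_bounded by blast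
  then have "emeasure (jordan_pos M \<nu>) (space M) \<le> ennreal C"
    by (subst emeasure_jordan_pos) (auto intro!: SUP_least ennreal_leI intro: abs_le_D1)
  then show "emeasure (jordan_pos M \<nu>) (space (jordan_pos M \<nu>)) \<noteq> \<infinity>"
    by (auto simp: top_unique)
qed

end

text \<open>For \<open>B \<subseteq> A\<close> one has \<open>\<nu> B = \<nu> A - \<nu> (A - B)\<close>; the supremum over \<open>B\<close> compares the two Jordan parts.\<close>

lemma jordan_decomposition:
  assumes \<nu>: "countably_additive_on M \<nu>" and A: "A \<in> sets M"
  shows "measure (jordan_pos M \<nu>) A - measure (jordan_pos M (\<lambda>A. - \<nu> A)) A = \<nu> A"
proof -
  have neg: "countably_additive_on M (\<lambda>A. - \<nu> A)"
    unfolding countably_additive_on_def by (intro allI impI sums_minus signed_sums[OF \<nu>])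
  have key: "measure (jordan_pos M \<nu>) A \<le> \<nu> A + measure (jordan_pos M (\<lambda>A. - \<nu> A)) A"
    if \<nu>: "countably_additive_on M \<nu>" and neg: "countably_additive_on M (\<lambda>A. - \<nu> A)" for \<nu>
  proof -
    interpret P: finite_measure "jordan_pos M \<nu>" by (rule finite_measure_jordan_pos[OF \<nu>])
    interpret N: finite_measure "jordan_pos M (\<lambda>A. - \<nu> A)" by (rule finite_measure_jordan_pos[OF neg])
    let ?n = "measure (jordan_pos M (\<lambda>A. - \<nu> A))"
    have b: "\<nu> B \<le> \<nu> A + ?n A" if B: "B \<in> sets M" "B \<subseteq> A" for B
    proof -
      have "ennreal (- \<nu> (A - B)) \<le> emeasure (jordan_pos M (\<lambda>A. - \<nu> A)) A"
        unfolding emeasure_jordan_pos[OF neg A] using A B by (intro SUP_upper) auto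
      then have "- \<nu> (A - B) \<le> ?n A"
        by (simp add: N.emeasure_eq_measure ennreal_le_iff)
      then show ?thesis using signed_Diff[OF \<nu> A B] by simp
    qed
    have "0 \<le> \<nu> A + ?n A" using b[of "{}"] signed_empty[OF \<nu>] by simp
    moreover have "ennreal (measure (jordan_pos M \<nu>) A) \<le> ennreal (\<nu> A + ?n A)"
      unfolding P.emeasure_eq_measure[symmetric] emeasure_jordan_pos[OF \<nu> A]
      by (intro SUP_least ennreal_leI) (use b in auto)
    ultimately show ?thesis by (simp add: ennreal_le_iff)
  qed
  show ?thesis using key[OF \<nu> neg] key[OF neg] \<nu> by simp
qed

text \<open>The two differences agree as set functions, so \<open>M1 + N2\<close> and \<open>N1 + M2\<close> agree as measures. Moving the negative terms
  across avoids subtraction and makes the usual monotone approximation by simple functions available.\<close>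

lemma integral_diff_eq:
  fixes f :: "'a \<Rightarrow> complex"
  assumes fin: "finite_measure M1" "finite_measure M2" "finite_measure N1" "finite_measure N2"
    and sets: "sets M1 = sets M" "sets M2 = sets M" "sets N1 = sets M" "sets N2 = sets M"
    and eq: "\<And>A. A \<in> sets M \<Longrightarrow> measure M1 A - measure M2 A = measure N1 A - measure N2 A"
    and f: "f \<in> borel_measurable M" and B: "\<And>x. x \<in> space M \<Longrightarrow> norm (f x) \<le> B"
  shows "(\<integral>x. f x \<partial>M1) - (\<integral>x. f x \<partial>M2) = (\<integral>x. f x \<partial>N1) - (\<integral>x. f x \<partial>N2)"
proof -
  interpret M1: finite_measure M1 by fact
  interpret M2: finite_measure M2 by fact
  interpret N1: finite_measure N1 by fact
  interpret N2: finite_measure N2 by fact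
  note [measurable_cong] = sets
  have sp: "space M1 = space M" "space M2 = space M" "space N1 = space M" "space N2 = space M"
    using sets[THEN sets_eq_imp_space_eq] by simp_all
  \<comment> \<open>Equality of the sums as measures, without any subtraction in the extended reals.\<close>
  have em: "emeasure M1 A + emeasure N2 A = emeasure N1 A + emeasure M2 A" if "A \<in> sets M" for A
    unfolding M1.emeasure_eq_measure M2.emeasure_eq_measure N1.emeasure_eq_measure N2.emeasure_eq_measure
    using eq[OF that] by (simp flip: ennreal_plus)
  have nn: "(\<integral>\<^sup>+x. g x \<partial>M1) + (\<integral>\<^sup>+x. g x \<partial>N2) = (\<integral>\<^sup>+x. g x \<partial>N1) + (\<integral>\<^sup>+x. g x \<partial>M2)"
    if "g \<in> borel_measurable M" for g
    using that
  proof (induction g rule: borel_measurable_induct)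
    case (cong f g)
    have "integral\<^sup>N L f = integral\<^sup>N L g" if "space L = space M" for L
      using cong that by (intro nn_integral_cong) simp
    with cong sp show ?case by simp
  next
    case (set A)
    then show ?case using em sets by simp
  next
    case (mult u c)
    then show ?case by (simp add: nn_integral_cmult flip: distrib_left)
  next
    case (add u v)
    then show ?case by (simp add: nn_integral_add ac_simps)
  next
    case (seq U)
    have "(\<lambda>i. (\<integral>\<^sup>+x. U i x \<partial>L)) \<longlonglongrightarrow> (\<integral>\<^sup>+x. (SUP i. U i) x \<partial>L)" if "sets L = sets M" for L
    proof -
      have "U i \<in> borel_measurable L" for i using seq that by (simp cong: measurable_cong_sets)
      then have "(\<integral>\<^sup>+x. (SUP i. U i) x \<partial>L) = (SUP i. (\<integral>\<^sup>+x. U i x \<partial>L))"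
        using seq by (simp add: nn_integral_monotone_convergence_SUP SUP_apply image_comp)
      moreover have "incseq (\<lambda>i. (\<integral>\<^sup>+x. U i x \<partial>L))"
        using seq by (auto simp: incseq_def le_fun_def intro!: nn_integral_mono)
      ultimately show ?thesis by (simp add: LIMSEQ_SUP)
    qed
    note L = this
    have "(\<lambda>i. (\<integral>\<^sup>+x. U i x \<partial>M1) + (\<integral>\<^sup>+x. U i x \<partial>N2)) \<longlonglongrightarrow> (\<integral>\<^sup>+x. (SUP i. U i) x \<partial>M1) + (\<integral>\<^sup>+x. (SUP i. U i) x \<partial>N2)"
      by (intro tendsto_add L sets)
    moreover have "(\<lambda>i. (\<integral>\<^sup>+x. U i x \<partial>N1) + (\<integral>\<^sup>+x. U i x \<partial>M2)) \<longlonglongrightarrow> (\<integral>\<^sup>+x. (SUP i. U i) x \<partial>N1) + (\<integral>\<^sup>+x. (SUP i. U i) x \<partial>M2)"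
      by (intro tendsto_add L sets)
    ultimately show ?case using seq.IH LIMSEQ_unique by simp
  qed
  have re: "(\<integral>x. g x \<partial>M1) - (\<integral>x. g x \<partial>M2) = (\<integral>x. g x \<partial>N1) - (\<integral>x. g x \<partial>N2)"
    if g[measurable]: "g \<in> borel_measurable M" and g0: "\<And>x. g x \<ge> 0" and gC: "\<And>x. x \<in> space M \<Longrightarrow> g x \<le> C" for g :: "'a \<Rightarrow> real" and C
  proof -
    have e: "ennreal (\<integral>x. g x \<partial>L) = (\<integral>\<^sup>+x. g x \<partial>L)" if "finite_measure L" "sets L = sets M" for L
    proof -
      interpret L: finite_measure L by fact
      have sL: "space L = space M" using that(2) by (rule sets_eq_imp_space_eq)
      have "integrable L g" using that g0 gC sL
        by (intro L.integrable_const_bound[where B = C]) (auto simp: measurable_cong_sets[OF that(2) refl] intro!: AE_I2 g)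
      then show ?thesis using g0 by (intro nn_integral_eq_integral[symmetric]) auto
    qed
    have "ennreal (\<integral>x. g x \<partial>M1) + ennreal (\<integral>x. g x \<partial>N2) = ennreal (\<integral>x. g x \<partial>N1) + ennreal (\<integral>x. g x \<partial>M2)"
      using nn[of "\<lambda>x. ennreal (g x)"] fin sets by (simp add: e)
    then show ?thesis using g0
      by (simp add: integral_nonneg flip: ennreal_plus)
  qed
  have re': "(\<integral>x. g x \<partial>M1) - (\<integral>x. g x \<partial>M2) = (\<integral>x. g x \<partial>N1) - (\<integral>x. g x \<partial>N2)"
    and int: "integrable M1 g" "integrable M2 g" "integrable N1 g" "integrable N2 g"
    if g[measurable]: "g \<in> borel_measurable M" and gC: "\<And>x. x \<in> space M \<Longrightarrow> \<bar>g x\<bar> \<le> B" for g :: "'a \<Rightarrow> real"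
  proof -
    have i: "integrable L h" if "finite_measure L" "sets L = sets M" "h \<in> borel_measurable M" "\<And>x. x \<in> space M \<Longrightarrow> \<bar>h x\<bar> \<le> C" for L h and C :: real
    proof -
      interpret L: finite_measure L by fact
      have sL: "space L = space M" using that(2) by (rule sets_eq_imp_space_eq)
      show ?thesis using that sL
        by (intro L.integrable_const_bound[where B = C]) (auto simp: measurable_cong_sets[OF that(2) refl] intro!: AE_I2)
    qed
    show "integrable M1 g" "integrable M2 g" "integrable N1 g" "integrable N2 g"
      by (auto intro!: i[where C = B] fin sets gC)
    have gC2: "g x \<le> B" "- g x \<le> B" "0 \<le> B" if "x \<in> space M" for x using gC[OF that] by linarith+
    have s: "(\<integral>x. g x \<partial>L) = (\<integral>x. max 0 (g x) \<partial>L) - (\<integral>x. max 0 (- g x) \<partial>L)" if "finite_measure L" "sets L = sets M" for L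
      using that gC2
      by (subst Bochner_Integration.integral_diff[symmetric])
         (auto intro!: i[where C = B] Bochner_Integration.integral_cong)
    show "(\<integral>x. g x \<partial>M1) - (\<integral>x. g x \<partial>M2) = (\<integral>x. g x \<partial>N1) - (\<integral>x. g x \<partial>N2)"
      using re[of "\<lambda>x. max 0 (g x)" B] re[of "\<lambda>x. max 0 (- g x)" B] gC2 fin sets
      by (simp add: s)
  qed
  have cre: "\<bar>Re (f x)\<bar> \<le> B" "\<bar>Im (f x)\<bar> \<le> B" if "x \<in> space M" for x
    using B[OF that] abs_Re_le_cmod[of "f x"] abs_Im_le_cmod[of "f x"] by linarith+
  have c: "(\<integral>x. f x \<partial>L) = of_real (\<integral>x. Re (f x) \<partial>L) + \<i> * of_real (\<integral>x. Im (f x) \<partial>L)"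
    if i: "integrable L (\<lambda>x. Re (f x))" "integrable L (\<lambda>x. Im (f x))" for L
  proof -
    have "integrable L (\<lambda>x. complex_of_real (Re (f x)))" "integrable L (\<lambda>x. complex_of_real (Im (f x)))"
      using i by (auto simp: complex_of_real_integrable_eq)
    then have "(\<integral>x. of_real (Re (f x)) + \<i> * of_real (Im (f x)) \<partial>L) =  (\<integral>x. complex_of_real (Re (f x)) \<partial>L) + \<i> * (\<integral>x. complex_of_real (Im (f x)) \<partial>L)"
      by simp
    then show ?thesis by (simp flip: complex_eq)
  qed
  have mf: "(\<lambda>x. Re (f x)) \<in> borel_measurable M" "(\<lambda>x. Im (f x)) \<in> borel_measurable M"
    using f by measurable
  have "of_real ((\<integral>x. Re (f x) \<partial>M1) - (\<integral>x. Re (f x) \<partial>M2)) = complex_of_real ((\<integral>x. Re (f x) \<partial>N1) - (\<integral>x. Re (f x) \<partial>N2))"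
       "of_real ((\<integral>x. Im (f x) \<partial>M1) - (\<integral>x. Im (f x) \<partial>M2)) = complex_of_real ((\<integral>x. Im (f x) \<partial>N1) - (\<integral>x. Im (f x) \<partial>N2))"
    using re'[OF mf(1) cre(1)] re'[OF mf(2) cre(2)] by auto
  moreover have "(\<integral>x. f x \<partial>K) - (\<integral>x. f x \<partial>L) =
      of_real ((\<integral>x. Re (f x) \<partial>K) - (\<integral>x. Re (f x) \<partial>L)) + \<i> * of_real ((\<integral>x. Im (f x) \<partial>K) - (\<integral>x. Im (f x) \<partial>L))"
    if "integrable K (\<lambda>x. Re (f x))" "integrable K (\<lambda>x. Im (f x))"
      "integrable L (\<lambda>x. Re (f x))" "integrable L (\<lambda>x. Im (f x))" for K L
    by (simp add: c[OF that(1,2)] c[OF that(3,4)] right_diff_distrib)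
  ultimately show ?thesis
    using int[OF mf(1) cre(1)] int[OF mf(2) cre(2)] by simp
qed

section \<open>Trigonometric polynomials on the torus\<close>

text \<open>The Laurent monomial \<open>z\<^sup>k\<close>; on the torus these are the characters.\<close>

definition mon :: "('n::finite \<Rightarrow> int) \<Rightarrow> complex ^ 'n \<Rightarrow> complex" where
  "mon k z = (\<Prod>j\<in>UNIV. (z $ j) powi k j)"

lemma torus_norm: "z \<in> torus \<Longrightarrow> norm (z $ j) = 1"
  by (simp add: torus_def)

lemma torus_nonzero: "z \<in> torus \<Longrightarrow> z $ j \<noteq> 0"
  using torus_norm[of z j] by auto

lemma compact_torus: "compact (torus :: (complex ^ 'n::finite) set)"
proof -
  have "norm z \<le> real CARD('n)" if "z \<in> torus" for z :: "complex ^ 'n"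
  proof -
    have "norm z \<le> (\<Sum>j\<in>UNIV. norm (z $ j))" unfolding norm_vec_def by (rule L2_set_le_sum) simp
    also have "\<dots> = real CARD('n)" using torus_norm[OF that] by simp
    finally show ?thesis .
  qed
  then have "bounded (torus :: (complex ^ 'n) set)" unfolding bounded_iff by blast
  moreover have "closed (torus :: (complex ^ 'n) set)"
    unfolding torus_def by (intro closed_Collect_all closed_Collect_eq continuous_intros)
  ultimately show ?thesis by (simp add: compact_eq_bounded_closed)
qed

lemma mon_add: "z \<in> torus \<Longrightarrow> mon (\<lambda>j. k j + l j) z = mon k z * mon l z"
  by (simp add: mon_def power_int_add torus_nonzero prod.distrib)

lemma mon_zero [simp]: "mon (\<lambda>_. 0) z = 1"
  by (simp add: mon_def)

lemma mon_mult: "mon k (w * z) = mon k w * mon k z"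
  by (simp add: mon_def power_int_mult_distrib prod.distrib)

lemma cnj_unit_powi: "norm w = 1 \<Longrightarrow> cnj (w powi m) = w powi (- m)"
proof -
  assume w: "norm w = 1"
  then have "cnj w = inverse w" by (simp add: divide_inverse inverse_complex_def complex_eq_iff cmod_def)
  moreover have "cnj (w powi m) = cnj w powi m"
    by (cases m rule: int_cases3) (auto simp: power_int_minus)
  ultimately show ?thesis by (simp add: power_int_minus power_int_inverse)
qed

lemma continuous_mon: "continuous_on torus (mon k)"
  unfolding mon_def by (intro continuous_intros) (auto simp: torus_nonzero)

lemma mon_single: "mon (\<lambda>i. if i = j then m else 0) z = z $ j powi m"
proof -
  have "mon (\<lambda>i. if i = j then m else 0) z = (\<Prod>i\<in>UNIV. if i = j then z $ j powi m else 1)"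
    unfolding mon_def by (rule prod.cong) auto
  then show ?thesis by simp
qed

text \<open>Only the values on the torus matter, hence the equations restricted to it.\<close>

inductive trig_poly :: "(complex ^ 'n::finite \<Rightarrow> complex) \<Rightarrow> bool" where
  monomial: "(\<And>z. z \<in> torus \<Longrightarrow> p z = c * mon k z) \<Longrightarrow> trig_poly p"
| add: "trig_poly p \<Longrightarrow> trig_poly q \<Longrightarrow> (\<And>z. z \<in> torus \<Longrightarrow> r z = p z + q z) \<Longrightarrow> trig_poly r"

lemma trig_poly_mult: 
  assumes "trig_poly p" "trig_poly q"
  shows "trig_poly (\<lambda>z. p z * q z)"
  using assms
proof (induction p arbitrary: q rule: trig_poly.induct)
  case (monomial p c k)
  note p = monomial.hyps
  from \<open>trig_poly q\<close> show ?case
  proof (induction q rule: trig_poly.induct)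
    case (monomial q d l)
    then show ?case
      by (intro trig_poly.monomial[where c = "c * d" and k = "\<lambda>j. k j + l j"]) (simp add: p mon_add)
  next
    case (add q1 q2 r)
    show ?case
      by (rule trig_poly.add[OF add.IH]) (simp add: add.hyps algebra_simps)
  qed
next
  case (add p1 p2 r)
  show ?case
    by (rule trig_poly.add[OF add.IH(1)[OF add.prems] add.IH(2)[OF add.prems]]) (simp add: add.hyps algebra_simps)
qed

lemma trig_poly_sum:
  "finite I \<Longrightarrow> (\<And>i. i \<in> I \<Longrightarrow> trig_poly (p i)) \<Longrightarrow> trig_poly (\<lambda>z. \<Sum>i\<in>I. p i z)"
proof (induction I rule: finite_induct)
  case empty
  show ?case by (rule trig_poly.monomial[where c = 0 and k = "\<lambda>_. 0"]) simp
next
  case (insert i I)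
  show ?case by (rule trig_poly.add[of "p i" "\<lambda>z. \<Sum>i\<in>I. p i z"]) (use insert in auto)
qed

lemma trig_poly_const: "trig_poly (\<lambda>z. c)"
  by (rule trig_poly.monomial[where c = c and k = "\<lambda>_. 0"]) simp

lemma trig_poly_cmult: "trig_poly p \<Longrightarrow> trig_poly (\<lambda>z. c * p z)"
  by (rule trig_poly_mult[OF trig_poly_const])

lemma trig_poly_coordinate: "trig_poly (\<lambda>z. z $ j)" "trig_poly (\<lambda>z. cnj (z $ j))"
proof -
  show "trig_poly (\<lambda>z. z $ j)"
    by (rule trig_poly.monomial[where c = 1 and k = "\<lambda>i. if i = j then 1 else 0"]) (simp add: mon_single)
  show "trig_poly (\<lambda>z. cnj (z $ j))"
    by (rule trig_poly.monomial[where c = 1 and k = "\<lambda>i. if i = j then - 1 else 0"])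
       (use cnj_unit_powi[of _ 1] in \<open>simp add: mon_single torus_norm\<close>)
qed

lemma vec_axis_expansion:
  fixes z :: "complex ^ 'n::finite"
  shows "z = (\<Sum>j\<in>UNIV. Re (z $ j) *\<^sub>R axis j 1 + Im (z $ j) *\<^sub>R axis j \<i>)"
proof (rule vec_eq_iff[THEN iffD2], rule allI)
  fix i
  have "(\<Sum>j\<in>UNIV. (Re (z $ j) *\<^sub>R axis j 1 + Im (z $ j) *\<^sub>R axis j \<i>) $ i)
      = (\<Sum>j\<in>UNIV. if j = i then Re (z $ i) *\<^sub>R 1 + Im (z $ i) *\<^sub>R \<i> else 0)"
    by (rule sum.cong) (auto simp: axis_def)
  also have "\<dots> = z $ i" by (simp add: complex_eq_iff)
  finally show "z $ i = (\<Sum>j\<in>UNIV. Re (z $ j) *\<^sub>R axis j 1 + Im (z $ j) *\<^sub>R axis j \<i>) $ i"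
    by (simp add: sum_component)
qed

text \<open>On the torus the conjugate of a coordinate is its inverse, so real and imaginary parts of the
  coordinates are trigonometric polynomials.\<close>

lemma trig_poly_real_polynomial_function:
  "real_polynomial_function p \<Longrightarrow> trig_poly (\<lambda>z :: complex ^ 'n::finite. complex_of_real (p z))"
proof (induction p rule: real_polynomial_function.induct)
  case (linear f)
  then interpret f: bounded_linear f .
  have f: "complex_of_real (f z) = (\<Sum>j\<in>UNIV. (of_real (f (axis j 1)) / 2 + of_real (f (axis j \<i>)) / (2 * \<i>)) * z $ j
      + (of_real (f (axis j 1)) / 2 - of_real (f (axis j \<i>)) / (2 * \<i>)) * cnj (z $ j))" for z
  proof -
    have "f z = (\<Sum>j\<in>UNIV. Re (z $ j) * f (axis j 1) + Im (z $ j) * f (axis j \<i>))"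
      by (subst (1) vec_axis_expansion) (simp add: f.sum f.add f.scaleR)
    then show ?thesis
      by (auto simp: complex_eq_iff field_simps intro!: sum.cong)
  qed
  have "trig_poly (\<lambda>z. \<Sum>j\<in>UNIV. (of_real (f (axis j 1)) / 2 + of_real (f (axis j \<i>)) / (2 * \<i>)) * z $ j
      + (of_real (f (axis j 1)) / 2 - of_real (f (axis j \<i>)) / (2 * \<i>)) * cnj (z $ j))"
    (is "trig_poly (\<lambda>z. \<Sum>j\<in>UNIV. ?c j * z $ j + ?d j * cnj (z $ j))")
  proof (rule trig_poly_sum)
    fix j
    show "trig_poly (\<lambda>z. ?c j * z $ j + ?d j * cnj (z $ j))"
      by (rule trig_poly.add[OF trig_poly_cmult[OF trig_poly_coordinate(1)] trig_poly_cmult[OF trig_poly_coordinate(2)]]) (rule refl)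
  qed simp
  then show ?case by (rule back_subst[of trig_poly]) (rule ext, rule f[symmetric])
next
  case (const c)
  show ?case by (rule trig_poly_const)
next
  case (add f g)
  then show ?case by (intro trig_poly.add[OF add.IH]) simp
next
  case (mult f g)
  then show ?case using trig_poly_mult[OF mult.IH] by simp
qed

lemma trig_poly_dense:
  fixes f :: "complex ^ 'n::finite \<Rightarrow> complex"
  assumes f: "continuous_on torus f" and e: "e > 0"
  obtains p where "trig_poly p" "\<And>z. z \<in> torus \<Longrightarrow> norm (f z - p z) < e"
proof -
  obtain g where g: "polynomial_function g" "\<And>z. z \<in> torus \<Longrightarrow> norm (f z - g z) < e"
    using Stone_Weierstrass_polynomial_function[OF compact_torus f e] by blast
  have "real_polynomial_function (\<lambda>z. Re (g z))" "real_polynomial_function (\<lambda>z. Im (g z))"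
    using g(1) bounded_linear_Re bounded_linear_Im unfolding polynomial_function_def o_def by blast+
  then have "trig_poly (\<lambda>z. complex_of_real (Re (g z)))" "trig_poly (\<lambda>z. \<i> * complex_of_real (Im (g z)))"
    by (auto intro: trig_poly_real_polynomial_function trig_poly_cmult)
  then have "trig_poly g" by (rule trig_poly.add) (simp add: complex_eq_iff)
  then show ?thesis using g(2) by (rule that)
qed

text \<open>The uniqueness principle behind all later Fourier arguments: by Stone--Weierstrass a bounded linear functional on the
  continuous functions is determined by its values on the monomials. The bound with \<open>B = 0\<close> also says that
  the functional depends only on the values on the torus.\<close>

lemma functional_eq_0_if_monomials:
  fixes \<Lambda> :: "(complex ^ 'n::finite \<Rightarrow> complex) \<Rightarrow> complex"
  assumes add: "\<And>f g. continuous_on torus f \<Longrightarrow> continuous_on torus g \<Longrightarrow> \<Lambda> (\<lambda>z. f z + g z) = \<Lambda> f + \<Lambda> g"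
    and scale: "\<And>c f. continuous_on torus f \<Longrightarrow> \<Lambda> (\<lambda>z. c * f z) = c * \<Lambda> f"
    and bound: "\<And>f B. continuous_on torus f \<Longrightarrow> (\<And>z. z \<in> torus \<Longrightarrow> norm (f z) \<le> B) \<Longrightarrow> norm (\<Lambda> f) \<le> C * B"
    and mon: "\<And>k. \<Lambda> (mon k) = 0"
    and f: "continuous_on torus f"
  shows "\<Lambda> f = 0"
proof -
  have diff: "\<Lambda> (\<lambda>z. f z - g z) = \<Lambda> f - \<Lambda> g" if "continuous_on torus f" "continuous_on torus g" for f g
  proof -
    have m: "continuous_on torus (\<lambda>z. - 1 * g z)"
      by (rule continuous_on_mult[OF continuous_on_const that(2)])
    have "(\<lambda>z. f z + - 1 * g z) = (\<lambda>z. f z - g z)" by auto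
    then show ?thesis using add[OF that(1) m] scale[OF that(2), of "- 1"] by simp
  qed
  have cong: "\<Lambda> f = \<Lambda> g" if fg: "continuous_on torus f" "continuous_on torus g" "\<And>z. z \<in> torus \<Longrightarrow> f z = g z" for f g
  proof -
    have "norm (\<Lambda> (\<lambda>z. f z - g z)) \<le> C * 0" using fg by (intro bound) (auto intro!: continuous_intros)
    then show ?thesis using diff[OF fg(1,2)] by simp
  qed
  have trig: "continuous_on torus p \<and> \<Lambda> p = 0" if "trig_poly p" for p
    using that
  proof (induction p rule: trig_poly.induct)
    case (monomial p c k)
    have c: "continuous_on torus (\<lambda>z. c * mon k z)" by (intro continuous_intros continuous_mon)
    then have p: "continuous_on torus p" using monomial by (simp cong: continuous_on_cong)
    then show ?case using cong[OF p c monomial] scale[OF continuous_mon] mon by simp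
  next
    case (add p q r)
    have c: "continuous_on torus (\<lambda>z. p z + q z)" using add.IH by (intro continuous_intros) auto
    then have r: "continuous_on torus r" using add.hyps by (simp cong: continuous_on_cong)
    then show ?case using cong[OF r c add.hyps(3)] assms(1)[of p q] add.IH by simp
  qed
  have "norm (\<Lambda> f) \<le> C * e" if e: "e > 0" for e
  proof -
    obtain p where p: "trig_poly p" "\<And>z. z \<in> torus \<Longrightarrow> norm (f z - p z) < e" 
      using trig_poly_dense[OF f e] by blast
    have "norm (\<Lambda> (\<lambda>z. f z - p z)) \<le> C * e"
      using p trig[OF p(1)] f by (intro bound) (auto intro!: continuous_intros less_imp_le)
    then show ?thesis using diff[OF f, of p] trig[OF p(1)] by simp
  qed
  moreover have "((\<lambda>e. C * e) \<longlongrightarrow> C * 0) (at_right 0)" by (intro tendsto_intros)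
  ultimately have "norm (\<Lambda> f) \<le> C * 0"
    by (intro tendsto_lowerbound[where f = "\<lambda>e. C * e"]) (auto simp: eventually_at_filter)
  then show ?thesis by simp
qed

section \<open>Haar measure of the torus\<close>

abbreviation angles :: "(real ^ 'n::finite) set" where
  "angles \<equiv> cbox 0 (\<chi> j. 2 * pi)"

definition cis_vec :: "real ^ 'n::finite \<Rightarrow> complex ^ 'n" where
  "cis_vec \<theta> = (\<chi> j. cis (\<theta> $ j))"

lemma cis_vec_nth [simp]: "cis_vec \<theta> $ j = cis (\<theta> $ j)"
  by (simp add: cis_vec_def)

lemma cis_vec_torus [simp]: "cis_vec \<theta> \<in> torus"
  by (simp add: torus_def)

lemma continuous_cis_vec [continuous_intros]: "continuous_on S cis_vec"
  unfolding cis_vec_def by (intro continuous_intros)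

lemma torus_eq_cis_vec: 
  assumes "z \<in> torus"
  obtains \<theta> where "\<theta> \<in> angles" "z = cis_vec \<theta>"
proof -
  let ?\<theta> = "\<chi> j. Arg2pi (z $ j)"
  have "cis (Arg2pi (z $ j)) = z $ j" for j
    using complex_norm_eq_1_exp[of "z $ j"] assms by (simp add: torus_def cis_conv_exp)
  then have "z = cis_vec ?\<theta>" by (simp add: vec_eq_iff)
  moreover have "?\<theta> \<in> angles"
    by (auto simp: mem_box_cart Arg2pi_ge_0 Arg2pi_lt_2pi less_imp_le)
  ultimately show ?thesis using that by blast
qed

lemma space_torus_borel [simp]: "space (torus_borel :: (complex ^ 'n::finite) measure) = torus"
  by (simp add: space_restrict_space)

lemma torus_in_sets [simp]: "torus \<in> sets (torus_borel :: (complex ^ 'n::finite) measure)"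
  using sets.top[of "torus_borel :: (complex ^ 'n) measure"] by (simp del: sets.top)

lemma sets_torus_haar [simp, measurable_cong]: "sets torus_haar = sets torus_borel"
  by (simp add: torus_haar_def)

lemma space_torus_haar [simp]: "space (torus_haar :: (complex ^ 'n::finite) measure) = torus"
  using sets_eq_imp_space_eq[OF sets_torus_haar] by simp

lemma prob_space_torus_haar: "prob_space (torus_haar :: (complex ^ 'n::finite) measure)"
  by (rule prob_spaceI) (simp add: emeasure_torus_haar_space)

lemma measurable_on_torus:
  fixes f :: "complex ^ 'n::finite \<Rightarrow> 'b::topological_space"
  shows "continuous_on torus f \<Longrightarrow> f \<in> borel_measurable torus_borel"
  by (rule borel_measurable_continuous_on_restrict)

lemma bounded_on_torus:
  fixes f :: "complex ^ 'n::finite \<Rightarrow> 'b::real_normed_vector"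
  assumes "continuous_on torus f"
  obtains B where "\<And>z. z \<in> torus \<Longrightarrow> norm (f z) \<le> B"
proof -
  have "bounded (f ` torus)" by (rule compact_imp_bounded[OF compact_continuous_image[OF assms compact_torus]])
  then show ?thesis using that by (auto simp: bounded_iff)
qed

lemma integrable_on_torus:
  fixes f :: "complex ^ 'n::finite \<Rightarrow> complex"
  assumes M: "finite_measure M" "sets M = sets torus_borel" and f: "continuous_on torus f"
  shows "integrable M f"
proof -
  interpret finite_measure M by fact
  obtain B where B: "\<And>z. z \<in> torus \<Longrightarrow> norm (f z) \<le> B" using bounded_on_torus[OF f] by blast
  have "space M = torus" using sets_eq_imp_space_eq[OF M(2)] by simp
  then show ?thesis
    using measurable_on_torus[OF f] B
    by (intro integrable_const_bound[where B = B]) (auto simp: measurable_cong_sets[OF M(2) refl] intro!: AE_I2)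
qed

lemma measure_angles: "measure lborel (angles :: (real ^ 'n::finite) set) = (2 * pi) ^ CARD('n)"
proof -
  have ne: "(angles :: (real ^ 'n) set) \<noteq> {}" by (auto simp: interval_eq_empty_cart not_less)
  have "measure lborel (angles :: (real ^ 'n) set) = (\<Prod>i\<in>(UNIV :: 'n set). (\<chi> j. 2 * pi) $ i - (0 :: real ^ 'n) $ i)"
    by (rule content_cbox_cart[OF ne])
  then show ?thesis by simp
qed

lemma integral_torus_haar_lborel:
  fixes f :: "complex ^ 'n::finite \<Rightarrow> complex"
  assumes f: "f \<in> borel_measurable torus_borel"
  shows "(\<integral>\<zeta>. f \<zeta> \<partial>torus_haar) = (\<integral>\<theta>. (indicator angles \<theta> / (2 * pi) ^ CARD('n)) *\<^sub>R f (cis_vec \<theta>) \<partial>lborel)"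
proof -
  let ?U = "uniform_measure lborel (angles :: (real ^ 'n) set)"
  have em: "emeasure lborel (angles :: (real ^ 'n) set) = ennreal ((2 * pi) ^ CARD('n))"
    using emeasure_eq_ennreal_measure[of lborel "angles :: (real ^ 'n) set"] emeasure_lborel_cbox_finite[of 0 "\<chi> j::'n. 2 * pi"]
    by (simp add: measure_angles)
  have U: "?U = density lborel (\<lambda>\<theta>. ennreal (indicator angles \<theta> / (2 * pi) ^ CARD('n)))"
    unfolding uniform_measure_def em
    by (rule arg_cong[where f = "density lborel"]) (auto simp: fun_eq_iff divide_ennreal[symmetric] ennreal_indicator split: split_indicator)
  have g: "cis_vec \<in> ?U \<rightarrow>\<^sub>M torus_borel"
    using cis_vec_measurable by (simp add: cis_vec_def[abs_def] cong: measurable_cong_sets)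
  have fg: "(\<lambda>\<theta>. f (cis_vec \<theta>)) \<in> borel_measurable borel"
    using measurable_comp[OF cis_vec_measurable f] by (simp add: o_def cis_vec_def[abs_def])
  have "(\<integral>\<zeta>. f \<zeta> \<partial>torus_haar) = (\<integral>\<theta>. f (cis_vec \<theta>) \<partial>?U)"
    unfolding torus_haar_def using integral_distr[OF g f] by (simp add: cis_vec_def[abs_def])
  also have "\<dots> = (\<integral>\<theta>. (indicator angles \<theta> / (2 * pi) ^ CARD('n)) *\<^sub>R f (cis_vec \<theta>) \<partial>lborel)"
    unfolding U using fg by (intro integral_density) auto
  finally show ?thesis .
qed

lemma integral_torus_haar:
  fixes f :: "complex ^ 'n::finite \<Rightarrow> complex"
  assumes f: "continuous_on torus f"
  shows "(\<integral>\<zeta>. f \<zeta> \<partial>torus_haar) = (1 / (2 * pi) ^ CARD('n)) *\<^sub>R integral angles (\<lambda>\<theta>. f (cis_vec \<theta>))"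
proof -
  have c: "continuous_on angles (\<lambda>\<theta>. f (cis_vec \<theta> :: complex ^ 'n))"
    by (rule continuous_on_compose2[OF f]) (auto intro: continuous_intros)
  have "set_integrable lborel angles (\<lambda>\<theta>. f (cis_vec \<theta> :: complex ^ 'n))"
    unfolding set_integrable_def by (rule borel_integrable_compact[OF compact_cbox c])
  then have "(LINT \<theta>:angles|lborel. f (cis_vec \<theta> :: complex ^ 'n)) = integral angles (\<lambda>\<theta>. f (cis_vec \<theta>))"
    by (rule set_borel_integral_eq_integral)
  then have "integral angles (\<lambda>\<theta>. f (cis_vec \<theta> :: complex ^ 'n)) = (\<integral>\<theta>. indicator angles \<theta> *\<^sub>R f (cis_vec \<theta>) \<partial>lborel)"
    by (simp add: set_lebesgue_integral_def)
  moreover have "(\<integral>\<theta>. (indicator angles \<theta> / (2 * pi) ^ CARD('n)) *\<^sub>R f (cis_vec \<theta>) \<partial>lborel)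
      = (\<integral>\<theta>. (1 / (2 * pi) ^ CARD('n)) *\<^sub>R (indicator angles \<theta> *\<^sub>R f (cis_vec \<theta>)) \<partial>lborel)"
    by (intro Bochner_Integration.integral_cong) (auto simp: split: split_indicator)
  ultimately show ?thesis
    unfolding integral_torus_haar_lborel[OF measurable_on_torus[OF f]] by (simp only: integral_scaleR_right)
qed

text \<open>Lebesgue measure on \<open>\<real>\<^sup>n\<close> is the image of the product measure indexed by the standard basis, so the
  integral of a product of one-variable functions factors.\<close>

lemma integral_torus_haar_prod:
  fixes g :: "'n::finite \<Rightarrow> complex \<Rightarrow> complex"
  assumes g: "\<And>j. continuous_on (sphere 0 1) (g j)"
  shows "(\<integral>\<zeta>. (\<Prod>j\<in>UNIV. g j (\<zeta> $ j)) \<partial>torus_haar) = (\<Prod>j\<in>UNIV. (1 / (2 * pi)) *\<^sub>R integral {0..2*pi} (\<lambda>t. g j (cis t)))"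
proof -
  define h where "h j t = (indicator {0..2*pi} t / (2 * pi)) *\<^sub>R g j (cis t)" for j t
  define ix where "ix = inv_into (UNIV :: 'n set) (\<lambda>j. axis j (1 :: real))"
  have ix: "ix (axis j 1) = j" for j
    unfolding ix_def by (rule inv_into_f_f) (auto simp: inj_on_def axis_eq_axis)
  have gc: "continuous_on S (\<lambda>t. g j (cis t))" for j S
    by (rule continuous_on_compose2[OF g]) (auto intro!: continuous_intros)
  have Basis: "(Basis :: (real ^ 'n) set) = (\<lambda>j. axis j 1) ` UNIV"
    by (auto simp: Basis_vec_def)
  have inj: "inj (\<lambda>j::'n. axis j (1 :: real))" by (auto simp: inj_on_def axis_eq_axis)
  have reindex: "(\<Prod>b\<in>(Basis :: (real ^ 'n) set). F b) = (\<Prod>j\<in>UNIV. F (axis j 1))" for F :: "real ^ 'n \<Rightarrow> complex"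
    unfolding Basis by (subst prod.reindex[OF inj]) simp
  have si: "set_integrable lborel {0..2*pi} (\<lambda>t. g j (cis t))" for j
    unfolding set_integrable_def using borel_integrable_compact[OF compact_Icc gc] .
  have hint: "integrable lborel (h j)" for j
  proof -
    have "integrable lborel (\<lambda>t. (1 / (2 * pi)) *\<^sub>R (indicator {0..2*pi} t *\<^sub>R g j (cis t)))"
      using si[of j] unfolding set_integrable_def by (rule integrable_scaleR_right)
    then show ?thesis by (simp add: h_def[abs_def])
  qed
  have hval: "integral\<^sup>L lborel (h j) = (1 / (2 * pi)) *\<^sub>R integral {0..2*pi} (\<lambda>t. g j (cis t))" for j
  proof -
    have "integral {0..2*pi} (\<lambda>t. g j (cis t)) = (\<integral>t. indicator {0..2*pi} t *\<^sub>R g j (cis t) \<partial>lborel)"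
      using set_borel_integral_eq_integral(2)[OF si] by (simp add: set_lebesgue_integral_def)
    then have "(1 / (2 * pi)) *\<^sub>R integral {0..2*pi} (\<lambda>t. g j (cis t)) =
      (\<integral>t. (1 / (2 * pi)) *\<^sub>R (indicator {0..2*pi} t *\<^sub>R g j (cis t)) \<partial>lborel)"
      by (simp only: integral_scaleR_right)
    then show ?thesis by (simp add: h_def[abs_def])
  qed
  have hm: "h j \<in> borel_measurable borel" for j using borel_measurable_integrable[OF hint[of j]] by simp
  interpret product_sigma_finite "\<lambda>b :: real ^ 'n. lborel :: real measure"
    by (rule product_sigma_finite.intro) (rule sigma_finite_lborel)
  have cont: "continuous_on torus (\<lambda>\<zeta> :: complex ^ 'n. \<Prod>j\<in>UNIV. g j (\<zeta> $ j))"
    by (intro continuous_on_prod continuous_on_compose2[OF g]) (auto intro!: continuous_intros simp: torus_def)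
  \<comment> \<open>The density of the angles is itself a product over the coordinates.\<close>
  have pt: "(indicator angles \<theta> / (2 * pi) ^ CARD('n)) *\<^sub>R (\<Prod>j\<in>UNIV. g j (cis_vec \<theta> $ j)) = (\<Prod>j\<in>UNIV. h j (\<theta> $ j))"
    for \<theta> :: "real ^ 'n"
  proof -
    have "(\<Prod>j\<in>UNIV. h j (\<theta> $ j)) = (\<Prod>j\<in>UNIV. complex_of_real (indicator {0..2*pi} (\<theta> $ j) / (2 * pi))) * (\<Prod>j\<in>UNIV. g j (cis_vec \<theta> $ j))"
      unfolding h_def scaleR_conv_of_real prod.distrib[symmetric] cis_vec_nth ..
    moreover have "(\<Prod>j\<in>(UNIV :: 'n set). indicator {0..2*pi} (\<theta> $ j) / (2 * pi)) = indicator angles \<theta> / (2 * pi) ^ CARD('n)"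
    proof (cases "\<theta> \<in> angles")
      case True
      then have "\<theta> $ j \<in> {0..2*pi}" for j by (simp add: mem_box_cart)
      then show ?thesis using True by (simp add: power_one_over)
    next
      case False
      then obtain j where "\<theta> $ j \<notin> {0..2*pi}" by (auto simp: mem_box_cart)
      then have "indicator {0..2*pi} (\<theta> $ j) / (2 * pi) = 0" by simp
      then have "(\<Prod>j\<in>(UNIV :: 'n set). indicator {0..2*pi} (\<theta> $ j) / (2 * pi)) = 0" by (intro prod_zero) auto
      then show ?thesis using False by simp
    qed
    ultimately show ?thesis by (simp only: of_real_prod[symmetric] scaleR_conv_of_real)
  qed
  have "(\<integral>\<zeta>. (\<Prod>j\<in>UNIV. g j (\<zeta> $ j)) \<partial>torus_haar) = (\<integral>\<theta>. (\<Prod>j\<in>UNIV. h j (\<theta> $ j)) \<partial>(lborel :: (real ^ 'n) measure))"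
    unfolding integral_torus_haar_lborel[OF measurable_on_torus[OF cont]] pt ..
  also have "\<dots> = (\<integral>f. (\<Prod>j\<in>UNIV. h j ((\<Sum>b\<in>Basis. f b *\<^sub>R b) $ j)) \<partial>(\<Pi>\<^sub>M b\<in>(Basis :: (real ^ 'n) set). lborel))"
    unfolding lborel_eq[where 'a = "real ^ 'n"]
    using hm by (subst integral_distr) (auto simp: measurable_cong_sets[OF sets_PiM_cong[OF refl sets_lborel] refl])
  also have "\<dots> = (\<integral>f. (\<Prod>b\<in>Basis. h (ix b) (f b)) \<partial>(\<Pi>\<^sub>M b\<in>(Basis :: (real ^ 'n) set). lborel))"
  proof (intro Bochner_Integration.integral_cong refl)
    fix f :: "real ^ 'n \<Rightarrow> real"
    have "(\<Sum>b\<in>Basis. f b *\<^sub>R b) $ j = f (axis j 1)" for j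
    proof -
      have "(\<Sum>b\<in>Basis. f b *\<^sub>R b) $ j = (\<Sum>b\<in>Basis. f b *\<^sub>R b) \<bullet> axis j 1" by (simp add: cart_eq_inner_axis)
      also have "\<dots> = f (axis j 1)" by (rule inner_sum_left_Basis) (auto simp: Basis)
      finally show ?thesis .
    qed
    then show "(\<Prod>j\<in>UNIV. h j ((\<Sum>b\<in>Basis. f b *\<^sub>R b) $ j)) = (\<Prod>b\<in>Basis. h (ix b) (f b))"
      unfolding reindex by (simp add: ix)
  qed
  also have "\<dots> = (\<Prod>b\<in>(Basis :: (real ^ 'n) set). integral\<^sup>L lborel (h (ix b)))"
    by (rule product_integral_prod) (auto simp: hint)
  also have "\<dots> = (\<Prod>j\<in>UNIV. (1 / (2 * pi)) *\<^sub>R integral {0..2*pi} (\<lambda>t. g j (cis t)))"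
    unfolding reindex by (simp add: ix hval)
  finally show ?thesis .
qed

lemma integral_cis_powi: "integral {0..2*pi} (\<lambda>t. cis t powi m) = (if m = 0 then of_real (2 * pi) else 0)"
proof (cases "m = 0")
  case False
  have p: "cis t powi m = cis (of_int m * t)" for t
    by (rule cis_power_int)
  have "((\<lambda>t. cis (of_int m * t) / (\<i> * of_int m)) has_vector_derivative cis (of_int m * t)) (at t within {0..2*pi})" for t
  proof -
    have "((\<lambda>t. cis (of_int m * t)) has_vector_derivative (of_int m :: real) *\<^sub>R (\<i> * cis (of_int m * t))) (at t within {0..2*pi})"
      using has_derivative_cis[of "\<lambda>t. of_int m * t" "\<lambda>t. of_int m * t" t "{0..2*pi}"]
      by (auto simp: has_vector_derivative_def scaleR_conv_of_real algebra_simps has_derivative_mult_right intro!: derivative_eq_intros)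
    then have "((\<lambda>t. cis (of_int m * t) / (\<i> * of_int m)) has_vector_derivative ((of_int m :: real) *\<^sub>R (\<i> * cis (of_int m * t))) / (\<i> * of_int m)) (at t within {0..2*pi})"
      by (rule has_vector_derivative_divide)
    then show ?thesis using False by (simp add: scaleR_conv_of_real)
  qed
  then have "((\<lambda>t. cis (of_int m * t)) has_integral (cis (of_int m * (2 * pi)) / (\<i> * of_int m) - cis (of_int m * 0) / (\<i> * of_int m))) {0..2*pi}"
    by (intro fundamental_theorem_of_calculus) auto
  moreover have "cis (of_int m * (2 * pi)) = 1" using cis_multiple_2pi[of "of_int m"] by (simp add: mult.commute)
  ultimately show ?thesis using False by (simp add: p integral_unique)
qed (simp add: scaleR_conv_of_real)

lemma integral_mon: "(\<integral>\<zeta>. mon k \<zeta> \<partial>torus_haar) = (if k = (\<lambda>_. 0) then 1 else 0)"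
proof -
  have "(\<integral>\<zeta>. mon k \<zeta> \<partial>torus_haar) = (\<Prod>j\<in>UNIV. (1 / (2 * pi)) *\<^sub>R integral {0..2*pi} (\<lambda>t. cis t powi k j))"
    unfolding mon_def by (rule integral_torus_haar_prod) (auto intro!: continuous_intros)
  also have "\<dots> = (\<Prod>j\<in>UNIV. if k j = 0 then 1 else 0)"
    by (intro prod.cong refl) (auto simp: integral_cis_powi scaleR_conv_of_real)
  also have "\<dots> = (if k = (\<lambda>_. 0) then 1 else 0)"
    by (auto simp: fun_eq_iff prod_zero_iff)
  finally show ?thesis .
qed

lemma torus_mult: "w \<in> torus \<Longrightarrow> z \<in> torus \<Longrightarrow> w * z \<in> torus"
  by (simp add: torus_def norm_mult)

lemma continuous_on_torus_rotate:
  fixes f :: "complex ^ 'n::finite \<Rightarrow> complex"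
  assumes "continuous_on torus f" "w \<in> torus"
  shows "continuous_on torus (\<lambda>z. f (w * z))"
proof -
  have "continuous_on torus (\<lambda>z. \<chi> j. w $ j * z $ j)" by (intro continuous_intros)
  then have "continuous_on torus (\<lambda>z. w * z)" by (simp add: times_vec_def)
  then show ?thesis
    by (rule continuous_on_compose2[OF assms(1)]) (auto simp: torus_mult assms)
qed

lemma norm_integral_torus_le:
  fixes f :: "complex ^ 'n::finite \<Rightarrow> complex"
  assumes M: "finite_measure M" "sets M = sets torus_borel" and f: "continuous_on torus f"
    and B: "\<And>z. z \<in> torus \<Longrightarrow> norm (f z) \<le> B"
  shows "norm (\<integral>z. f z \<partial>M) \<le> measure M torus * B"
proof -
  interpret finite_measure M by fact
  have sp: "space M = torus" using sets_eq_imp_space_eq[OF M(2)] by simp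
  have "norm (\<integral>z. f z \<partial>M) \<le> (\<integral>z. norm (f z) \<partial>M)" by (rule integral_norm_bound)
  also have "\<dots> \<le> (\<integral>z. B \<partial>M)"
    by (rule integral_mono) (use integrable_on_torus[OF M f] B sp in auto)
  finally show ?thesis by (simp add: sp)
qed

text \<open>Both sides are bounded functionals of \<open>f\<close>. On a monomial, which is a character, they can differ
  only if the monomial is not constant, and then both vanish.\<close>

lemma integral_torus_haar_rotate:
  fixes f :: "complex ^ 'n::finite \<Rightarrow> complex"
  assumes f: "continuous_on torus f" and w: "w \<in> torus"
  shows "(\<integral>\<zeta>. f (w * \<zeta>) \<partial>torus_haar) = (\<integral>\<zeta>. f \<zeta> \<partial>torus_haar)"
proof -
  interpret prob_space "torus_haar :: (complex ^ 'n) measure" by (rule prob_space_torus_haar)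
  have i: "integrable torus_haar g" if "continuous_on torus g" for g :: "complex ^ 'n \<Rightarrow> complex"
    by (rule integrable_on_torus[OF _ _ that]) (auto intro: finite_measure_axioms)
  note r = continuous_on_torus_rotate[OF _ w]
  have "(\<integral>\<zeta>. f (w * \<zeta>) \<partial>torus_haar) - (\<integral>\<zeta>. f \<zeta> \<partial>torus_haar) = 0"
  proof (rule functional_eq_0_if_monomials[where \<Lambda> = "\<lambda>f. (\<integral>\<zeta>. f (w * \<zeta>) \<partial>torus_haar) - (\<integral>\<zeta>. f \<zeta> \<partial>torus_haar)" and C = 2, OF _ _ _ _ f])
    fix g :: "complex ^ 'n \<Rightarrow> complex" and B assume g: "continuous_on torus g" and B: "\<And>z :: complex ^ 'n. z \<in> torus \<Longrightarrow> norm (g z) \<le> B"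
    have "norm (\<integral>\<zeta>. g (w * \<zeta>) \<partial>torus_haar) \<le> measure (torus_haar :: (complex ^ 'n) measure) torus * B"
      by (rule norm_integral_torus_le) (auto simp: B torus_mult w r g finite_measure_axioms)
    moreover have "norm (\<integral>\<zeta>. g \<zeta> \<partial>torus_haar) \<le> measure (torus_haar :: (complex ^ 'n) measure) torus * B"
      by (rule norm_integral_torus_le) (auto simp: B g finite_measure_axioms)
    ultimately show "norm ((\<integral>\<zeta>. g (w * \<zeta>) \<partial>torus_haar) - (\<integral>\<zeta>. g \<zeta> \<partial>torus_haar)) \<le> 2 * B"
      using prob_space norm_triangle_ineq4[of "(\<integral>\<zeta>. g (w * \<zeta>) \<partial>torus_haar)" "(\<integral>\<zeta>. g \<zeta> \<partial>torus_haar)"] by simp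
  next
    fix k
    show "(\<integral>\<zeta>. mon k (w * \<zeta>) \<partial>torus_haar) - (\<integral>\<zeta>. mon k \<zeta> \<partial>torus_haar) = 0"
      by (auto simp: mon_mult integral_mon)
  qed (use i r in \<open>auto simp: algebra_simps\<close>)
  then show ?thesis by simp
qed

text \<open>The functional given by integration against \<open>F\<close> vanishes on monomials, hence on the conjugate of \<open>F\<close>,
  so the integral of \<open>\<bar>F\<bar>\<^sup>2\<close> is \<open>0\<close>.\<close>

lemma continuous_eq_0_if_fourier_0:
  fixes F :: "complex ^ 'n::finite \<Rightarrow> complex"
  assumes F: "continuous_on torus F" and 0: "\<And>k. (\<integral>\<zeta>. F \<zeta> * mon k \<zeta> \<partial>torus_haar) = 0" and z: "z \<in> torus"
  shows "F z = 0"
proof -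
  interpret prob_space "torus_haar :: (complex ^ 'n) measure" by (rule prob_space_torus_haar)
  have i: "integrable torus_haar g" if "continuous_on torus g" for g :: "complex ^ 'n \<Rightarrow> complex"
    by (rule integrable_on_torus[OF _ _ that]) (auto intro: finite_measure_axioms)
  obtain BF where BF: "\<And>z. z \<in> torus \<Longrightarrow> norm (F z) \<le> BF" using bounded_on_torus[OF F] by blast
  have BF0: "BF \<ge> 0" using BF[OF z] norm_ge_zero order_trans by blast
  have c: "continuous_on torus (\<lambda>\<zeta>. F \<zeta> * g \<zeta>)" if "continuous_on torus g" for g
    by (intro continuous_intros F that)
  have "(\<integral>\<zeta>. F \<zeta> * cnj (F \<zeta>) \<partial>torus_haar) = 0"
  proof (rule functional_eq_0_if_monomials[where \<Lambda> = "\<lambda>f. \<integral>\<zeta>. F \<zeta> * f \<zeta> \<partial>torus_haar" and C = BF])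
    fix g :: "complex ^ 'n \<Rightarrow> complex" and B assume g: "continuous_on torus g" and B: "\<And>z :: complex ^ 'n. z \<in> torus \<Longrightarrow> norm (g z) \<le> B"
    have "norm (\<integral>\<zeta>. F \<zeta> * g \<zeta> \<partial>torus_haar) \<le> measure (torus_haar :: (complex ^ 'n) measure) torus * (BF * B)"
      by (rule norm_integral_torus_le)
         (auto simp: norm_mult c g finite_measure_axioms intro!: mult_mono B BF BF0)
    then show "norm (\<integral>\<zeta>. F \<zeta> * g \<zeta> \<partial>torus_haar) \<le> BF * B"
      using prob_space by simp
  next
    fix g c assume "continuous_on torus (g :: complex ^ 'n \<Rightarrow> complex)"
    have "(\<integral>\<zeta>. F \<zeta> * (c * g \<zeta>) \<partial>torus_haar) = (\<integral>\<zeta>. c * (F \<zeta> * g \<zeta>) \<partial>torus_haar)"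
      by (simp add: ac_simps)
    then show "(\<integral>\<zeta>. F \<zeta> * (c * g \<zeta>) \<partial>torus_haar) = c * (\<integral>\<zeta>. F \<zeta> * g \<zeta> \<partial>torus_haar)" by simp
  next
    show "continuous_on torus (\<lambda>x. cnj (F x))" by (intro continuous_intros F)
  qed (use i c 0 in \<open>auto simp: distrib_left\<close>)
  then have "integral angles (\<lambda>\<theta>. F (cis_vec \<theta>) * cnj (F (cis_vec \<theta>))) = 0"
    by (subst (asm) integral_torus_haar) (auto intro!: continuous_intros F)
  moreover have cF: "continuous_on angles (\<lambda>\<theta>. F (cis_vec \<theta>))"
    by (rule continuous_on_compose2[OF F]) (auto intro: continuous_intros)
  then have "(\<lambda>\<theta>. F (cis_vec \<theta>) * cnj (F (cis_vec \<theta>))) integrable_on angles"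
    by (intro integrable_continuous continuous_intros)
  ultimately have "((\<lambda>\<theta>. F (cis_vec \<theta>) * cnj (F (cis_vec \<theta>))) has_integral 0) angles"
    by (metis integrable_integral)
  then have "((\<lambda>\<theta>. Re (F (cis_vec \<theta>) * cnj (F (cis_vec \<theta>)))) has_integral Re 0) angles"
    by (rule has_integral_Re)
  then have I: "((\<lambda>\<theta>. (norm (F (cis_vec \<theta>)))\<^sup>2) has_integral 0) angles"
    by (simp add: complex_mult_cnj cmod_power2)
  obtain \<theta> where \<theta>: "\<theta> \<in> angles" "z = cis_vec \<theta>" using torus_eq_cis_vec[OF z] .
  have "(norm (F (cis_vec \<theta>)))\<^sup>2 = 0"
  proof (rule has_integral_0_cbox_imp_0[OF _ _ I _ \<theta>(1)])
    show "continuous_on angles (\<lambda>x. (cmod (F (cis_vec x)))\<^sup>2)" by (intro continuous_intros cF)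
    show "box 0 (\<chi> j::'n. 2 * pi) \<noteq> {}" by (auto simp: interval_eq_empty_cart not_le)
  qed auto
  then show ?thesis using \<theta> by simp
qed

section \<open>Weak sequential compactness of measures on the torus\<close>

text \<open>The binary digit of weight \<open>2\<^bsup>-k-1\<^esup>\<close> of the fractional part of \<open>x\<close>.\<close>

definition binary_digit :: "real \<Rightarrow> nat \<Rightarrow> real" where
  "binary_digit x k = of_int (\<lfloor>2 ^ Suc k * x\<rfloor> - 2 * \<lfloor>2 ^ k * x\<rfloor>)"

lemma binary_digit_cases: "binary_digit x k = 0 \<or> binary_digit x k = 1"
proof -
  have "2 * \<lfloor>2 ^ k * x\<rfloor> \<le> \<lfloor>2 ^ Suc k * x\<rfloor>" "\<lfloor>2 ^ Suc k * x\<rfloor> < 2 * \<lfloor>2 ^ k * x\<rfloor> + 2"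
    by (simp_all add: le_floor_iff floor_less_iff mult.assoc) linarith+
  then have "\<lfloor>2 ^ Suc k * x\<rfloor> - 2 * \<lfloor>2 ^ k * x\<rfloor> = 0 \<or> \<lfloor>2 ^ Suc k * x\<rfloor> - 2 * \<lfloor>2 ^ k * x\<rfloor> = 1" by arith
  then show ?thesis unfolding binary_digit_def by auto
qed

lemma binary_digit_sums: "(\<lambda>k. binary_digit x k / 2 ^ Suc k) sums (x - of_int \<lfloor>x\<rfloor>)"
proof -
  have eq: "(\<Sum>k<n. binary_digit x k / 2 ^ Suc k) = of_int \<lfloor>2 ^ n * x\<rfloor> / 2 ^ n - of_int \<lfloor>x\<rfloor>" for n
    by (induction n) (auto simp: binary_digit_def field_simps)
  have "(\<lambda>n. of_int \<lfloor>2 ^ n * x\<rfloor> / 2 ^ n) \<longlonglongrightarrow> x"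
  proof (rule tendsto_sandwich)
    show "\<forall>\<^sub>F n in sequentially. x - (1 / 2) ^ n \<le> of_int \<lfloor>2 ^ n * x\<rfloor> / 2 ^ n"
    proof (intro always_eventually allI)
      fix n :: nat
      have "2 ^ n * x - 1 \<le> of_int \<lfloor>2 ^ n * x\<rfloor>" by linarith
      then have "(2 ^ n * x - 1) / 2 ^ n \<le> of_int \<lfloor>2 ^ n * x\<rfloor> / 2 ^ n" by (intro divide_right_mono) auto
      moreover have "(2 ^ n * x - 1) / 2 ^ n = x - (1 / 2) ^ n" by (simp add: diff_divide_distrib power_one_over)
      ultimately show "x - (1 / 2) ^ n \<le> of_int \<lfloor>2 ^ n * x\<rfloor> / 2 ^ n" by simp
    qed
    show "\<forall>\<^sub>F n in sequentially. of_int \<lfloor>2 ^ n * x\<rfloor> / 2 ^ n \<le> x"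
    proof (intro always_eventually allI)
      fix n :: nat
      have "of_int \<lfloor>2 ^ n * x\<rfloor> \<le> 2 ^ n * x" by linarith
      then show "of_int \<lfloor>2 ^ n * x\<rfloor> / 2 ^ n \<le> x" by (simp add: field_simps)
    qed
    have "(\<lambda>n. x - (1 / 2) ^ n) \<longlonglongrightarrow> x - 0" by (intro tendsto_intros LIMSEQ_realpow_zero) auto
    then show "(\<lambda>n. x - (1 / 2) ^ n) \<longlonglongrightarrow> x" by simp
  qed simp
  then have "(\<lambda>n. of_int \<lfloor>2 ^ n * x\<rfloor> / 2 ^ n - of_int \<lfloor>x\<rfloor>) \<longlonglongrightarrow> x - of_int \<lfloor>x\<rfloor>" by (intro tendsto_intros)
  then show ?thesis unfolding sums_def eq .
qed

text \<open>Schoenberg's switching function: it reads off ternary digits from \<open>{0, 2}\<close>.\<close>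

definition switch :: "real \<Rightarrow> real" where
  "switch x = max 0 (min 1 (1 / 2 - cos (pi * x)))"

lemma ternary_tail:
  fixes b :: "nat \<Rightarrow> real"
  assumes b: "\<And>m. b m = 0 \<or> b m = 1"
  shows "summable (\<lambda>m. 2 * b m / 3 ^ Suc m)" "0 \<le> (\<Sum>m. 2 * b m / 3 ^ Suc m)" "(\<Sum>m. 2 * b m / 3 ^ Suc m) \<le> 1"
proof -
  have g: "(\<lambda>m. (2 / 3) * (1 / 3 :: real) ^ m) sums 1"
    using sums_mult[OF geometric_sums[of "1 / 3 :: real"], of "2 / 3"] by simp
  have le: "0 \<le> 2 * b m / 3 ^ Suc m" "2 * b m / 3 ^ Suc m \<le> (2 / 3) * (1 / 3) ^ m" for m
    using b[of m] by (auto simp: field_simps)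
  show s: "summable (\<lambda>m. 2 * b m / 3 ^ Suc m)"
    by (rule summable_comparison_test'[OF sums_summable[OF g], of 0]) (simp only: real_norm_def abs_of_nonneg[OF le(1)] le(2))
  show "0 \<le> (\<Sum>m. 2 * b m / 3 ^ Suc m)" by (rule suminf_nonneg[OF s]) (rule le)
  show "(\<Sum>m. 2 * b m / 3 ^ Suc m) \<le> 1"
    using suminf_le[OF le(2) s sums_summable[OF g]] sums_unique[OF g] by simp
qed

text \<open>Multiplication by \<open>3\<^sup>M\<close> turns the digits before position \<open>M\<close> into an even integer, because all
  digits are \<open>0\<close> or \<open>2\<close>; the rest lies in \<open>[0, 1/3]\<close> or \<open>[2/3, 1]\<close> according to the digit at \<open>M\<close>, and there the
  \<open>2\<close>-periodic function \<open>switch\<close> is constant.\<close>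

lemma switch_ternary:
  fixes b :: "nat \<Rightarrow> real"
  assumes b: "\<And>m. b m = 0 \<or> b m = 1"
  shows "switch (3 ^ M * (\<Sum>m. 2 * b m / 3 ^ Suc m)) = b M"
proof -
  note s = ternary_tail[OF b]
  define y where "y = (\<Sum>l. 2 * b (l + M) / 3 ^ Suc l)"
  define R where "R = (\<Sum>l. 2 * b (l + Suc M) / 3 ^ Suc l)"
  have R: "0 \<le> R" "R \<le> 1" unfolding R_def by (rule ternary_tail; use b in blast)+
  have sM: "summable (\<lambda>l. 2 * b (l + M) / 3 ^ Suc l)" by (rule ternary_tail) (use b in blast)
  have "y = 2 * b M / 3 + (\<Sum>l. 2 * b (Suc l + M) / 3 ^ Suc (Suc l))"
    unfolding y_def using suminf_split_head[OF sM] by simp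
  also have "(\<Sum>l. 2 * b (Suc l + M) / 3 ^ Suc (Suc l)) = R / 3"
  proof -
    have "(\<lambda>l. (2 * b (l + Suc M) / 3 ^ Suc l) / 3) sums (R / 3)"
      unfolding R_def by (intro sums_divide summable_sums ternary_tail) (use b in blast)
    then show ?thesis by (simp add: sums_unique[symmetric])
  qed
  finally have y: "y = 2 * b M / 3 + R / 3" .
  have "3 ^ M * (\<Sum>m<M. 2 * b m / 3 ^ Suc m) \<in> (\<lambda>n. 2 * of_int n) ` UNIV"
  proof (induction M)
    case 0
    then show ?case by (auto intro: image_eqI[of _ _ 0])
  next
    case (Suc M)
    then obtain n where n: "3 ^ M * (\<Sum>m<M. 2 * b m / 3 ^ Suc m) = 2 * of_int n" by auto
    have "3 ^ Suc M * (\<Sum>m<Suc M. 2 * b m / 3 ^ Suc m) = 3 * (3 ^ M * (\<Sum>m<M. 2 * b m / 3 ^ Suc m)) + 2 * b M"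
      by (simp add: field_simps)
    also have "\<dots> = 2 * of_int (3 * n + \<lfloor>b M\<rfloor>)" unfolding n using b[of M] by auto
    finally show ?case by blast
  qed
  then obtain n where n: "3 ^ M * (\<Sum>m<M. 2 * b m / 3 ^ Suc m) = 2 * of_int n" by auto
  have "(\<Sum>m. 2 * b m / 3 ^ Suc m) = (\<Sum>l. 2 * b (l + M) / 3 ^ Suc (l + M)) + (\<Sum>m<M. 2 * b m / 3 ^ Suc m)"
    by (rule suminf_split_initial_segment[OF s(1)])
  moreover have "(\<Sum>l. 2 * b (l + M) / 3 ^ Suc (l + M)) = y / 3 ^ M"
  proof -
    have "(\<lambda>l. (2 * b (l + M) / 3 ^ Suc l) / 3 ^ M) sums (y / 3 ^ M)"
      unfolding y_def by (intro sums_divide summable_sums sM)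
    then show ?thesis by (simp add: sums_unique[symmetric] power_add mult.assoc)
  qed
  ultimately have "3 ^ M * (\<Sum>m. 2 * b m / 3 ^ Suc m) = y + 2 * of_int n"
    using n by (simp add: field_simps)
  then have "cos (pi * (3 ^ M * (\<Sum>m. 2 * b m / 3 ^ Suc m))) = cos (pi * y + 2 * pi * of_int n)"
    by (simp add: algebra_simps)
  also have "\<dots> = cos (pi * y)" by (simp add: cos_add)
  finally have c: "cos (pi * (3 ^ M * (\<Sum>m. 2 * b m / 3 ^ Suc m))) = cos (pi * y)" .
  show ?thesis
  proof (cases "b M = 0")
    case True
    have "cos (pi * y) \<ge> cos (pi / 3)" using True y R by (intro cos_monotone_0_pi_le) auto
    then have "cos (pi * y) \<ge> 1 / 2" by (simp only: cos_60)
    then show ?thesis using True unfolding switch_def c by simp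
  next
    case False
    then have "b M = 1" using b[of M] by simp
    moreover have "cos (pi * y) \<le> cos (pi - pi / 3)"
      using \<open>b M = 1\<close> y R by (intro cos_monotone_0_pi_le) (auto simp: field_simps)
    then have "cos (pi * y) \<le> - 1 / 2" by (simp add: cos_120)
    ultimately show ?thesis unfolding switch_def c by simp
  qed
qed

text \<open>One coordinate of Schoenberg's space-filling curve: the ternary digits of \<open>t\<close> at the positions
  paired with \<open>j\<close> are read as binary digits.\<close>

definition curve_coord :: "'n::finite \<Rightarrow> real \<Rightarrow> real" where
  "curve_coord j t = (\<Sum>k. switch (3 ^ prod_encode (to_nat j, k) * t) / 2 ^ Suc k)"

definition torus_curve :: "real \<Rightarrow> complex ^ 'n::finite" where
  "torus_curve t = (\<chi> j. cis (2 * pi * curve_coord j t))"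

text \<open>A Borel right inverse of the curve: the binary digits of all angles, in units of a full turn, are
  interleaved into a single ternary expansion with digits \<open>0\<close> and \<open>2\<close>.\<close>

definition ternary_code :: "real ^ 'n::finite \<Rightarrow> real" where
  "ternary_code \<theta> = (\<Sum>m. 2 * binary_digit (\<theta> $ from_nat (fst (prod_decode m)) / (2 * pi)) (snd (prod_decode m)) / 3 ^ Suc m)"

lemma ternary_code_bounds: "0 \<le> ternary_code \<theta>" "ternary_code \<theta> \<le> 1"
  unfolding ternary_code_def by (rule ternary_tail; rule binary_digit_cases)+

lemma measurable_ternary_code: "ternary_code \<in> borel_measurable (borel :: (real ^ 'n::finite) measure)"
  unfolding ternary_code_def binary_digit_def by measurable

lemma torus_curve_ternary_code: "torus_curve (ternary_code \<theta>) = cis_vec \<theta>"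
proof -
  have "cis (2 * pi * curve_coord j (ternary_code \<theta>)) = cis (\<theta> $ j)" for j
  proof -
    let ?b = "\<lambda>m. binary_digit (\<theta> $ from_nat (fst (prod_decode m)) / (2 * pi)) (snd (prod_decode m))"
    have "switch (3 ^ prod_encode (to_nat j, k) * ternary_code \<theta>) = binary_digit (\<theta> $ j / (2 * pi)) k" for k
      unfolding ternary_code_def by (subst switch_ternary) (auto simp: binary_digit_cases)
    then have "curve_coord j (ternary_code \<theta>) = \<theta> $ j / (2 * pi) - of_int \<lfloor>\<theta> $ j / (2 * pi)\<rfloor>"
      unfolding curve_coord_def using binary_digit_sums[of "\<theta> $ j / (2 * pi)"] by (simp add: sums_unique[symmetric])
    then have "2 * pi * curve_coord j (ternary_code \<theta>) = \<theta> $ j - 2 * pi * of_int \<lfloor>\<theta> $ j / (2 * pi)\<rfloor>"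
      by (simp add: field_simps)
    moreover have "cis (\<theta> $ j - 2 * pi * of_int n) = cis (\<theta> $ j)" for n :: int
      using cis_multiple_2pi[of "of_int n"] by (simp add: mult.commute flip: cis_divide)
    ultimately show ?thesis by simp
  qed
  then show ?thesis by (simp add: torus_curve_def cis_vec_def)
qed

lemma torus_curve_torus [simp]: "torus_curve t \<in> torus"
  by (simp add: torus_def torus_curve_def)

lemma continuous_torus_curve: "continuous_on UNIV (torus_curve :: real \<Rightarrow> complex ^ 'n::finite)"
proof -
  have "continuous_on UNIV (curve_coord j)" for j :: 'n
  proof (rule uniform_limit_theorem)
    show "uniform_limit UNIV (\<lambda>n t. \<Sum>k<n. switch (3 ^ prod_encode (to_nat j, k) * t) / 2 ^ Suc k) (curve_coord j) sequentially"
      unfolding curve_coord_def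
    proof (rule Weierstrass_m_test)
      fix n and x :: real
      have "\<bar>switch y\<bar> \<le> 1" for y by (auto simp: switch_def)
      then show "norm (switch (3 ^ prod_encode (to_nat j, n) * x) / 2 ^ Suc n) \<le> (1 / 2) * (1 / 2) ^ n"
        by (simp add: field_simps)
      show "summable (\<lambda>n. (1 / 2) * (1 / 2 :: real) ^ n)" by (intro summable_mult summable_geometric) simp
    qed
    show "\<forall>\<^sub>F n in sequentially. continuous_on UNIV (\<lambda>t. \<Sum>k<n. switch (3 ^ prod_encode (to_nat j, k) * t) / 2 ^ Suc k)"
      unfolding switch_def by (intro always_eventually allI continuous_intros) auto
  qed simp
  then show ?thesis
    unfolding torus_curve_def by (intro continuous_on_vec_lambda continuous_on_cis continuous_intros)
qed

text \<open>The measures are normalized, transported to \<open>[0,1]\<close> by \<open>ternary_code\<close>, where Helly's theorem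
  applies, and the limit is pushed forward along the continuous curve. A null measure is replaced by
  a point mass, which is harmless because its total mass \<open>0\<close> is kept as a separate factor.\<close>

theorem torus_weak_compactness:
  fixes D :: "nat \<Rightarrow> (real ^ 'n::finite) measure"
  assumes sets: "\<And>i. sets (D i) = sets borel" and C: "\<And>i. emeasure (D i) UNIV \<le> ennreal C"
  shows "\<exists>r N. strict_mono (r :: nat \<Rightarrow> nat) \<and> finite_measure N \<and> sets N = sets (torus_borel :: (complex ^ 'n) measure) \<and>
     (\<forall>f :: complex ^ 'n \<Rightarrow> complex. continuous_on torus f \<longrightarrow>
        (\<lambda>i. \<integral>\<theta>. f (cis_vec \<theta>) \<partial>D (r i)) \<longlonglongrightarrow> (\<integral>\<zeta>. f \<zeta> \<partial>N))"
proof -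
  have sp: "space (D i) = UNIV" for i using sets_eq_imp_space_eq[OF sets[of i]] by simp
  have fin: "finite_measure (D i)" for i
    by (rule finite_measureI) (use C[of i] in \<open>auto simp: sp top_unique\<close>)
  define m where "m i = measure (D i) UNIV" for i
  have em: "emeasure (D i) UNIV = ennreal (m i)" for i
    using finite_measure.emeasure_eq_measure[OF fin] by (simp add: m_def)
  have m: "0 \<le> m i" "m i \<le> max 0 C" for i
    using C[of i] by (auto simp: m_def em[unfolded m_def] ennreal_le_iff2)
  obtain m0 r0 where r0: "strict_mono r0" "(m \<circ> r0) \<longlonglongrightarrow> m0" and m0: "m0 \<in> {0..max 0 C}"
    using compact_imp_seq_compact[OF compact_Icc, of 0 "max 0 C"] m unfolding seq_compact_def
    by (metis atLeastAtMost_iff)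
  have meas: "ternary_code \<in> borel_measurable (D i)" for i
    using measurable_ternary_code measurable_cong_sets[OF sets refl] by blast
  \<comment> \<open>The normalized images on the line; when \<open>m i = 0\<close> any probability measure will do.\<close>
  define P where "P i = (if m i = 0 then return borel 0 else distr (density (D i) (\<lambda>_. ennreal (1 / m i))) borel ternary_code)" for i
  have Psets: "sets (P i) = sets borel" for i by (simp add: P_def)
  have meas': "ternary_code \<in> borel_measurable (density (D i) g)" for i g
    using meas by simp
  have Pprob: "prob_space (P i)" for i
  proof (cases "m i = 0")
    case True
    then show ?thesis by (simp add: P_def prob_space_return)
  next
    case False
    then have "m i > 0" using m(1)[of i] by simp
    have "emeasure (density (D i) (\<lambda>_. ennreal (1 / m i))) UNIV = ennreal (1 / m i) * ennreal (m i)"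
      using em sp[of i] sets.top[of "D i"] by (simp add: emeasure_density nn_integral_cmult_indicator)
    also have "\<dots> = 1" using \<open>m i > 0\<close> by (simp flip: ennreal_mult)
    finally have "prob_space (density (D i) (\<lambda>_. ennreal (1 / m i)))"
      by (intro prob_spaceI) (simp add: sp)
    then show ?thesis using False unfolding P_def by (simp add: prob_space.prob_space_distr[OF _ meas'])
  qed
  have Prd: "real_distribution (P i)" for i
    using Pprob[of i] Psets[of i] by (auto simp: real_distribution_def real_distribution_axioms_def)
  have P1: "measure (P i) {-1<..1} = 1" for i
  proof -
    have "emeasure (P i) {-1<..1} = emeasure (P i) (space (P i))"
    proof (cases "m i = 0")
      case False
      have "ternary_code -` {-1<..1} = (UNIV :: (real ^ 'n) set)"
        using ternary_code_bounds by (force intro: less_le_trans[of "-1" 0])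
      then show ?thesis using False by (simp add: P_def emeasure_distr[OF meas'] sp)
    qed (simp add: P_def)
    then show ?thesis using prob_space.emeasure_space_1[OF Pprob[of i]] by (simp add: measure_def)
  qed
  have "tight P"
    unfolding tight_def
  proof (intro conjI allI impI)
    fix e :: real assume "e > 0"
    then have "\<forall>n. 1 - e < measure (P n) {- 1<..1}" by (simp add: P1)
    then show "\<exists>a b. a < b \<and> (\<forall>n. 1 - e < measure (P n) {a<..b})"
      by (intro exI[of _ "- 1"] exI[of _ 1]) auto
  qed (rule Prd)
  then obtain r1 Q where r1: "strict_mono r1" and Q: "real_distribution Q" and w: "weak_conv_m (P \<circ> r0 \<circ> r1) Q"
    using tight_imp_convergent_subsubsequence r0(1) by blast
  interpret Q: real_distribution Q by fact
  have mc: "torus_curve \<in> Q \<rightarrow>\<^sub>M (torus_borel :: (complex ^ 'n) measure)"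
  proof (rule measurable_restrict_space2)
    show "(torus_curve :: real \<Rightarrow> complex ^ 'n) \<in> borel_measurable Q"
      unfolding measurable_cong_sets[OF Q.events_eq_borel refl]
      by (rule borel_measurable_continuous_onI[OF continuous_torus_curve])
  qed simp
  define N where "N = density (distr Q torus_borel torus_curve) (\<lambda>_ :: complex ^ 'n. ennreal m0)"
  have "finite_measure N"
  proof (rule finite_measureI)
    interpret Qd: prob_space "distr Q torus_borel torus_curve :: (complex ^ 'n) measure"
      by (rule Q.prob_space_distr[OF mc])
    have "emeasure N (space N) = ennreal m0 * emeasure (distr Q torus_borel torus_curve :: (complex ^ 'n) measure) (space (distr Q torus_borel torus_curve))"
      unfolding N_def space_density by (rule emeasure_density_const) auto
    then show "emeasure N (space N) \<noteq> \<infinity>"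
      unfolding Qd.emeasure_space_1 by simp
  qed
  moreover have "sets N = sets (torus_borel :: (complex ^ 'n) measure)" by (simp add: N_def)
  moreover have "strict_mono (r0 \<circ> r1)" using r0 r1 by (simp add: strict_mono_o)
  moreover have "(\<lambda>i. \<integral>\<theta>. f (cis_vec \<theta>) \<partial>D ((r0 \<circ> r1) i)) \<longlonglongrightarrow> (\<integral>\<zeta>. f \<zeta> \<partial>N)"
    if f: "continuous_on torus f" for f :: "complex ^ 'n \<Rightarrow> complex"
  proof -
    have fc: "continuous_on UNIV (\<lambda>t. f (torus_curve t))"
      by (rule continuous_on_compose2[OF f continuous_torus_curve]) auto
    have fcm: "(\<lambda>t. f (torus_curve t)) \<in> borel_measurable borel"
      by (rule borel_measurable_continuous_onI[OF fc])
    have fz: "continuous_on UNIV (\<lambda>\<theta>. f (cis_vec \<theta>))"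
      by (rule continuous_on_compose2[OF f]) (auto intro: continuous_intros)
    have fzm: "(\<lambda>\<theta>. f (cis_vec \<theta>)) \<in> borel_measurable (D i)" for i
      using borel_measurable_continuous_onI[OF fz] measurable_cong_sets[OF sets refl] by blast
    obtain B where B: "\<And>z. z \<in> torus \<Longrightarrow> norm (f z) \<le> B" using bounded_on_torus[OF f] by blast
    have Pi: "m i *\<^sub>R (\<integral>t. f (torus_curve t) \<partial>P i) = (\<integral>\<theta>. f (cis_vec \<theta>) \<partial>D i)" for i
    proof (cases "m i = 0")
      case True
      have "AE \<theta> in D i. False" by (rule AE_I[of _ _ UNIV]) (use True em sets in auto)
      then have "(\<integral>\<theta>. f (cis_vec \<theta>) \<partial>D i) = (\<integral>\<theta>. 0 \<partial>D i)"
        by (intro integral_cong_AE fzm) (auto elim: eventually_mono)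
      then show ?thesis using True by simp
    next
      case False
      have "(\<integral>t. f (torus_curve t) \<partial>P i) = (\<integral>\<theta>. f (cis_vec \<theta>) \<partial>density (D i) (\<lambda>_. ennreal (1 / m i)))"
        using False by (simp add: P_def integral_distr[OF meas' fcm] torus_curve_ternary_code)
      also have "\<dots> = (\<integral>\<theta>. (1 / m i) *\<^sub>R f (cis_vec \<theta>) \<partial>D i)"
        using m(1) by (intro integral_density fzm) auto
      finally show ?thesis using False by simp
    qed
    have "(\<lambda>i. \<integral>t. f (torus_curve t) \<partial>(P \<circ> r0 \<circ> r1) i) \<longlonglongrightarrow> (\<integral>t. f (torus_curve t) \<partial>Q)"
    proof (rule weak_conv_imp_integral_bdd_continuous_conv[OF _ Q w, where B = B])
      show "isCont (\<lambda>t. f (torus_curve t)) x" for x using fc by (simp add: continuous_on_eq_continuous_at)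
    qed (auto simp: Prd B)
    moreover have "(\<lambda>i. m ((r0 \<circ> r1) i)) \<longlonglongrightarrow> m0"
      using LIMSEQ_subseq_LIMSEQ[OF r0(2) r1] by (simp add: o_def)
    ultimately have "(\<lambda>i. m ((r0 \<circ> r1) i) *\<^sub>R (\<integral>t. f (torus_curve t) \<partial>P ((r0 \<circ> r1) i))) \<longlonglongrightarrow> m0 *\<^sub>R (\<integral>t. f (torus_curve t) \<partial>Q)"
      by (intro tendsto_scaleR) (simp_all add: o_def)
    moreover have "(\<integral>\<zeta>. f \<zeta> \<partial>N) = m0 *\<^sub>R (\<integral>t. f (torus_curve t) \<partial>Q)"
    proof -
      have fd: "f \<in> borel_measurable (distr Q torus_borel torus_curve)"
        using measurable_on_torus[OF f] by simp
      have "(\<integral>\<zeta>. f \<zeta> \<partial>N) = (\<integral>\<zeta>. m0 *\<^sub>R f \<zeta> \<partial>distr Q torus_borel torus_curve)"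
        unfolding N_def by (rule integral_density[OF fd]) (use m0 in auto)
      then show ?thesis by (simp add: integral_distr[OF mc measurable_on_torus[OF f]])
    qed
    ultimately show ?thesis by (simp add: Pi)
  qed
  ultimately show ?thesis by blast
qed

section \<open>The radial differential equation\<close>

text \<open>With \<open>E = \<bar>h\<bar>\<^sup>2 + \<bar>h'\<bar>\<^sup>2\<close> the equation gives \<open>\<bar>E'\<bar> \<le> C E\<close> between \<open>s\<close> and \<open>t\<close>, so \<open>E\<close>
  times a suitable exponential is monotone and stays \<open>0\<close> on either side of \<open>s\<close>.\<close>

lemma linear_ode_zero_data:
  fixes h h' h'' p q :: "real \<Rightarrow> complex"
  assumes h: "\<And>r. r \<in> {0<..<1} \<Longrightarrow> (h has_vector_derivative h' r) (at r)"
    and h': "\<And>r. r \<in> {0<..<1} \<Longrightarrow> (h' has_vector_derivative h'' r) (at r)"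
    and eq: "\<And>r. r \<in> {0<..<1} \<Longrightarrow> h'' r = p r * h' r + q r * h r"
    and pq: "continuous_on {0<..<1} p" "continuous_on {0<..<1} q"
    and s: "s \<in> {0<..<1}" "h s = 0" "h' s = 0" and t: "t \<in> {0<..<1}"
  shows "h t = 0"
proof -
  let ?I = "{min s t..max s t}"
  have I: "?I \<subseteq> {0<..<1}" using s t by auto
  have bdd: "\<exists>B. \<forall>r\<in>?I. norm (g r) \<le> B" if "continuous_on {0<..<1} g" for g :: "real \<Rightarrow> complex"
  proof -
    have "bounded (g ` ?I)"
      by (rule compact_imp_bounded[OF compact_continuous_image[OF continuous_on_subset[OF that I] compact_Icc]])
    then show ?thesis by (auto simp: bounded_iff)
  qed
  obtain P where P: "\<forall>r\<in>?I. norm (p r) \<le> P" using bdd[OF pq(1)] by (elim exE)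
  obtain Q where Q: "\<forall>r\<in>?I. norm (q r) \<le> Q" using bdd[OF pq(2)] by (elim exE)
  define K where "K = max P Q"
  have K: "norm (p r) \<le> K" "norm (q r) \<le> K" if "r \<in> ?I" for r
    using P[rule_format, OF that] Q[rule_format, OF that] unfolding K_def by linarith+
  have K0: "K \<ge> 0" using K(1)[of s] norm_ge_zero[of "p s"] by (simp, linarith)
  define E where "E r = h r \<bullet> h r + h' r \<bullet> h' r" for r
  define E' where "E' r = 2 * (h r \<bullet> h' r) + 2 * (h' r \<bullet> h'' r)" for r
  define C where "C = 1 + 3 * K"
  have E: "(E has_real_derivative E' r) (at r)" if "r \<in> ?I" for r
  proof -
    have "r \<in> {0<..<1}" using that I by auto
    note h[OF this, unfolded has_vector_derivative_def] h'[OF this, unfolded has_vector_derivative_def]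
    then show ?thesis
      unfolding E_def E'_def has_field_derivative_def
      by (auto intro!: derivative_eq_intros simp: inner_commute algebra_simps fun_eq_iff)
  qed
  have bound: "\<bar>E' r\<bar> \<le> C * E r" if "r \<in> ?I" for r
  proof -
    let ?x = "norm (h r)" and ?y = "norm (h' r)"
    have r: "r \<in> {0<..<1}" using that I by auto
    have "norm (h'' r) \<le> K * ?y + K * ?x"
      unfolding eq[OF r] using K[OF that]
      by (intro norm_triangle_le add_mono) (auto simp: norm_mult intro: mult_right_mono)
    then have "\<bar>h' r \<bullet> h'' r\<bar> \<le> ?y * (K * ?y + K * ?x)"
      by (meson Cauchy_Schwarz_ineq2 mult_left_mono norm_ge_zero order_trans)
    moreover have "\<bar>h r \<bullet> h' r\<bar> \<le> ?x * ?y" by (rule Cauchy_Schwarz_ineq2)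
    ultimately have "\<bar>E' r\<bar> \<le> 2 * (?x * ?y) + 2 * (?y * (K * ?y + K * ?x))"
      unfolding E'_def by linarith
    also have "\<dots> \<le> C * (?x\<^sup>2 + ?y\<^sup>2)"
    proof -
      have "2 * (?x * ?y) \<le> ?x\<^sup>2 + ?y\<^sup>2" using sum_squares_bound[of ?x ?y] by simp
      then have "(1 + K) * (2 * (?x * ?y)) \<le> (1 + K) * (?x\<^sup>2 + ?y\<^sup>2)"
        using K0 by (intro mult_left_mono) auto
      moreover have "0 \<le> 2 * K * ?x\<^sup>2" using K0 by simp
      ultimately show ?thesis by (simp add: C_def algebra_simps power2_eq_square)
    qed
    also have "\<dots> = C * E r" by (simp add: E_def power2_norm_eq_inner)
    finally show ?thesis .
  qed
  have "E t \<le> 0"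
  proof (cases "s \<le> t")
    case True
    have "E t * exp (- C * t) \<le> E s * exp (- C * s)"
    proof (rule DERIV_nonpos_imp_nonincreasing[OF True])
      fix r assume r: "s \<le> r" "r \<le> t"
      then have r': "r \<in> ?I" by auto
      have "((\<lambda>r. E r * exp (- C * r)) has_real_derivative (E' r - C * E r) * exp (- C * r)) (at r)"
        by (auto intro!: derivative_eq_intros E[OF r'] simp: algebra_simps)
      moreover have "(E' r - C * E r) * exp (- C * r) \<le> 0"
        using bound[OF r'] by (simp add: mult_le_0_iff)
      ultimately show "\<exists>y. ((\<lambda>r. E r * exp (- C * r)) has_real_derivative y) (at r) \<and> y \<le> 0" by blast
    qed
    then show ?thesis using s by (simp add: E_def mult_le_0_iff)
  next
    case False
    then have ts: "t \<le> s" by simp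
    have "E t * exp (C * t) \<le> E s * exp (C * s)"
    proof (rule DERIV_nonneg_imp_nondecreasing[OF ts])
      fix r assume r: "t \<le> r" "r \<le> s"
      then have r': "r \<in> ?I" by auto
      have "((\<lambda>r. E r * exp (C * r)) has_real_derivative (E' r + C * E r) * exp (C * r)) (at r)"
        by (auto intro!: derivative_eq_intros E[OF r'] simp: algebra_simps)
      moreover have "(E' r + C * E r) * exp (C * r) \<ge> 0"
        using bound[OF r'] by simp
      ultimately show "\<exists>y. ((\<lambda>r. E r * exp (C * r)) has_real_derivative y) (at r) \<and> y \<ge> 0" by blast
    qed
    then show ?thesis using s by (simp add: E_def mult_le_0_iff)
  qed
  then have "h t \<bullet> h t \<le> 0" unfolding E_def
    using inner_ge_zero[of "h' t"] by linarith
  then show ?thesis by (metis inner_gt_zero_iff not_less)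
qed

text \<open>The equation for \<open>f\<close> that expresses that \<open>f(r) e\<^bsup>ik\<theta>\<^esup>\<close> is annihilated by \<open>L\<close>; the conditions at \<open>0\<close> select the
  solutions without singularity.\<close>

definition radial_solution :: "complex \<Rightarrow> complex \<Rightarrow> int \<Rightarrow> (real \<Rightarrow> complex) \<Rightarrow> bool" where
  "radial_solution a b k f \<longleftrightarrow> continuous_on {0..<1} f \<and>
     (\<exists>f' f''. ((\<lambda>r. of_real r * f' r) \<longlongrightarrow> 0) (at_right 0) \<and>
        (\<forall>r\<in>{0<..<1}. (f has_vector_derivative f' r) (at r) \<and> (f' has_vector_derivative f'' r) (at r) \<and>
          of_real (1 - r\<^sup>2) / 4 * (f'' r + f' r / of_real r - (of_int k)\<^sup>2 / (of_real r)\<^sup>2 * f r)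
          + (a + b) * of_real r * f' r / 2 + (a - b) * of_int k / 2 * f r - a * b * f r = 0))"

text \<open>The Wronskian \<open>W\<close> satisfies \<open>W' = p W\<close>, so it is a constant divided by \<open>r (1 - r\<^sup>2)\<^bsup>-(a+b)\<^esup>\<close>; the behaviour
  at \<open>0\<close> makes the constant \<open>0\<close>. Then \<open>f s * g - g s * f\<close> solves the equation with zero data at \<open>s\<close>.\<close>

lemma radial_solution_proportional:
  assumes f: "radial_solution a b k f" and g: "radial_solution a b k g"
    and r: "r \<in> {0..<1}" and s: "s \<in> {0..<1}"
  shows "f r * g s = f s * g r"
proof -
  have cf: "continuous_on {0..<1} f" and cg: "continuous_on {0..<1} g"
    using f g by (auto simp: radial_solution_def)
  let ?eq = "\<lambda>h h' h'' r. of_real (1 - r\<^sup>2) / 4 * (h'' r + h' r / of_real r - (of_int k)\<^sup>2 / (of_real r)\<^sup>2 * h r)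
          + (a + b) * of_real r * h' r / 2 + (a - b) * of_int k / 2 * h r - a * b * h r = (0::complex)"
  obtain f' f'' where f0: "((\<lambda>r. of_real r * f' r) \<longlongrightarrow> 0) (at_right 0)"
    and f': "\<And>r. r \<in> {0<..<1} \<Longrightarrow> (f has_vector_derivative f' r) (at r)"
    and f'': "\<And>r. r \<in> {0<..<1} \<Longrightarrow> (f' has_vector_derivative f'' r) (at r)"
    and feq: "\<And>r. r \<in> {0<..<1} \<Longrightarrow> ?eq f f' f'' r"
    using f unfolding radial_solution_def by blast
  obtain g' g'' where g0: "((\<lambda>r. of_real r * g' r) \<longlongrightarrow> 0) (at_right 0)"
    and g': "\<And>r. r \<in> {0<..<1} \<Longrightarrow> (g has_vector_derivative g' r) (at r)"
    and g'': "\<And>r. r \<in> {0<..<1} \<Longrightarrow> (g' has_vector_derivative g'' r) (at r)"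
    and geq: "\<And>r. r \<in> {0<..<1} \<Longrightarrow> ?eq g g' g'' r"
    using g unfolding radial_solution_def by blast
  define p where "p r = - (1 / of_real r + 2 * (a + b) * of_real r / of_real (1 - r\<^sup>2))" for r :: real
  define q where "q r = (of_int k)\<^sup>2 / (of_real r)\<^sup>2 - (2 * (a - b) * of_int k - 4 * a * b) / of_real (1 - r\<^sup>2)" for r :: real
  have sq: "1 - r\<^sup>2 > 0" if "r \<in> {0<..<1}" for r :: real
    using that by (simp add: power_less_one_iff abs_square_less_1)
  have solve: "h'' r = p r * h' r + q r * h r" if "?eq h h' h'' r" and r: "r \<in> {0<..<1}" for h h' h'' r
  proof -
    define R where "R = complex_of_real r"
    define W where "W = complex_of_real (1 - r\<^sup>2)"
    have nz: "R \<noteq> 0" "W \<noteq> 0" using r sq[OF r] unfolding R_def W_def of_real_eq_0_iff by auto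
    have e: "W / 4 * (h'' r + h' r / R - (of_int k)\<^sup>2 / R\<^sup>2 * h r)
          + (a + b) * R * h' r / 2 + (a - b) * of_int k / 2 * h r - a * b * h r = 0"
      using that(1) by (simp add: R_def W_def)
    have "h'' r = - (h' r / R) + (of_int k)\<^sup>2 / R\<^sup>2 * h r - (4 / W) * ((a + b) * R * h' r / 2 + (a - b) * of_int k / 2 * h r - a * b * h r)"
    proof -
      define X where "X = (a + b) * R * h' r / 2 + (a - b) * of_int k / 2 * h r - a * b * h r"
      define Y where "Y = h'' r + h' r / R - (of_int k)\<^sup>2 / R\<^sup>2 * h r"
      have "W / 4 * Y + X = 0" using e by (simp add: X_def Y_def algebra_simps)
      then have "Y = - (4 / W) * X" using nz by (simp add: field_simps) (metis add.commute add_eq_0_iff mult.commute mult_minus_right)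
      then have "h'' r = - (h' r / R) + (of_int k)\<^sup>2 / R\<^sup>2 * h r - (4 / W) * X" by (simp add: Y_def algebra_simps)
      then show ?thesis by (simp add: X_def)
    qed
    also have "\<dots> = p r * h' r + q r * h r"
      unfolding p_def q_def R_def[symmetric] W_def[symmetric] using nz by (simp add: field_simps)
    finally show ?thesis .
  qed
  have fsol: "f'' r = p r * f' r + q r * f r" and gsol: "g'' r = p r * g' r + q r * g r"
    if r: "r \<in> {0<..<1}" for r
    using solve[where h = f and h' = f' and h'' = f'' and r = r, OF feq[OF r] r]
      solve[where h = g and h' = g' and h'' = g'' and r = r, OF geq[OF r] r] by blast+
  have contp: "continuous_on {0<..<1} p" "continuous_on {0<..<1} q"
    unfolding p_def q_def using sq by (auto intro!: continuous_intros simp: abs_square_eq_1 simp flip: of_real_power)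
  \<comment> \<open>The Wronskian equals a constant divided by \<open>\<psi>\<close>.\<close>
  define W where "W r = f r * g' r - f' r * g r" for r
  define \<psi> where "\<psi> r = of_real r * exp (- (a + b) * of_real (ln (1 - r\<^sup>2)))" for r :: real
  have W': "(W has_vector_derivative p r * W r) (at r)" if r: "r \<in> {0<..<1}" for r
  proof -
    have "(W has_vector_derivative (f r * g'' r + f' r * g' r) - (f' r * g' r + f'' r * g r)) (at r)"
      unfolding W_def using f'[OF r] f''[OF r] g'[OF r] g''[OF r]
      by (auto intro!: derivative_eq_intros)
    moreover have "(f r * g'' r + f' r * g' r) - (f' r * g' r + f'' r * g r) = p r * W r"
      unfolding fsol[OF r] gsol[OF r] W_def by (simp add: algebra_simps)
    ultimately show ?thesis by simp
  qed
  have \<psi>': "(\<psi> has_vector_derivative - p r * \<psi> r) (at r)" if r: "r \<in> {0<..<1}" for r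
  proof -
    have 1: "((\<lambda>r. ln (1 - r\<^sup>2)) has_real_derivative - (2 * r / (1 - r\<^sup>2))) (at r)"
      using sq[OF r] by (auto intro!: derivative_eq_intros simp: field_simps)
    have "((\<lambda>r. complex_of_real (ln (1 - r\<^sup>2))) has_vector_derivative of_real (- (2 * r / (1 - r\<^sup>2)))) (at r)"
      using 1 by (intro has_vector_derivative_of_real) 
    then have "((\<lambda>r. - (a + b) * complex_of_real (ln (1 - r\<^sup>2))) has_vector_derivative - (a + b) * of_real (- (2 * r / (1 - r\<^sup>2)))) (at r)"
      by (rule has_vector_derivative_mult_right)
    then have "((\<lambda>r. exp (- (a + b) * complex_of_real (ln (1 - r\<^sup>2)))) has_vector_derivative
        (- (a + b) * of_real (- (2 * r / (1 - r\<^sup>2)))) * exp (- (a + b) * of_real (ln (1 - r\<^sup>2)))) (at r)"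
      by (rule field_vector_diff_chain_at[OF _ DERIV_exp, unfolded o_def])
    moreover have "(complex_of_real has_vector_derivative 1) (at r)"
      using has_vector_derivative_of_real[OF DERIV_ident] by simp
    ultimately have "(\<psi> has_vector_derivative of_real r * ((- (a + b) * of_real (- (2 * r / (1 - r\<^sup>2)))) * exp (- (a + b) * of_real (ln (1 - r\<^sup>2))))
        + 1 * exp (- (a + b) * of_real (ln (1 - r\<^sup>2)))) (at r)"
      unfolding \<psi>_def by (rule has_vector_derivative_mult[rotated])
    moreover have "R * ((- (a + b) * of_real (- (2 * r / (1 - r\<^sup>2)))) * e) + 1 * e
        = - (- (1 / R + 2 * (a + b) * R / of_real (1 - r\<^sup>2))) * (R * e)"
      if "R = of_real r" for R e :: complex
    proof -
      define w where "w = complex_of_real (1 - r\<^sup>2)"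
      have nz: "R \<noteq> 0" "w \<noteq> 0" using r sq[OF r] unfolding w_def that of_real_eq_0_iff by auto
      have 2: "complex_of_real (- (2 * r / (1 - r\<^sup>2))) = - (2 * R / w)"
        unfolding w_def that by (simp only: of_real_minus of_real_divide of_real_mult of_real_numeral)
      show ?thesis
        unfolding 2 w_def[symmetric] using nz by (simp add: field_simps)
    qed
    ultimately show ?thesis
      unfolding p_def \<psi>_def by simp
  qed
  have W\<psi>: "((\<lambda>r. W r * \<psi> r) has_vector_derivative 0) (at r)" if r: "r \<in> {0<..<1}" for r
    using has_vector_derivative_mult[OF W'[OF r] \<psi>'[OF r]] by (simp add: algebra_simps)
  obtain c where c: "\<And>r. r \<in> {0<..<1} \<Longrightarrow> W r * \<psi> r = c"
    by (rule has_vector_derivative_zero_constant[of "{0<..<1::real}" "\<lambda>r. W r * \<psi> r"])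
       (simp_all add: has_vector_derivative_at_within[OF W\<psi>])
  have ev: "\<forall>\<^sub>F r in at_right 0. r \<in> {0<..<1::real}"
    using eventually_at_right_real[of 0 1] by simp
  \<comment> \<open>The constant is read off at the singular point, where \<open>r f'\<close> and \<open>r g'\<close> vanish.\<close>
  have lim0: "(h \<longlongrightarrow> h 0) (at_right 0)" if "continuous_on {0..<1} h" for h :: "real \<Rightarrow> complex"
  proof -
    have "(h \<longlongrightarrow> h 0) (at 0 within {0..<1})" using that by (simp add: continuous_on_def)
    then show ?thesis by (rule tendsto_within_subset[where T = "{0<..<1}", THEN Lim_transform_within_set]) 
      (auto simp: eventually_at intro!: exI[of _ 1])
  qed
  have "((\<lambda>r. (f r * (of_real r * g' r) - (of_real r * f' r) * g r) * exp (- (a + b) * of_real (ln (1 - r\<^sup>2)))) \<longlongrightarrow>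
      (f 0 * 0 - 0 * g 0) * exp (- (a + b) * of_real (ln (1 - 0\<^sup>2)))) (at_right 0)"
    by (intro tendsto_intros lim0 cf cg f0 g0) auto
  then have "((\<lambda>r. W r * \<psi> r) \<longlongrightarrow> 0) (at_right 0)"
    by (simp add: W_def \<psi>_def algebra_simps)
  moreover have "((\<lambda>r. W r * \<psi> r) \<longlongrightarrow> c) (at_right 0)"
    by (rule tendsto_eventually, rule eventually_mono[OF ev], rule c)
  ultimately have "c = 0" by (meson tendsto_unique trivial_limit_at_right_real)
  then have W0: "W r = 0" if "r \<in> {0<..<1}" for r
    using c[OF that] that by (auto simp: \<psi>_def)
  have pos: "f r * g s = f s * g r" if r: "r \<in> {0<..<1}" and s: "s \<in> {0<..<1}" for r s
  proof -
    have "f s * g r - f r * g s = 0"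
    proof (rule linear_ode_zero_data[where h = "\<lambda>r. f s * g r - f r * g s" and h' = "\<lambda>r. f s * g' r - f' r * g s"
          and h'' = "\<lambda>r. f s * g'' r - f'' r * g s" and p = p and q = q and s = s])
      fix r :: real assume r: "r \<in> {0<..<1}"
      show "f s * g'' r - f'' r * g s = p r * (f s * g' r - f' r * g s) + q r * (f s * g r - f r * g s)"
        unfolding fsol[OF r] gsol[OF r] by (simp add: algebra_simps)
    qed (use contp r s W0[OF s] f' f'' g' g'' in \<open>auto intro!: derivative_eq_intros simp: W_def\<close>)
    then show ?thesis by simp
  qed
  \<comment> \<open>The endpoint \<open>0\<close> follows by continuity.\<close>
  have zero: "f 0 * g s = f s * g 0" if s: "s \<in> {0<..<1}" for s
  proof -
    have "((\<lambda>r. f r * g s) \<longlongrightarrow> f 0 * g s) (at_right 0)" by (intro tendsto_intros lim0 cf)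
    moreover have "((\<lambda>r. f s * g r) \<longlongrightarrow> f s * g 0) (at_right 0)" by (intro tendsto_intros lim0 cg)
    then have "((\<lambda>r. f r * g s) \<longlongrightarrow> f s * g 0) (at_right 0)"
      by (rule Lim_transform_eventually) (rule eventually_mono[OF ev], rule pos[symmetric, OF _ s])
    ultimately show ?thesis by (meson tendsto_unique trivial_limit_at_right_real)
  qed
  consider "r = 0" "s = 0" | "r = 0" "s \<in> {0<..<1}" | "r \<in> {0<..<1}" "s = 0" | "r \<in> {0<..<1}" "s \<in> {0<..<1}"
    using r s by fastforce
  then show ?thesis by cases (auto simp: pos zero)
qed

section \<open>Fourier coefficients of separately harmonic functions\<close>

lemma open_polydisc: "open (polydisc :: (complex ^ 'n::finite) set)"
proof -
  have eq: "polydisc = (\<Inter>j\<in>UNIV. {z :: complex ^ 'n. norm (z $ j) < 1})" by (auto simp: polydisc_def)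
  show ?thesis
    unfolding eq by (intro open_INT finite ballI open_Collect_less continuous_intros)
qed

lemma linear_axis: "linear (axis j :: complex \<Rightarrow> complex ^ 'n::finite)"
  by (rule linearI) (auto simp: axis_def vec_eq_iff)

lemma bounded_linear_axis: "bounded_linear (axis j :: complex \<Rightarrow> complex ^ 'n::finite)"
  using linear_axis by (simp add: linear_conv_bounded_linear)

lemma has_vector_derivative_along_axis:
  fixes f :: "complex ^ 'n::finite \<Rightarrow> complex"
  assumes "(f has_derivative f') (at z)"
  shows "((\<lambda>t. f (z + axis j (c * of_real t))) has_vector_derivative f' (axis j c)) (at 0)"
proof -
  have m: "bounded_linear (\<lambda>t::real. axis j (c * of_real t) :: complex ^ 'n)"
    by (rule bounded_linear_compose[OF bounded_linear_axis bounded_linear_compose[OF bounded_linear_mult_right bounded_linear_of_real]])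
  have "((\<lambda>t::real. z + axis j (c * of_real t)) has_derivative (\<lambda>t. axis j (c * of_real t))) (at 0)"
    using has_derivative_add[OF has_derivative_const bounded_linear_imp_has_derivative[OF m], of z] by simp
  moreover have "(f has_derivative f') (at (z + axis j (c * of_real 0)))"
    using assms by (simp add: linear_0[OF linear_axis])
  ultimately have "((\<lambda>t::real. f (z + axis j (c * of_real t))) has_derivative (\<lambda>t. f' (axis j (c * of_real t)))) (at 0)"
    by (rule has_derivative_compose)
  moreover have "f' (axis j (c * of_real t)) = t *\<^sub>R f' (axis j c)" for t :: real
  proof -
    have "axis j (c * of_real t) = t *\<^sub>R axis j c"
      using linear_cmul[OF linear_axis, of j t c] by (simp add: scaleR_conv_of_real mult.commute)
    then show ?thesis using linear_cmul[OF has_derivative_linear[OF assms]] by simp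
  qed
  ultimately show ?thesis by (simp add: has_vector_derivative_def)
qed

lemma partial_x_eq:
  assumes "(f has_derivative f') (at z)"
  shows "partial_x j f z = f' (axis j 1)"
  unfolding partial_x_def using vector_derivative_at[OF has_vector_derivative_along_axis[OF assms, of j 1]] by simp

lemma partial_y_eq:
  assumes "(f has_derivative f') (at z)"
  shows "partial_y j f z = f' (axis j \<i>)"
  unfolding partial_y_def using vector_derivative_at[OF has_vector_derivative_along_axis[OF assms, of j \<i>]] by simp

lemma radial_solution_cmult:
  assumes "radial_solution a b k f"
  shows "radial_solution a b k (\<lambda>x. c * f x)"
proof -
  obtain f' f'' where l: "((\<lambda>r. of_real r * f' r) \<longlongrightarrow> 0) (at_right 0)"
    and f: "\<And>r. r \<in> {0<..<1} \<Longrightarrow> (f has_vector_derivative f' r) (at r) \<and> (f' has_vector_derivative f'' r) (at r) \<and>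
          of_real (1 - r\<^sup>2) / 4 * (f'' r + f' r / of_real r - (of_int k)\<^sup>2 / (of_real r)\<^sup>2 * f r)
          + (a + b) * of_real r * f' r / 2 + (a - b) * of_int k / 2 * f r - a * b * f r = 0"
    and c: "continuous_on {0..<1} f"
    using assms unfolding radial_solution_def by blast
  have "((\<lambda>r. c * (of_real r * f' r)) \<longlongrightarrow> c * 0) (at_right 0)" by (intro tendsto_intros l)
  then have l': "((\<lambda>r. of_real r * (c * f' r)) \<longlongrightarrow> 0) (at_right 0)" by (simp add: mult_ac)
  have e: "of_real (1 - r\<^sup>2) / 4 * (c * f'' r + c * f' r / of_real r - (of_int k)\<^sup>2 / (of_real r)\<^sup>2 * (c * f r))
          + (a + b) * of_real r * (c * f' r) / 2 + (a - b) * of_int k / 2 * (c * f r) - a * b * (c * f r) = 0"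
    if "r \<in> {0<..<1}" for r
  proof -
    have "of_real (1 - r\<^sup>2) / 4 * (c * f'' r + c * f' r / of_real r - (of_int k)\<^sup>2 / (of_real r)\<^sup>2 * (c * f r))
          + (a + b) * of_real r * (c * f' r) / 2 + (a - b) * of_int k / 2 * (c * f r) - a * b * (c * f r)
       = c * (of_real (1 - r\<^sup>2) / 4 * (f'' r + f' r / of_real r - (of_int k)\<^sup>2 / (of_real r)\<^sup>2 * f r)
          + (a + b) * of_real r * f' r / 2 + (a - b) * of_int k / 2 * f r - a * b * f r)"
      by (simp add: algebra_simps)
    then show ?thesis using f[OF that] by simp
  qed
  show ?thesis
    unfolding radial_solution_def using l' e f
    by (intro conjI continuous_on_mult_left c exI[of _ "\<lambda>r. c * f' r"] exI[of _ "\<lambda>r. c * f'' r"] ballI)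
       (auto intro!: has_vector_derivative_mult_right)
qed

lemma radial_solution_cong:
  assumes f: "radial_solution a b k f" and fg: "\<And>x. x \<in> {0..<1} \<Longrightarrow> f x = g x"
  shows "radial_solution a b k g"
proof -
  have "(g has_vector_derivative D) (at r)" if "r \<in> {0<..<1}" "(f has_vector_derivative D) (at r)" for r D
    by (rule has_vector_derivative_transform_within_open[OF that(2) _ that(1)]) (auto simp: fg)
  moreover have "continuous_on {0..<1} g"
    using f fg unfolding radial_solution_def by (metis continuous_on_eq)
  moreover have "f r = g r" if "r \<in> {0<..<1}" for r using that fg by simp
  ultimately show ?thesis using f unfolding radial_solution_def by (metis (no_types, lifting))
qed

text \<open>First and second derivatives of \<open>u\<close> as bounded linear maps: \<open>u'' z g h\<close> is the derivative in direction \<open>g\<close> of the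
  derivative in direction \<open>h\<close>.\<close>

locale C2_derivatives =
  fixes u :: "complex ^ 'n::finite \<Rightarrow> complex"
    and u' :: "complex ^ 'n \<Rightarrow> (complex ^ 'n) \<Rightarrow>\<^sub>L complex"
    and u'' :: "complex ^ 'n \<Rightarrow> (complex ^ 'n) \<Rightarrow>\<^sub>L ((complex ^ 'n) \<Rightarrow>\<^sub>L complex)"
  assumes u': "\<And>z. z \<in> polydisc \<Longrightarrow> (u has_derivative blinfun_apply (u' z)) (at z)"
    and u'': "\<And>z. z \<in> polydisc \<Longrightarrow> (u' has_derivative blinfun_apply (u'' z)) (at z)"
    and cont: "continuous_on polydisc u''"
begin

lemma deriv_apply:
  assumes "z \<in> polydisc"
  shows "((\<lambda>z. blinfun_apply (u' z) h) has_derivative (\<lambda>g. blinfun_apply (blinfun_apply (u'' z) g) h)) (at z)"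
  using bounded_linear.has_derivative[OF blinfun.bounded_linear_left u''[OF assms]] .

text \<open>The two mixed second derivatives stay separate here; their difference is removed later, by averaging.\<close>

lemma L_op_eq:
  assumes z: "z \<in> polydisc"
  shows "L_op j a b u z = of_real (1 - (norm (z $ j))\<^sup>2) / 4 *
       (u'' z (axis j 1) (axis j 1) + u'' z (axis j \<i>) (axis j \<i>) + \<i> * (u'' z (axis j 1) (axis j \<i>) - u'' z (axis j \<i>) (axis j 1)))
     + a * z $ j * (u' z (axis j 1) - \<i> * u' z (axis j \<i>)) / 2 + b * cnj (z $ j) * (u' z (axis j 1) + \<i> * u' z (axis j \<i>)) / 2
     - a * b * u z"
proof -
  have db: "dzbar j u w = (u' w (axis j 1) + \<i> * u' w (axis j \<i>)) / 2" if "w \<in> polydisc" for w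
    unfolding dzbar_def partial_x_eq[OF u'[OF that]] partial_y_eq[OF u'[OF that]] ..
  have "((\<lambda>w. (u' w (axis j 1) + \<i> * u' w (axis j \<i>)) / 2) has_derivative
      (\<lambda>g. (u'' z g (axis j 1) + \<i> * u'' z g (axis j \<i>)) / 2)) (at z)"
    by (intro bounded_linear.has_derivative[OF bounded_linear_divide] has_derivative_add has_derivative_mult_right deriv_apply z)
  then have d: "(dzbar j u has_derivative (\<lambda>g. (u'' z g (axis j 1) + \<i> * u'' z g (axis j \<i>)) / 2)) (at z)"
    by (rule has_derivative_transform_within_open[OF _ open_polydisc z]) (simp add: db)
  show ?thesis
    unfolding L_op_def dz_def[of j "dzbar j u"] partial_x_eq[OF d] partial_y_eq[OF d] db[OF z]
    unfolding dz_def partial_x_eq[OF u'[OF z]] partial_y_eq[OF u'[OF z]]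
    by (simp add: algebra_simps add_divide_distrib diff_divide_distrib)
qed

lemma cont_u': "continuous_on polydisc u'"
  by (rule has_derivative_continuous_on[OF has_derivative_at_withinI[OF u'']])

lemma cont_u: "continuous_on polydisc u"
  by (rule has_derivative_continuous_on[OF has_derivative_at_withinI[OF u']])

end

definition polar_point :: "('n::finite \<Rightarrow> real) \<Rightarrow> complex ^ 'n \<Rightarrow> complex ^ 'n" where
  "polar_point r \<zeta> = (\<chi> i. of_real (r i) * \<zeta> $ i)"

lemma polar_point_polydisc:
  "(\<And>i. \<bar>r i\<bar> < 1) \<Longrightarrow> \<zeta> \<in> torus \<Longrightarrow> polar_point r \<zeta> \<in> polydisc"
  by (simp add: polar_point_def polydisc_def norm_mult torus_norm)

text \<open>The coefficient of \<open>\<zeta>\<^sup>k\<close> on the torus of polyradius \<open>r\<close>.\<close>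

definition fourier_coeff :: "(complex ^ 'n::finite \<Rightarrow> complex) \<Rightarrow> ('n \<Rightarrow> int) \<Rightarrow> ('n \<Rightarrow> real) \<Rightarrow> complex" where
  "fourier_coeff u k r = (\<integral>\<zeta>. u (polar_point r \<zeta>) * mon (\<lambda>i. - k i) \<zeta> \<partial>torus_haar)"

lemma continuous_polar_point [continuous_intros]: "continuous_on S (polar_point r)"
  unfolding polar_point_def by (intro continuous_intros)

lemma continuous_on_polar:
  assumes "continuous_on polydisc f" "\<And>i. \<bar>r i\<bar> < 1"
  shows "continuous_on torus (\<lambda>\<zeta>. f (polar_point r \<zeta>))"
  by (rule continuous_on_compose2[OF assms(1) continuous_polar_point]) (auto intro: polar_point_polydisc assms)

lemma integral_angles_deriv:
  fixes g g' :: "real \<Rightarrow> real ^ 'n::finite \<Rightarrow> complex"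
  assumes d: "\<And>s \<theta>. s \<in> {-1<..<1} \<Longrightarrow> ((\<lambda>s. g s \<theta>) has_vector_derivative g' s \<theta>) (at s)"
    and c: "\<And>s. s \<in> {-1<..<1} \<Longrightarrow> continuous_on angles (g s)"
    and c': "continuous_on ({-1<..<1} \<times> angles) (\<lambda>(s, \<theta>). g' s \<theta>)"
    and s: "s \<in> {-1<..<1}"
  shows "((\<lambda>s. integral angles (g s)) has_vector_derivative integral angles (g' s)) (at s)"
proof -
  have "((\<lambda>s. integral angles (g s)) has_vector_derivative integral angles (g' s)) (at s within {-1<..<1})"
    by (rule leibniz_rule_vector_derivative)
       (use c' s in \<open>auto intro!: has_vector_derivative_at_within d integrable_continuous c\<close>)
  then show ?thesis by (simp only: at_within_open[OF s open_greaterThanLessThan])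
qed

context C2_derivatives
begin

context
  fixes r :: "'n \<Rightarrow> real" and k :: "'n \<Rightarrow> int" and j :: 'n
  assumes r: "\<And>i. \<bar>r i\<bar> < 1"
begin

text \<open>The point with polar coordinates \<open>r\<close> and \<open>\<theta>\<close>, where coordinate \<open>j\<close> is given radius
  \<open>x\<close> and is turned by the angle \<open>t\<close>.\<close>

definition pt :: "real \<Rightarrow> real \<Rightarrow> real ^ 'n \<Rightarrow> complex ^ 'n" where
  "pt x t \<theta> = (\<chi> i. if i = j then of_real x * cis (\<theta> $ j + t) else of_real (r i) * cis (\<theta> $ i))"

lemma pt_polydisc: "x \<in> {-1<..<1} \<Longrightarrow> pt x t \<theta> \<in> polydisc"
  using r by (simp add: pt_def polydisc_def norm_mult abs_less_iff)

definition wt :: "real ^ 'n \<Rightarrow> complex" where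
  "wt \<theta> = mon (\<lambda>i. - k i) (cis_vec \<theta>)"

lemma continuous_wt: "continuous_on S wt"
  unfolding wt_def by (rule continuous_on_compose2[OF continuous_mon]) (auto intro: continuous_intros)

lemma pt_expand: "pt x t \<theta> = (\<chi> i. if i = j then 0 else of_real (r i) * cis (\<theta> $ i)) + axis j (of_real x * cis (\<theta> $ j + t))"
  by (auto simp: pt_def axis_def vec_eq_iff)

lemma pt_dx: "((\<lambda>x. pt x t \<theta>) has_vector_derivative axis j (cis (\<theta> $ j + t))) (at x)"
proof -
  have "((\<lambda>x. of_real x * cis (\<theta> $ j + t)) has_vector_derivative cis (\<theta> $ j + t)) (at x)"
    using has_vector_derivative_mult_left[OF has_vector_derivative_of_real[OF DERIV_ident]] by simp
  from bounded_linear.has_vector_derivative[OF bounded_linear_axis this, of j]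
  show ?thesis unfolding pt_expand
    using has_vector_derivative_add[OF has_vector_derivative_const] by fastforce
qed

lemma pt_dt: "((\<lambda>t. pt x t \<theta>) has_vector_derivative axis j (\<i> * of_real x * cis (\<theta> $ j + t))) (at t)"
proof -
  have "((\<lambda>t. cis (\<theta> $ j + t)) has_vector_derivative \<i> * cis (\<theta> $ j + t)) (at t)"
    unfolding has_vector_derivative_def by (auto intro!: derivative_eq_intros)
  from has_vector_derivative_mult_right[OF this, of "of_real x"]
  have "((\<lambda>t. of_real x * cis (\<theta> $ j + t)) has_vector_derivative \<i> * of_real x * cis (\<theta> $ j + t)) (at t)"
    by (simp add: mult_ac)
  from bounded_linear.has_vector_derivative[OF bounded_linear_axis this, of j]
  show ?thesis unfolding pt_expand
    using has_vector_derivative_add[OF has_vector_derivative_const] by fastforce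
qed

lemma vector_chain:
  assumes "(p has_vector_derivative p') (at t)" "(f has_derivative f') (at (p t))"
  shows "((\<lambda>t. f (p t)) has_vector_derivative f' p') (at t)"
  using vector_derivative_diff_chain_within[of p p' t UNIV f f'] assms has_derivative_at_withinI
  by (auto simp: o_def)

lemma continuous_pt: 
  assumes "continuous_on S x" "continuous_on S t" "continuous_on S \<theta>"
  shows "continuous_on S (\<lambda>s. pt (x s) (t s) (\<theta> s))"
  unfolding pt_expand
proof (intro continuous_on_add continuous_on_vec_lambda bounded_linear.continuous_on[OF bounded_linear_axis])
  show "continuous_on S (\<lambda>s. if i = j then 0 else complex_of_real (r i) * cis (\<theta> s $ i))" for i
    using assms by (cases "i = j") (auto intro!: continuous_intros continuous_on_cis)
  show "continuous_on S (\<lambda>s. complex_of_real (x s) * cis (\<theta> s $ j + t s))"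
    using assms by (intro continuous_intros continuous_on_cis)
qed

lemma continuous_pt_comp:
  assumes "continuous_on polydisc f" "continuous_on S x" "continuous_on S t" "continuous_on S \<theta>"
    "\<And>s. s \<in> S \<Longrightarrow> x s \<in> {-1<..<1}"
  shows "continuous_on S (\<lambda>s. f (pt (x s) (t s) (\<theta> s)))"
  by (rule continuous_on_compose2[OF assms(1) continuous_pt]) (use assms pt_polydisc in auto)

abbreviation D1 :: "complex \<Rightarrow> real \<Rightarrow> real \<Rightarrow> real ^ 'n \<Rightarrow> complex" where
  "D1 a x t \<theta> \<equiv> u' (pt x t \<theta>) (axis j (a * cis (\<theta> $ j + t)))"

abbreviation D2 :: "complex \<Rightarrow> complex \<Rightarrow> real \<Rightarrow> real \<Rightarrow> real ^ 'n \<Rightarrow> complex" where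
  "D2 a b x t \<theta> \<equiv> u'' (pt x t \<theta>) (axis j (a * cis (\<theta> $ j + t))) (axis j (b * cis (\<theta> $ j + t)))"

lemma continuous_axis_cis:
  assumes "continuous_on S t" "continuous_on S \<theta>" "continuous_on S a"
  shows "continuous_on S (\<lambda>s. axis j (a s * cis (\<theta> s $ j + t s)) :: complex ^ 'n)"
  using assms by (intro bounded_linear.continuous_on[OF bounded_linear_axis] continuous_intros continuous_on_cis)

lemma continuous_u_pt:
  assumes "continuous_on S x" "continuous_on S t" "continuous_on S \<theta>" "\<And>s. s \<in> S \<Longrightarrow> x s \<in> {-1<..<1}"
  shows "continuous_on S (\<lambda>s. u (pt (x s) (t s) (\<theta> s)))"
  using continuous_pt_comp[OF cont_u] assms by blast

lemma continuous_D1: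
  assumes "continuous_on S x" "continuous_on S t" "continuous_on S \<theta>" "\<And>s. s \<in> S \<Longrightarrow> x s \<in> {-1<..<1}"
    and "continuous_on S a"
  shows "continuous_on S (\<lambda>s. D1 (a s) (x s) (t s) (\<theta> s))"
  by (intro bounded_bilinear.continuous_on[OF bounded_bilinear_blinfun_apply] continuous_pt_comp[OF cont_u'] continuous_axis_cis assms)

lemma continuous_D2:
  assumes "continuous_on S x" "continuous_on S t" "continuous_on S \<theta>" "\<And>s. s \<in> S \<Longrightarrow> x s \<in> {-1<..<1}"
    and "continuous_on S a" "continuous_on S b"
  shows "continuous_on S (\<lambda>s. D2 (a s) (b s) (x s) (t s) (\<theta> s))"
  by (intro bounded_bilinear.continuous_on[OF bounded_bilinear_blinfun_apply] continuous_pt_comp[OF cont] continuous_axis_cis assms)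

lemma u_dx: "x \<in> {-1<..<1} \<Longrightarrow> ((\<lambda>x. u (pt x t \<theta>)) has_vector_derivative D1 1 x t \<theta>) (at x)"
  using vector_chain[OF pt_dx u'[OF pt_polydisc]] by simp

lemma u_dt: "x \<in> {-1<..<1} \<Longrightarrow> ((\<lambda>t. u (pt x t \<theta>)) has_vector_derivative D1 (\<i> * of_real x) x t \<theta>) (at t)"
  using vector_chain[OF pt_dt u'[OF pt_polydisc]] by simp

lemma u'_dx: "x \<in> {-1<..<1} \<Longrightarrow> ((\<lambda>x. u' (pt x t \<theta>)) has_vector_derivative u'' (pt x t \<theta>) (axis j (1 * cis (\<theta> $ j + t)))) (at x)"
  using vector_chain[OF pt_dx u''[OF pt_polydisc]] by simp

lemma u'_dt: "x \<in> {-1<..<1} \<Longrightarrow> ((\<lambda>t. u' (pt x t \<theta>)) has_vector_derivative u'' (pt x t \<theta>) (axis j (\<i> * of_real x * cis (\<theta> $ j + t)))) (at t)"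
  using vector_chain[OF pt_dt u''[OF pt_polydisc]] by simp

lemma axis_dt: "((\<lambda>t. axis j (a * cis (\<theta> $ j + t)) :: complex ^ 'n) has_vector_derivative axis j (\<i> * a * cis (\<theta> $ j + t))) (at t)"
proof -
  have "((\<lambda>t. cis (\<theta> $ j + t)) has_vector_derivative \<i> * cis (\<theta> $ j + t)) (at t)"
    unfolding has_vector_derivative_def by (auto intro!: derivative_eq_intros)
  from has_vector_derivative_mult_right[OF this, of a]
  have "((\<lambda>t. a * cis (\<theta> $ j + t)) has_vector_derivative \<i> * a * cis (\<theta> $ j + t)) (at t)"
    by (simp add: mult_ac)
  from bounded_linear.has_vector_derivative[OF bounded_linear_axis this, of j] show ?thesis .
qed

lemma axis_dx: "((\<lambda>x. axis j (c * of_real x * cis (\<theta> $ j + t)) :: complex ^ 'n) has_vector_derivative axis j (c * cis (\<theta> $ j + t))) (at x)"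
proof -
  have "((\<lambda>x. complex_of_real x) has_vector_derivative 1) (at x)"
    using has_vector_derivative_of_real[OF DERIV_ident] by simp
  from has_vector_derivative_mult_right[OF this, of "c * cis (\<theta> $ j + t)"]
  have "((\<lambda>x. c * of_real x * cis (\<theta> $ j + t)) has_vector_derivative c * cis (\<theta> $ j + t)) (at x)"
    by (simp add: mult_ac)
  from bounded_linear.has_vector_derivative[OF bounded_linear_axis this, of j] show ?thesis .
qed

lemma blinfun_apply_deriv:
  assumes "(A has_vector_derivative A') (at t)" "(h has_vector_derivative h') (at t)"
  shows "((\<lambda>t. blinfun_apply (A t) (h t :: complex ^ 'n) :: complex) has_vector_derivative A' (h t) + A t h') (at t)"
  using bounded_bilinear.has_vector_derivative[OF bounded_bilinear_blinfun_apply assms] by (simp add: add.commute)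

lemma D1_dx: "x \<in> {-1<..<1} \<Longrightarrow> ((\<lambda>x. D1 1 x t \<theta>) has_vector_derivative D2 1 1 x t \<theta>) (at x)"
  using blinfun_apply_deriv[OF u'_dx has_vector_derivative_const] by (fastforce simp: blinfun.zero_right)

lemma D1_dt: "x \<in> {-1<..<1} \<Longrightarrow> ((\<lambda>t. D1 1 x t \<theta>) has_vector_derivative D2 (\<i> * of_real x) 1 x t \<theta> + D1 \<i> x t \<theta>) (at t)"
  using blinfun_apply_deriv[OF u'_dt[where x = x and \<theta> = \<theta> and t = t] axis_dt[where a = 1 and \<theta> = \<theta> and t = t]] by simp

lemma D1x_dt: "x \<in> {-1<..<1} \<Longrightarrow> ((\<lambda>t. D1 (\<i> * of_real x) x t \<theta>) has_vector_derivative
    D2 (\<i> * of_real x) (\<i> * of_real x) x t \<theta> + D1 (- of_real x) x t \<theta>) (at t)"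
  using blinfun_apply_deriv[OF u'_dt[where x = x and \<theta> = \<theta> and t = t] axis_dt[where a = "\<i> * of_real x" and \<theta> = \<theta> and t = t]]
  by (simp flip: mult.assoc)

lemma D1x_dx: "x \<in> {-1<..<1} \<Longrightarrow> ((\<lambda>x. D1 (\<i> * of_real x) x t \<theta>) has_vector_derivative
    D2 1 (\<i> * of_real x) x t \<theta> + D1 \<i> x t \<theta>) (at x)"
  using blinfun_apply_deriv[OF u'_dx[where x = x and \<theta> = \<theta> and t = t] axis_dx[where c = \<i> and \<theta> = \<theta> and x = x and t = t]] by simp

lemma continuous_D1_radius:
  assumes "continuous_on {-1<..<1} c"
  shows "continuous_on ({-1<..<1} \<times> angles) (\<lambda>p. D1 (c (fst p)) (fst p) t (snd p))"
  by (rule continuous_D1[where x = fst and t = "\<lambda>_. t" and \<theta> = snd and a = "\<lambda>p. c (fst p)"])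
     (auto intro!: continuous_intros continuous_on_compose2[OF assms])

lemma continuous_D2_radius:
  assumes "continuous_on {-1<..<1} c" "continuous_on {-1<..<1} d"
  shows "continuous_on ({-1<..<1} \<times> angles) (\<lambda>p. D2 (c (fst p)) (d (fst p)) (fst p) t (snd p))"
  by (rule continuous_D2[where x = fst and t = "\<lambda>_. t" and \<theta> = snd and a = "\<lambda>p. c (fst p)" and b = "\<lambda>p. d (fst p)"])
     (auto intro!: continuous_intros continuous_on_compose2[OF assms(1)] continuous_on_compose2[OF assms(2)])

lemma continuous_D1_angle:
  assumes "x \<in> {-1<..<1}"
  shows "continuous_on (T \<times> angles) (\<lambda>p. D1 c x (fst p) (snd p))"
  by (rule continuous_D1[where x = "\<lambda>_. x" and t = fst and \<theta> = snd and a = "\<lambda>_. c"])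
     (use assms in \<open>auto intro!: continuous_intros\<close>)

lemma continuous_D2_angle:
  assumes "x \<in> {-1<..<1}"
  shows "continuous_on (T \<times> angles) (\<lambda>p. D2 c d x (fst p) (snd p))"
  by (rule continuous_D2[where x = "\<lambda>_. x" and t = fst and \<theta> = snd and a = "\<lambda>_. c" and b = "\<lambda>_. d"])
     (use assms in \<open>auto intro!: continuous_intros\<close>)

lemma continuous_D_angles:
  assumes "x \<in> {-1<..<1}"
  shows "continuous_on angles (D1 c x t)" "continuous_on angles (D2 c d x t)" "continuous_on angles (\<lambda>\<theta>. u (pt x t \<theta>))"
proof -
  show "continuous_on angles (D1 c x t)"
    by (rule continuous_D1[where x = "\<lambda>_. x" and t = "\<lambda>_. t" and \<theta> = "\<lambda>\<theta>. \<theta>" and a = "\<lambda>_. c"])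
       (use assms in \<open>auto intro!: continuous_intros\<close>)
  show "continuous_on angles (D2 c d x t)"
    by (rule continuous_D2[where x = "\<lambda>_. x" and t = "\<lambda>_. t" and \<theta> = "\<lambda>\<theta>. \<theta>" and a = "\<lambda>_. c" and b = "\<lambda>_. d"])
       (use assms in \<open>auto intro!: continuous_intros\<close>)
  show "continuous_on angles (\<lambda>\<theta>. u (pt x t \<theta>))"
    by (rule continuous_u_pt[where x = "\<lambda>_. x" and t = "\<lambda>_. t" and \<theta> = "\<lambda>\<theta>. \<theta>"])
       (use assms in \<open>auto intro!: continuous_intros\<close>)
qed

definition avg :: "(real ^ 'n \<Rightarrow> complex) \<Rightarrow> complex" where
  "avg h = integral angles (\<lambda>\<theta>. h \<theta> * wt \<theta>)"

lemma avg_deriv: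
  assumes d: "\<And>s \<theta>. s \<in> {-1<..<1} \<Longrightarrow> ((\<lambda>s. g s \<theta>) has_vector_derivative g' s \<theta>) (at s)"
    and c: "\<And>s. s \<in> {-1<..<1} \<Longrightarrow> continuous_on angles (g s)"
    and c': "continuous_on ({-1<..<1} \<times> angles) (\<lambda>p. g' (fst p) (snd p))"
    and s: "s \<in> {-1<..<1}"
  shows "((\<lambda>s. avg (g s)) has_vector_derivative avg (g' s)) (at s)"
  unfolding avg_def
proof (rule integral_angles_deriv[OF _ _ _ s])
  show "((\<lambda>s. g s \<theta> * wt \<theta>) has_vector_derivative g' s \<theta> * wt \<theta>) (at s)" if "s \<in> {-1<..<1}" for s \<theta>
    by (rule has_vector_derivative_mult_left[OF d[OF that]])
  show "continuous_on angles (\<lambda>\<theta>. g s \<theta> * wt \<theta>)" if "s \<in> {-1<..<1}" for s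
    by (rule continuous_on_mult[OF c[OF that] continuous_wt])
  have "continuous_on ({-1<..<1} \<times> angles) (\<lambda>p. g' (fst p) (snd p) * wt (snd p))"
    by (intro continuous_on_mult c' continuous_on_compose2[OF continuous_wt]) (auto intro: continuous_intros)
  then show "continuous_on ({-1<..<1} \<times> angles) (\<lambda>(s, \<theta>). g' s \<theta> * wt \<theta>)" by (simp add: split_beta)
qed

lemma avg_add: "continuous_on angles g \<Longrightarrow> continuous_on angles h \<Longrightarrow> avg (\<lambda>\<theta>. g \<theta> + h \<theta>) = avg g + avg h"
  unfolding avg_def
  by (subst integral_add[symmetric]) (auto intro!: integrable_continuous continuous_on_mult continuous_wt simp: distrib_right)

lemma avg_cmult: "avg (\<lambda>\<theta>. c * h \<theta>) = c * avg h"
  unfolding avg_def by (simp add: mult.assoc integral_mult_right)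

lemma avg_diff: "continuous_on angles g \<Longrightarrow> continuous_on angles h \<Longrightarrow> avg (\<lambda>\<theta>. g \<theta> - h \<theta>) = avg g - avg h"
  unfolding avg_def
  by (subst integral_diff[symmetric]) (auto intro!: integrable_continuous continuous_on_mult continuous_wt simp: left_diff_distrib)

lemma fourier_coeff_avg:
  assumes x: "x \<in> {-1<..<1}"
  shows "fourier_coeff u k (r(j := x)) = (1 / (2 * pi) ^ CARD('n)) *\<^sub>R avg (\<lambda>\<theta>. u (pt x 0 \<theta>))"
proof -
  have r': "\<bar>(r(j := x)) i\<bar> < 1" for i using r x by (auto simp: abs_less_iff)
  have c: "continuous_on torus (\<lambda>\<zeta>. u (polar_point (r(j := x)) \<zeta>) * mon (\<lambda>i. - k i) \<zeta>)"
    by (intro continuous_on_mult continuous_on_polar[OF cont_u] continuous_mon r')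
  have "polar_point (r(j := x)) (cis_vec \<theta>) = pt x 0 \<theta>" for \<theta>
    by (simp add: polar_point_def pt_def vec_eq_iff)
  then show ?thesis
    unfolding fourier_coeff_def integral_torus_haar[OF c] avg_def wt_def by simp
qed

text \<open>Rotating coordinate \<open>j\<close> by \<open>t\<close> multiplies the character by a constant and leaves Haar measure invariant.\<close>

lemma avg_homogeneous:
  assumes x: "x \<in> {-1<..<1}"
  shows "avg (\<lambda>\<theta>. u (pt x t \<theta>)) = cis (of_int (k j) * t) * avg (\<lambda>\<theta>. u (pt x 0 \<theta>))"
proof -
  have r': "\<bar>(r(j := x)) i\<bar> < 1" for i using r x by (auto simp: abs_less_iff)
  define w where "w = (\<chi> i. if i = j then cis t else 1)"
  have w: "w \<in> torus" by (simp add: w_def torus_def)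
  have mw: "mon (\<lambda>i. - k i) w = cis (- of_int (k j) * t)"
  proof -
    have "mon (\<lambda>i. - k i) w = (\<Prod>i\<in>UNIV. if i = j then cis (- of_int (k j) * t) else 1)"
      unfolding mon_def w_def by (rule prod.cong) (auto simp: cis_power_int)
    then show ?thesis by simp
  qed
  define F where "F = (\<lambda>\<zeta>. u (polar_point (r(j := x)) \<zeta>))"
  have cF: "continuous_on torus F" unfolding F_def by (rule continuous_on_polar[OF cont_u r'])
  have c: "continuous_on torus (\<lambda>\<zeta>. F \<zeta> * mon (\<lambda>i. - k i) \<zeta>)"
    by (intro continuous_on_mult cF continuous_mon)
  have c2: "continuous_on torus (\<lambda>\<zeta>. F (w * \<zeta>) * mon (\<lambda>i. - k i) \<zeta>)"
    by (intro continuous_on_mult continuous_on_torus_rotate[OF cF w] continuous_mon)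
  have Fw: "F (w * cis_vec \<theta>) = u (pt x t \<theta>)" for \<theta>
    unfolding F_def by (rule arg_cong[where f = u]) (auto simp: polar_point_def pt_def vec_eq_iff w_def cis_mult add.commute)
  have F0: "F (cis_vec \<theta>) = u (pt x 0 \<theta>)" for \<theta>
    unfolding F_def by (rule arg_cong[where f = u]) (auto simp: polar_point_def pt_def vec_eq_iff)
  have "(\<integral>\<zeta>. F (w * \<zeta>) * mon (\<lambda>i. - k i) \<zeta> \<partial>torus_haar) = (\<integral>\<zeta>. cis (of_int (k j) * t) * (F (w * \<zeta>) * mon (\<lambda>i. - k i) (w * \<zeta>)) \<partial>torus_haar)"
  proof (rule Bochner_Integration.integral_cong[OF refl])
    fix \<zeta>
    have "cis (of_int (k j) * t) * mon (\<lambda>i. - k i) w = 1" unfolding mw cis_mult by simp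
    then show "F (w * \<zeta>) * mon (\<lambda>i. - k i) \<zeta> = cis (of_int (k j) * t) * (F (w * \<zeta>) * mon (\<lambda>i. - k i) (w * \<zeta>))"
      unfolding mon_mult by (metis (no_types, lifting) mult.assoc mult.commute mult_1)
  qed
  also have "\<dots> = cis (of_int (k j) * t) * (\<integral>\<zeta>. F \<zeta> * mon (\<lambda>i. - k i) \<zeta> \<partial>torus_haar)"
    using integral_torus_haar_rotate[OF c w] by simp
  finally show ?thesis
    unfolding integral_torus_haar[OF c] integral_torus_haar[OF c2] Fw F0 avg_def wt_def by simp
qed

text \<open>The function \<open>F x t\<close> obtained by averaging at radius \<open>x\<close> and rotation angle \<open>t\<close> equals \<open>e\<^bsup>ikt\<^esup> f(x)\<close>. Differentiating
  both descriptions, once through the integral and once through this formula, expresses the averages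
  of all first and second derivatives of \<open>u\<close> by \<open>f\<close>, \<open>f'\<close> and \<open>f''\<close>. The two orders of
  mixed differentiation give the same result, so the antisymmetric second derivative averages to \<open>0\<close>.\<close>

lemma avg_radial_solution:
  assumes L: "\<And>z. z \<in> polydisc \<Longrightarrow> L_op j a b u z = 0"
  shows "radial_solution a b (k j) (\<lambda>x. avg (\<lambda>\<theta>. u (pt x 0 \<theta>)))"
proof -
  define f f' f'' where "f x = avg (\<lambda>\<theta>. u (pt x 0 \<theta>))" and "f' x = avg (D1 1 x 0)" and "f'' x = avg (D2 1 1 x 0)" for x
  define K :: complex where "K = of_int (k j)"
  note cont_angle = continuous_D_angles
  have const: "continuous_on {-1<..<1} (\<lambda>x :: real. c)" "continuous_on {-1<..<1} (\<lambda>x. \<i> * complex_of_real x)" for c :: complex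
    by (intro continuous_intros)+
  have A: "(f has_vector_derivative f' x) (at x)" if "x \<in> {-1<..<1}" for x
    unfolding f_def f'_def
    by (rule avg_deriv[OF u_dx cont_angle(3) continuous_D1_radius[OF const(1)] that])
  have B: "(f' has_vector_derivative f'' x) (at x)" if "x \<in> {-1<..<1}" for x
    unfolding f''_def f'_def
    by (rule avg_deriv[OF D1_dx cont_angle(1) continuous_D2_radius[OF const(1) const(1)] that])
  have cisK: "((\<lambda>t. cis (of_int (k j) * t) * X) has_vector_derivative \<i> * K * cis (of_int (k j) * t) * X) (at t)" for X t
  proof -
    have "((\<lambda>t. cis (of_int (k j) * t)) has_vector_derivative \<i> * K * cis (of_int (k j) * t)) (at t)"
      unfolding has_vector_derivative_def K_def
      by (auto intro!: derivative_eq_intros simp: scaleR_conv_of_real fun_eq_iff)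
    then show ?thesis by (rule has_vector_derivative_mult_left)
  qed
  have C: "avg (D1 (\<i> * of_real x) x t) = \<i> * K * cis (of_int (k j) * t) * f x" if x: "x \<in> {-1<..<1}" and t: "t \<in> {-1<..<1}" for x t
  proof -
    have "((\<lambda>t. avg (\<lambda>\<theta>. u (pt x t \<theta>))) has_vector_derivative avg (D1 (\<i> * of_real x) x t)) (at t)"
      by (rule avg_deriv[OF u_dt[OF x] cont_angle(3)[OF x] continuous_D1_angle[OF x] t])
    moreover have "((\<lambda>t. avg (\<lambda>\<theta>. u (pt x t \<theta>))) has_vector_derivative \<i> * K * cis (of_int (k j) * t) * f x) (at t)"
    proof -
      have "(\<lambda>t. avg (\<lambda>\<theta>. u (pt x t \<theta>))) = (\<lambda>t. cis (of_int (k j) * t) * f x)"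
        unfolding f_def by (rule ext) (rule avg_homogeneous[OF x])
      then show ?thesis using cisK by simp
    qed
    ultimately show ?thesis by (rule vector_derivative_unique_at)
  qed
  have Ftt: "avg (\<lambda>\<theta>. D2 (\<i> * of_real x) (\<i> * of_real x) x 0 \<theta> + D1 (- of_real x) x 0 \<theta>) = - K\<^sup>2 * f x" if x: "x \<in> {-1<..<1}" for x
  proof -
    have "((\<lambda>t. avg (D1 (\<i> * of_real x) x t)) has_vector_derivative avg (\<lambda>\<theta>. D2 (\<i> * of_real x) (\<i> * of_real x) x 0 \<theta> + D1 (- of_real x) x 0 \<theta>)) (at 0)"
      by (rule avg_deriv[OF D1x_dt[OF x] cont_angle(1)[OF x] continuous_on_add[OF continuous_D2_angle[OF x] continuous_D1_angle[OF x]]]) simp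
    moreover have "((\<lambda>t. avg (D1 (\<i> * of_real x) x t)) has_vector_derivative - K\<^sup>2 * f x) (at 0)"
    proof (rule has_vector_derivative_transform_within_open)
      show "((\<lambda>t. \<i> * K * (cis (of_int (k j) * t) * f x)) has_vector_derivative - K\<^sup>2 * f x) (at 0)"
        using has_vector_derivative_mult_right[OF cisK[of "f x" 0], of "\<i> * K"]
        by (simp add: power2_eq_square algebra_simps)
      show "\<i> * K * (cis (of_int (k j) * t) * f x) = avg (D1 (\<i> * of_real x) x t)" if "t \<in> {-1<..<1}" for t
        using C[OF x that] by (simp add: mult.assoc)
    qed auto
    ultimately show ?thesis by (rule vector_derivative_unique_at)
  qed
  \<comment> \<open>The mixed derivative, first in \<open>t\<close> and then in \<open>x\<close>; \<open>Fxt\<close> below is the other order.\<close>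
  have Ftx: "avg (\<lambda>\<theta>. D2 1 (\<i> * of_real x) x 0 \<theta> + D1 \<i> x 0 \<theta>) = \<i> * K * f' x" if x: "x \<in> {-1<..<1}" for x
  proof -
    have "((\<lambda>x. avg (D1 (\<i> * of_real x) x 0)) has_vector_derivative avg (\<lambda>\<theta>. D2 1 (\<i> * of_real x) x 0 \<theta> + D1 \<i> x 0 \<theta>)) (at x)"
      by (rule avg_deriv[OF D1x_dx cont_angle(1) continuous_on_add[OF continuous_D2_radius[OF const(1,2)] continuous_D1_radius[OF const(1)]] x])
    moreover have "((\<lambda>x. avg (D1 (\<i> * of_real x) x 0)) has_vector_derivative \<i> * K * f' x) (at x)"
    proof (rule has_vector_derivative_transform_within_open)
      show "((\<lambda>x. \<i> * K * f x) has_vector_derivative \<i> * K * f' x) (at x)"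
        by (rule has_vector_derivative_mult_right[OF A[OF x]])
      show "\<i> * K * f x = avg (D1 (\<i> * of_real x) x 0)" if "x \<in> {-1<..<1}" for x
        using C[OF that, of 0] by simp
    qed (use x in auto)
    ultimately show ?thesis by (rule vector_derivative_unique_at)
  qed
  have Fx: "avg (D1 1 x t) = cis (of_int (k j) * t) * f' x" if x: "x \<in> {-1<..<1}" for x t
  proof -
    have "((\<lambda>x. avg (\<lambda>\<theta>. u (pt x t \<theta>))) has_vector_derivative avg (D1 1 x t)) (at x)"
      by (rule avg_deriv[OF u_dx cont_angle(3) continuous_D1_radius[OF const(1)] x])
    moreover have "((\<lambda>x. avg (\<lambda>\<theta>. u (pt x t \<theta>))) has_vector_derivative cis (of_int (k j) * t) * f' x) (at x)"
    proof (rule has_vector_derivative_transform_within_open)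
      show "((\<lambda>x. cis (of_int (k j) * t) * f x) has_vector_derivative cis (of_int (k j) * t) * f' x) (at x)"
        by (rule has_vector_derivative_mult_right[OF A[OF x]])
      show "cis (of_int (k j) * t) * f x = avg (\<lambda>\<theta>. u (pt x t \<theta>))" if "x \<in> {-1<..<1}" for x
        unfolding f_def by (rule avg_homogeneous[OF that, symmetric])
    qed (use x in auto)
    ultimately show ?thesis by (rule vector_derivative_unique_at)
  qed
  have Fxt: "avg (\<lambda>\<theta>. D2 (\<i> * of_real x) 1 x 0 \<theta> + D1 \<i> x 0 \<theta>) = \<i> * K * f' x" if x: "x \<in> {-1<..<1}" for x
  proof -
    have "((\<lambda>t. avg (D1 1 x t)) has_vector_derivative avg (\<lambda>\<theta>. D2 (\<i> * of_real x) 1 x 0 \<theta> + D1 \<i> x 0 \<theta>)) (at 0)"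
      by (rule avg_deriv[OF D1_dt[OF x] cont_angle(1)[OF x] continuous_on_add[OF continuous_D2_angle[OF x] continuous_D1_angle[OF x]]]) simp
    moreover have "((\<lambda>t. avg (D1 1 x t)) has_vector_derivative \<i> * K * f' x) (at 0)"
      unfolding Fx[OF x] using cisK[of "f' x" 0] by simp
    ultimately show ?thesis by (rule vector_derivative_unique_at)
  qed
  have eq: "of_real (1 - x\<^sup>2) / 4 * (f'' x + f' x / of_real x - K\<^sup>2 / (of_real x)\<^sup>2 * f x)
          + (a + b) * of_real x * f' x / 2 + (a - b) * K / 2 * f x - a * b * f x = 0" if x: "x \<in> {0<..<1}" for x
  proof -
    have x': "x \<in> {-1<..<1}" using x by auto
    define X where "X = complex_of_real x"
    have X0: "X \<noteq> 0" using x by (simp add: X_def)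
    define E where "E \<theta> = cis (\<theta> $ j)" for \<theta> :: "real ^ 'n"
    have real_lin: "axis j (X * c) = x *\<^sub>R (axis j c :: complex ^ 'n)" for c
      using linear_cmul[OF linear_axis, of j x c] by (simp add: X_def scaleR_conv_of_real)
    have D1X: "D1 (X * c) x 0 \<theta> = X * D1 c x 0 \<theta>" "D1 (c * X) x 0 \<theta> = X * D1 c x 0 \<theta>" "D1 (- X) x 0 \<theta> = - (X * D1 1 x 0 \<theta>)" for c \<theta>
    proof -
      show 1: "D1 (X * c) x 0 \<theta> = X * D1 c x 0 \<theta>" for c
        unfolding mult.assoc real_lin blinfun.scaleR_right unfolding X_def by (rule scaleR_conv_of_real)
      show "D1 (c * X) x 0 \<theta> = X * D1 c x 0 \<theta>" unfolding mult.commute[of c X] by (rule 1)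
      have "axis j (- X * cis (\<theta> $ j + 0)) = - (axis j (X * cis (\<theta> $ j + 0)) :: complex ^ 'n)"
        using linear_neg[OF linear_axis, of j "X * cis (\<theta> $ j + 0)"] by simp
      then show "D1 (- X) x 0 \<theta> = - (X * D1 1 x 0 \<theta>)"
        using 1[of 1] by (simp add: blinfun.minus_right)
    qed
    have D2X: "D2 (c * X) d x 0 \<theta> = X * D2 c d x 0 \<theta>" "D2 c (d * X) x 0 \<theta> = X * D2 c d x 0 \<theta>" for c d \<theta>
    proof -
      have e: "c * X * cis y = X * (c * cis y)" for c y by (simp add: mult_ac)
      show "D2 (c * X) d x 0 \<theta> = X * D2 c d x 0 \<theta>" "D2 c (d * X) x 0 \<theta> = X * D2 c d x 0 \<theta>"
        unfolding e real_lin blinfun.scaleR_right blinfun.scaleR_left unfolding X_def by (rule scaleR_conv_of_real)+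
    qed
    have cD: "continuous_on angles (D1 c x 0)" "continuous_on angles (D2 c d x 0)" "continuous_on angles (\<lambda>\<theta>. u (pt x 0 \<theta>))" for c d
      by (rule cont_angle[OF x'])+
    define P1 where "P1 = avg (D1 \<i> x 0)"
    have P1: "X * P1 = \<i> * K * f x"
    proof -
      have "avg (D1 (\<i> * of_real x) x 0) = X * P1"
        unfolding P1_def avg_cmult[symmetric] X_def[symmetric] D1X ..
      then show ?thesis using C[OF x', of 0] by simp
    qed
    define Hii where "Hii = avg (D2 \<i> \<i> x 0)"
    have Hii: "X\<^sup>2 * Hii - X * f' x = - K\<^sup>2 * f x"
    proof -
      have "(\<lambda>\<theta>. D2 (\<i> * of_real x) (\<i> * of_real x) x 0 \<theta> + D1 (- of_real x) x 0 \<theta>) = (\<lambda>\<theta>. X\<^sup>2 * D2 \<i> \<i> x 0 \<theta> - X * D1 1 x 0 \<theta>)"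
        unfolding X_def[symmetric] D1X D2X by (simp add: power2_eq_square mult.assoc)
      then have "avg (\<lambda>\<theta>. X\<^sup>2 * D2 \<i> \<i> x 0 \<theta> - X * D1 1 x 0 \<theta>) = - K\<^sup>2 * f x" using Ftt[OF x'] by simp
      moreover have "avg (\<lambda>\<theta>. X\<^sup>2 * D2 \<i> \<i> x 0 \<theta> - X * D1 1 x 0 \<theta>) = X\<^sup>2 * Hii - X * f' x"
        unfolding avg_diff[OF continuous_on_mult_left[OF cD(2)] continuous_on_mult_left[OF cD(1)]] avg_cmult Hii_def f'_def ..
      ultimately show ?thesis by (simp only:)
    qed
    define H1i Hi1 where "H1i = avg (D2 1 \<i> x 0)" and "Hi1 = avg (D2 \<i> 1 x 0)"
    have sym: "H1i = Hi1"
    proof -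
      have "avg (\<lambda>\<theta>. X * D2 1 \<i> x 0 \<theta> + D1 \<i> x 0 \<theta>) = avg (\<lambda>\<theta>. X * D2 \<i> 1 x 0 \<theta> + D1 \<i> x 0 \<theta>)"
        using Ftx[OF x'] Fxt[OF x'] unfolding X_def[symmetric] D2X by simp
      then have "X * H1i + P1 = X * Hi1 + P1"
        unfolding avg_add[OF continuous_on_mult_left[OF cD(2)] cD(1)] avg_cmult H1i_def Hi1_def P1_def .
      then show ?thesis using X0 by simp
    qed
    \<comment> \<open>The equation at a point of the torus in the frame rotated to that point: the Laplacian, the
      antisymmetric part and the two first order terms are invariant under this rotation.\<close>
    have Lpt: "of_real (1 - x\<^sup>2) / 4 * (D2 1 1 x 0 \<theta> + D2 \<i> \<i> x 0 \<theta> + \<i> * (D2 1 \<i> x 0 \<theta> - D2 \<i> 1 x 0 \<theta>))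
      + a * X / 2 * (D1 1 x 0 \<theta> - \<i> * D1 \<i> x 0 \<theta>) + b * X / 2 * (D1 1 x 0 \<theta> + \<i> * D1 \<i> x 0 \<theta>) - a * b * u (pt x 0 \<theta>) = 0" for \<theta>
    proof -
      define z where "z = pt x 0 \<theta>"
      define cc ss where "cc = cos (\<theta> $ j)" and "ss = sin (\<theta> $ j)"
      have cs: "of_real cc * of_real cc + of_real ss * of_real ss = (1 :: complex)"
        unfolding of_real_mult[symmetric] of_real_add[symmetric] cc_def ss_def
        using sin_cos_squared_add[of "\<theta> $ j"] by (simp add: power2_eq_square add.commute)
      have z: "z \<in> polydisc" unfolding z_def by (rule pt_polydisc[OF x'])
      have zj: "z $ j = X * cis (\<theta> $ j)" by (simp add: z_def pt_def X_def)
      have nz: "(norm (z $ j))\<^sup>2 = x\<^sup>2" by (simp add: zj X_def norm_mult)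
      have ax: "axis j (1 * cis (\<theta> $ j + 0)) = cc *\<^sub>R axis j 1 + ss *\<^sub>R (axis j \<i> :: complex ^ 'n)"
        "axis j (\<i> * cis (\<theta> $ j + 0)) = cc *\<^sub>R axis j \<i> - ss *\<^sub>R (axis j 1 :: complex ^ 'n)"
        by (auto simp: axis_def vec_eq_iff cc_def ss_def complex_eq_iff)
      define d1 di h11 h1i hi1 hii where "d1 = u' z (axis j 1)" and "di = u' z (axis j \<i>)"
        and "h11 = u'' z (axis j 1) (axis j 1)" and "h1i = u'' z (axis j 1) (axis j \<i>)"
        and "hi1 = u'' z (axis j \<i>) (axis j 1)" and "hii = u'' z (axis j \<i>) (axis j \<i>)"
      have d: "D1 1 x 0 \<theta> = of_real cc * d1 + of_real ss * di" "D1 \<i> x 0 \<theta> = of_real cc * di - of_real ss * d1"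
        unfolding ax z_def[symmetric] blinfun.add_right blinfun.diff_right blinfun.scaleR_right d1_def di_def
        by (simp_all add: scaleR_conv_of_real)
      have h: "D2 1 1 x 0 \<theta> = of_real cc * (of_real cc * h11 + of_real ss * h1i) + of_real ss * (of_real cc * hi1 + of_real ss * hii)"
        "D2 \<i> \<i> x 0 \<theta> = of_real cc * (of_real cc * hii - of_real ss * hi1) - of_real ss * (of_real cc * h1i - of_real ss * h11)"
        "D2 1 \<i> x 0 \<theta> = of_real cc * (of_real cc * h1i - of_real ss * h11) + of_real ss * (of_real cc * hii - of_real ss * hi1)"
        "D2 \<i> 1 x 0 \<theta> = of_real cc * (of_real cc * hi1 + of_real ss * hii) - of_real ss * (of_real cc * h11 + of_real ss * h1i)"
        unfolding ax z_def[symmetric] blinfun.add_right blinfun.diff_right blinfun.scaleR_right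
          blinfun.add_left blinfun.diff_left blinfun.scaleR_left h11_def h1i_def hi1_def hii_def
        by (simp_all add: scaleR_conv_of_real algebra_simps)
      have s1: "D2 1 1 x 0 \<theta> + D2 \<i> \<i> x 0 \<theta> = h11 + hii"
      proof -
        have "D2 1 1 x 0 \<theta> + D2 \<i> \<i> x 0 \<theta> = (of_real cc * of_real cc + of_real ss * of_real ss) * (h11 + hii)"
          unfolding h by (simp add: algebra_simps)
        then show ?thesis unfolding cs by simp
      qed
      have s2: "D2 1 \<i> x 0 \<theta> - D2 \<i> 1 x 0 \<theta> = h1i - hi1"
      proof -
        have "D2 1 \<i> x 0 \<theta> - D2 \<i> 1 x 0 \<theta> = (of_real cc * of_real cc + of_real ss * of_real ss) * (h1i - hi1)"
          unfolding h by (simp add: algebra_simps)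
        then show ?thesis unfolding cs by simp
      qed
      have cis: "cis (\<theta> $ j) = of_real cc + \<i> * of_real ss" by (simp add: complex_eq_iff cc_def ss_def)
      have s3: "D1 1 x 0 \<theta> - \<i> * D1 \<i> x 0 \<theta> = cis (\<theta> $ j) * (d1 - \<i> * di)"
        "D1 1 x 0 \<theta> + \<i> * D1 \<i> x 0 \<theta> = cnj (cis (\<theta> $ j)) * (d1 + \<i> * di)"
        unfolding d cis by (simp_all add: algebra_simps)
      have "of_real (1 - (norm (z $ j))\<^sup>2) / 4 * (h11 + hii + \<i> * (h1i - hi1))
         + a * z $ j * (d1 - \<i> * di) / 2 + b * cnj (z $ j) * (d1 + \<i> * di) / 2 - a * b * u z = 0"
        using L[OF z] unfolding L_op_eq[OF z] d1_def di_def h11_def h1i_def hi1_def hii_def .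
      then have "of_real (1 - x\<^sup>2) / 4 * (h11 + hii + \<i> * (h1i - hi1))
         + a * (X * cis (\<theta> $ j)) * (d1 - \<i> * di) / 2 + b * cnj (X * cis (\<theta> $ j)) * (d1 + \<i> * di) / 2 - a * b * u z = 0"
        unfolding nz unfolding zj .
      moreover have "cnj (X * cis (\<theta> $ j)) = X * cnj (cis (\<theta> $ j))" by (simp add: X_def)
      ultimately show ?thesis
        unfolding s1 s2 s3 unfolding z_def[symmetric] by (simp only: mult_ac times_divide_eq_left times_divide_eq_right)
    qed
    let ?W = "complex_of_real (1 - x\<^sup>2) / 4"
    have "avg (\<lambda>\<theta>. ?W * (D2 1 1 x 0 \<theta> + D2 \<i> \<i> x 0 \<theta> + \<i> * (D2 1 \<i> x 0 \<theta> - D2 \<i> 1 x 0 \<theta>))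
      + a * X / 2 * (D1 1 x 0 \<theta> - \<i> * D1 \<i> x 0 \<theta>) + b * X / 2 * (D1 1 x 0 \<theta> + \<i> * D1 \<i> x 0 \<theta>) - a * b * u (pt x 0 \<theta>))
     = ?W * (f'' x + Hii + \<i> * (H1i - Hi1)) + a * X / 2 * (f' x - \<i> * P1) + b * X / 2 * (f' x + \<i> * P1) - a * b * f x"
      by (simp only: avg_add avg_diff avg_cmult cD continuous_on_add continuous_on_diff continuous_on_mult_left
           f''_def Hii_def H1i_def Hi1_def f'_def P1_def f_def)
    then have "?W * (f'' x + Hii + \<i> * (H1i - Hi1)) + a * X / 2 * (f' x - \<i> * P1) + b * X / 2 * (f' x + \<i> * P1) - a * b * f x = 0"
      unfolding Lpt by (simp add: avg_def)
    moreover have "Hii = f' x / X - K\<^sup>2 / X\<^sup>2 * f x"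
      using Hii X0 by (simp add: field_simps power2_eq_square)
    moreover have "a * X / 2 * (f' x - \<i> * P1) + b * X / 2 * (f' x + \<i> * P1) = (a + b) * X * f' x / 2 + (a - b) * K / 2 * f x"
    proof -
      have "a * X / 2 * (f' x - \<i> * P1) + b * X / 2 * (f' x + \<i> * P1) = (a + b) * X * f' x / 2 - \<i> * (a - b) / 2 * (X * P1)"
        by (simp add: field_simps)
      then show ?thesis unfolding P1 by (simp add: field_simps)
    qed
    ultimately have "?W * (f'' x + (f' x / X - K\<^sup>2 / X\<^sup>2 * f x)) + ((a + b) * X * f' x / 2 + (a - b) * K / 2 * f x) - a * b * f x = 0"
      unfolding sym by (simp only: diff_self mult_zero_right add_0_right add.assoc)
    then show ?thesis unfolding X_def[symmetric] by (simp only: add.assoc add_diff_eq)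
  qed
  have "continuous_on {0..<1} f"
    by (intro continuous_at_imp_continuous_on ballI has_vector_derivative_continuous[OF A]) auto
  moreover have "((\<lambda>x. of_real x * f' x) \<longlongrightarrow> 0) (at_right 0)"
  proof -
    have "isCont (\<lambda>x. of_real x * f' x) 0"
      using has_vector_derivative_continuous[OF B[of 0]] by (intro continuous_intros) auto
    then show ?thesis by (simp add: isCont_def filterlim_at_split)
  qed
  ultimately show ?thesis
    unfolding radial_solution_def f_def[symmetric] using A B eq unfolding K_def
    by (intro conjI exI[of _ f'] exI[of _ f''] ballI) auto
qed

lemma fourier_coeff_radial_solution:
  assumes L: "\<And>z. z \<in> polydisc \<Longrightarrow> L_op j a b u z = 0"
  shows "radial_solution a b (k j) (\<lambda>x. fourier_coeff u k (r(j := x)))"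
proof (rule radial_solution_cong[OF radial_solution_cmult[OF avg_radial_solution[OF L]]])
  fix x :: real assume "x \<in> {0..<1}"
  then show "of_real (1 / (2 * pi) ^ CARD('n)) * avg (\<lambda>\<theta>. u (pt x 0 \<theta>)) = fourier_coeff u k (r(j := x))"
    by (subst fourier_coeff_avg) (auto simp: scaleR_conv_of_real)
qed

end

end

section \<open>Growth of binomial and hypergeometric coefficients\<close>

text \<open>The Taylor coefficients of \<open>(1 - z)\<^bsup>-(a+1)\<^esup>\<close>.\<close>

definition rising_coeff :: "'a::field_char_0 \<Rightarrow> nat \<Rightarrow> 'a" where
  "rising_coeff a n = pochhammer (a + 1) n / fact n"

lemma rising_coeff_gbinomial: "rising_coeff a n = (- 1) ^ n * (- (a + 1) gchoose n)"
  by (simp add: rising_coeff_def gbinomial_pochhammer add.commute power_mult_distrib[symmetric] flip: mult.assoc)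

lemma rising_coeff_Suc: "rising_coeff a (Suc n) * of_nat (Suc n) = rising_coeff a n * (a + 1 + of_nat n)"
  by (simp add: rising_coeff_def pochhammer_Suc field_simps del: of_nat_Suc)

lemma rising_coeff_sums:
  fixes z :: complex
  assumes "norm z < 1"
  shows "(\<lambda>n. rising_coeff a n * z ^ n) sums (1 - z) powr (- (a + 1))"
  using gen_binomial_complex[of "- z" "- (a + 1)"] assms
  by (simp add: rising_coeff_gbinomial power_minus[of z] mult_ac)

lemma rising_coeff_sums_real:
  fixes x :: real
  assumes "\<bar>x\<bar> < 1"
  shows "(\<lambda>n. rising_coeff a n * x ^ n) sums (1 - x) powr (- (a + 1))"
  using gen_binomial_real[of "- x" "- (a + 1)"] assms
  by (simp add: rising_coeff_gbinomial power_minus[of x] mult_ac)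

lemma rising_coeff_summable_norm:
  fixes z :: complex
  assumes "norm z < 1"
  shows "summable (\<lambda>n. norm (rising_coeff a n * z ^ n))"
proof -
  obtain r where r: "norm z < r" "r < 1" using dense[OF assms] by blast
  have "r \<ge> 0" using r(1) norm_ge_zero[of z] by linarith
  then show ?thesis
    using r by (intro powser_insidea[OF sums_summable[OF rising_coeff_sums[of "of_real r" a]]]) auto
qed

text \<open>The coefficient grows like \<open>n\<^sup>a / \<Gamma>(a+1)\<close>; the power is written as an exponential so that
  real and complex exponents are treated alike.\<close>

lemma rising_coeff_asymptotic:
  fixes a :: "'a :: Gamma"
  shows "(\<lambda>n. rising_coeff a n * exp (- a * of_real (ln (real n)))) \<longlonglongrightarrow> rGamma (a + 1)"
proof -
  have "(\<lambda>n. (- (a + 1) gchoose n) / ((- 1) ^ n / exp ((- (a + 1) + 1) * of_real (ln (real n))))) \<longlonglongrightarrow> inverse (Gamma (- (- (a + 1))))"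
    by (rule gbinomial_asymptotic)
  moreover have "(- (a + 1) gchoose n) / ((- 1) ^ n / exp ((- (a + 1) + 1) * of_real (ln (real n)))) = rising_coeff a n * exp (- a * of_real (ln (real n)))" for n
    by (cases "even n") (simp_all add: rising_coeff_gbinomial)
  ultimately show ?thesis by (simp add: rGamma_inverse_Gamma add.commute)
qed

lemma rising_coeff_shift_asymptotic:
  fixes a :: complex
  shows "(\<lambda>n. rising_coeff a (n + p) * exp (- a * of_real (ln (real n)))) \<longlonglongrightarrow> rGamma (a + 1)"
proof -
  have 1: "(\<lambda>n. rising_coeff a (n + p) * exp (- a * of_real (ln (real (n + p))))) \<longlonglongrightarrow> rGamma (a + 1)"
    using LIMSEQ_ignore_initial_segment[OF rising_coeff_asymptotic] .
  have "(\<lambda>n. ln (real (n + p)) - ln (real n)) \<longlonglongrightarrow> 0" by real_asymp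
  then have "(\<lambda>n. exp (a * of_real (ln (real (n + p)) - ln (real n)))) \<longlonglongrightarrow> exp (a * of_real 0)"
    by (intro tendsto_intros)
  from tendsto_mult[OF 1 this]
  have "(\<lambda>n. rising_coeff a (n + p) * (exp (- a * of_real (ln (real (n + p)))) * exp (a * of_real (ln (real (n + p)) - ln (real n))))) \<longlonglongrightarrow> rGamma (a + 1)"
    by (simp add: mult.assoc)
  moreover have "exp (- a * of_real (ln (real (n + p)))) * exp (a * of_real (ln (real (n + p)) - ln (real n))) = exp (- a * of_real (ln (real n)))" for n
    by (simp add: algebra_simps flip: exp_add)
  ultimately show ?thesis by simp
qed

lemma rising_coeff_pos: "\<sigma> > 0 \<Longrightarrow> rising_coeff (\<sigma> - 1 :: real) n > 0"
  by (simp add: rising_coeff_def pochhammer_pos)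

lemma nonpos_Ints_iff: "(a :: complex) + 1 \<notin> \<int>\<^sub>\<le>\<^sub>0 \<longleftrightarrow> (\<forall>k\<ge>1. a \<noteq> - of_nat k)"
proof
  assume 1: "a + 1 \<notin> \<int>\<^sub>\<le>\<^sub>0"
  show "\<forall>k\<ge>1. a \<noteq> - of_nat k"
  proof (intro allI impI notI)
    fix k :: nat assume "k \<ge> 1" "a = - of_nat k"
    then have "a + 1 = - of_nat (k - 1)" by (simp add: of_nat_diff)
    then show False using 1 by auto
  qed
next
  assume 2: "\<forall>k\<ge>1. a \<noteq> - of_nat k"
  show "a + 1 \<notin> \<int>\<^sub>\<le>\<^sub>0"
  proof
    assume "a + 1 \<in> \<int>\<^sub>\<le>\<^sub>0"
    then obtain k where "a + 1 = - of_nat k" by (elim nonpos_Ints_cases')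
    then have "a = - of_nat (Suc k)" by (simp add: algebra_simps) (metis add_diff_cancel_right' diff_minus_eq_add minus_diff_eq uminus_add_conv_diff)
    then show False using 2[rule_format, of "Suc k"] by simp
  qed
qed

text \<open>The positive coefficients \<open>rising_coeff (\<sigma> - 1) n\<close> belong to the series of \<open>(1 - x)\<^bsup>-\<sigma>\<^esup>\<close>, which tends to
  infinity and so outweighs any finite part of the other series as \<open>x \<rightarrow> 1\<close>.\<close>

lemma abelian_small_o:
  fixes e :: "nat \<Rightarrow> complex" and \<sigma> :: real
  assumes \<sigma>: "\<sigma> > 0" and e: "(\<lambda>n. e n / of_real (rising_coeff (\<sigma> - 1) n)) \<longlonglongrightarrow> 0"
  shows "((\<lambda>x. of_real ((1 - x) powr \<sigma>) * (\<Sum>n. e n * of_real x ^ n)) \<longlongrightarrow> 0) (at_left 1)"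
proof (rule tendstoI)
  fix \<epsilon> :: real assume \<epsilon>: "\<epsilon> > 0"
  define Q where "Q = rising_coeff (\<sigma> - 1)"
  have Q: "Q n > 0" for n unfolding Q_def using \<sigma> by (rule rising_coeff_pos)
  have sQ: "(\<lambda>n. Q n * x ^ n) sums (1 - x) powr (- \<sigma>)" if "0 \<le> x" "x < 1" for x
    using rising_coeff_sums_real[of x "\<sigma> - 1"] that by (simp add: Q_def)
  have "\<forall>\<^sub>F n in sequentially. norm (e n / of_real (Q n)) < \<epsilon> / 2"
    using order_tendstoD(2)[OF tendsto_norm_zero[OF e], of "\<epsilon> / 2"] \<epsilon> by (simp add: Q_def)
  then obtain N where N': "\<And>n. n \<ge> N \<Longrightarrow> norm (e n / of_real (Q n)) < \<epsilon> / 2"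
    unfolding eventually_sequentially by blast
  have N: "norm (e n) \<le> \<epsilon> / 2 * Q n" if "n \<ge> N" for n
    using N'[OF that] Q[of n] by (simp add: norm_divide field_simps)
  \<comment> \<open>The first \<open>N\<close> terms are bounded by \<open>K\<close>; the others by half of \<open>\<epsilon>\<close> times the comparison series.\<close>
  define K where "K = (\<Sum>n<N. norm (e n))"
  have bnd: "norm (of_real ((1 - x) powr \<sigma>) * (\<Sum>n. e n * of_real x ^ n)) \<le> (1 - x) powr \<sigma> * K + \<epsilon> / 2"
    if x: "0 \<le> x" "x < 1" for x
  proof -
    let ?g = "\<lambda>n. (if n < N then norm (e n) else 0) + \<epsilon> / 2 * (Q n * x ^ n)"
    have g: "?g sums (K + \<epsilon> / 2 * (1 - x) powr (- \<sigma>))"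
      unfolding K_def using sums_If_finite_set[of "{..<N}" "\<lambda>n. norm (e n)"]
      by (intro sums_add sums_mult sQ x) (simp add: lessThan_def)
    have le: "norm (e n * of_real x ^ n) \<le> ?g n" for n
    proof (cases "n < N")
      case True
      have "norm (e n * of_real x ^ n) \<le> norm (e n) * 1"
        using x by (simp add: norm_mult norm_power mult_left_le power_le_one)
      also have "\<dots> \<le> ?g n" using True Q[of n] x \<epsilon> by simp
      finally show ?thesis .
    next
      case False
      then have "norm (e n) * x ^ n \<le> \<epsilon> / 2 * Q n * x ^ n" using N[of n] x by (intro mult_right_mono) auto
      then show ?thesis using False x by (simp add: norm_mult norm_power)
    qed
    have sn: "summable (\<lambda>n. norm (e n * of_real x ^ n))"
      by (rule summable_comparison_test'[OF sums_summable[OF g], of 0]) (simp only: real_norm_def abs_norm_cancel le)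
    have "norm (\<Sum>n. e n * of_real x ^ n) \<le> (\<Sum>n. norm (e n * of_real x ^ n))" by (rule summable_norm[OF sn])
    also have "\<dots> \<le> K + \<epsilon> / 2 * (1 - x) powr (- \<sigma>)"
      unfolding sums_unique[OF g] by (rule suminf_le[OF le sn sums_summable[OF g]])
    finally have "(1 - x) powr \<sigma> * norm (\<Sum>n. e n * of_real x ^ n) \<le> (1 - x) powr \<sigma> * (K + \<epsilon> / 2 * (1 - x) powr (- \<sigma>))"
      by (intro mult_left_mono) auto
    also have "\<dots> = (1 - x) powr \<sigma> * K + \<epsilon> / 2" using x by (simp add: distrib_left powr_minus)
    finally show ?thesis by (simp add: norm_mult)
  qed
  have "((\<lambda>x. (1 - x) powr \<sigma> * K + \<epsilon> / 2) \<longlongrightarrow> 0 * K + \<epsilon> / 2) (at_left 1)"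
    using \<sigma> by (intro tendsto_intros) real_asymp
  from order_tendstoD(2)[OF this, of \<epsilon>] have "\<forall>\<^sub>F x in at_left 1. (1 - x) powr \<sigma> * K + \<epsilon> / 2 < \<epsilon>"
    using \<epsilon> by simp
  moreover have "\<forall>\<^sub>F x in at_left (1::real). x \<in> {0<..<1}"
    by (rule eventually_at_left_real) simp
  ultimately show "\<forall>\<^sub>F x in at_left 1. dist (of_real ((1 - x) powr \<sigma>) * (\<Sum>n. e n * of_real x ^ n)) 0 < \<epsilon>"
  proof eventually_elim
    case (elim x)
    then have "norm (of_real ((1 - x) powr \<sigma>) * (\<Sum>n. e n * of_real x ^ n)) \<le> (1 - x) powr \<sigma> * K + \<epsilon> / 2"
      by (intro bnd) auto
    with elim(1) show ?case unfolding dist_norm diff_zero by linarith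
  qed
qed

text \<open>The coefficients of a multiple of the hypergeometric series \<open>F(a+1+p, b+1; p+1; x)\<close>.\<close>

definition hyp_coeff :: "complex \<Rightarrow> complex \<Rightarrow> nat \<Rightarrow> nat \<Rightarrow> complex" where
  "hyp_coeff a b p n = rising_coeff a (n + p) * rising_coeff b n"

definition hyp_series :: "complex \<Rightarrow> complex \<Rightarrow> nat \<Rightarrow> complex \<Rightarrow> complex" where
  "hyp_series a b p x = (\<Sum>n. hyp_coeff a b p n * x ^ n)"

text \<open>All three coefficient sequences have power growth, with exponents \<open>a\<close>, \<open>b\<close> and \<open>a + b\<close>; the factor in front of the last
  is the quotient of the limiting constants.\<close>

lemma hyp_coeff_ratio:
  assumes "Re a + Re b > -1"
  shows "(\<lambda>n. (hyp_coeff a b p n - rGamma (a + 1) * rGamma (b + 1) * Gamma (a + b + 1) * rising_coeff (a + b) n)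
            / of_real (rising_coeff (Re a + Re b) n)) \<longlonglongrightarrow> 0"
proof -
  define L where "L = rGamma (a + 1) * rGamma (b + 1) * Gamma (a + b + 1)"
  define \<sigma> where "\<sigma> = Re a + Re b"
  have nz: "a + b + 1 \<notin> \<int>\<^sub>\<le>\<^sub>0"
  proof
    assume "a + b + 1 \<in> \<int>\<^sub>\<le>\<^sub>0"
    then have "Re (a + b + 1) \<le> 0" by (elim nonpos_Ints_cases') simp
    then show False using assms by simp
  qed
  have rG: "Gamma (a + b + 1) * rGamma (a + b + 1) = 1"
    using nz by (simp add: rGamma_inverse_Gamma Gamma_eq_zero_iff)
  have "\<sigma> + 1 \<notin> \<int>\<^sub>\<le>\<^sub>0"
  proof
    assume "\<sigma> + 1 \<in> \<int>\<^sub>\<le>\<^sub>0"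
    then obtain k where "\<sigma> + 1 = - of_nat k" by (elim nonpos_Ints_cases')
    then show False using assms by (simp add: \<sigma>_def)
  qed
  then have s0: "rGamma (\<sigma> + 1) \<noteq> 0" by (simp add: rGamma_eq_zero_iff)
  let ?E = "\<lambda>n. exp (- (a + b) * of_real (ln (real n)))"
  have 1: "(\<lambda>n. (rising_coeff a (n + p) * exp (- a * of_real (ln (real n)))) * (rising_coeff b n * exp (- b * of_real (ln (real n))))
      - L * (rising_coeff (a + b) n * ?E n)) \<longlonglongrightarrow> rGamma (a + 1) * rGamma (b + 1) - L * rGamma (a + b + 1)"
    using rising_coeff_asymptotic[of "a + b"]
    by (intro tendsto_intros rising_coeff_shift_asymptotic rising_coeff_asymptotic) 
  have 2: "rGamma (a + 1) * rGamma (b + 1) - L * rGamma (a + b + 1) = 0"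
    using rG by (simp add: L_def mult.assoc)
  have 3: "(rising_coeff a (n + p) * exp (- a * of_real (ln (real n)))) * (rising_coeff b n * exp (- b * of_real (ln (real n))))
      - L * (rising_coeff (a + b) n * ?E n) = (hyp_coeff a b p n - L * rising_coeff (a + b) n) * ?E n" for n
    by (simp add: hyp_coeff_def algebra_simps exp_diff exp_minus) (simp add: field_simps exp_add[symmetric])
  have "(\<lambda>n. norm ((hyp_coeff a b p n - L * rising_coeff (a + b) n) * ?E n)) \<longlonglongrightarrow> 0"
    using tendsto_norm_zero[OF 1[unfolded 2]] unfolding 3 .
  moreover have "(\<lambda>n. rising_coeff \<sigma> n * exp (- \<sigma> * ln (real n))) \<longlonglongrightarrow> rGamma (\<sigma> + 1)"
    using rising_coeff_asymptotic[of \<sigma>] by simp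
  ultimately have "(\<lambda>n. norm ((hyp_coeff a b p n - L * rising_coeff (a + b) n) * ?E n) / (rising_coeff \<sigma> n * exp (- \<sigma> * ln (real n)))) \<longlonglongrightarrow> 0 / rGamma (\<sigma> + 1)"
    using s0 by (intro tendsto_divide)
  moreover have "norm ((hyp_coeff a b p n - L * rising_coeff (a + b) n) * ?E n) / (rising_coeff \<sigma> n * exp (- \<sigma> * ln (real n)))
     = norm ((hyp_coeff a b p n - L * rising_coeff (a + b) n) / of_real (rising_coeff \<sigma> n))" for n
  proof -
    have "rising_coeff \<sigma> n > 0" using rising_coeff_pos[of "\<sigma> + 1" n] assms by (simp add: \<sigma>_def)
    moreover have "norm (?E n) = exp (- \<sigma> * ln (real n))" by (simp add: \<sigma>_def norm_exp_eq_Re algebra_simps)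
    ultimately show ?thesis by (simp add: norm_mult norm_divide)
  qed
  ultimately have "(\<lambda>n. norm ((hyp_coeff a b p n - L * rising_coeff (a + b) n) / of_real (rising_coeff \<sigma> n))) \<longlonglongrightarrow> 0" by simp
  then show ?thesis unfolding L_def \<sigma>_def by (rule tendsto_norm_zero_cancel)
qed

lemma hyp_coeff_summable:
  assumes "Re a + Re b > -1" "norm x < 1"
  shows "summable (\<lambda>n. hyp_coeff a b p n * x ^ n)"
proof -
  define L where "L = rGamma (a + 1) * rGamma (b + 1) * Gamma (a + b + 1)"
  define \<sigma> where "\<sigma> = Re a + Re b"
  have pos: "rising_coeff \<sigma> n > 0" for n using rising_coeff_pos[of "\<sigma> + 1" n] assms by (simp add: \<sigma>_def)
  have "Bseq (\<lambda>n. (hyp_coeff a b p n - L * rising_coeff (a + b) n) / of_real (rising_coeff \<sigma> n))"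
    unfolding L_def \<sigma>_def by (rule convergent_imp_Bseq, rule convergentI, rule hyp_coeff_ratio[OF assms(1)])
  then obtain K where K: "\<And>n. norm ((hyp_coeff a b p n - L * rising_coeff (a + b) n) / of_real (rising_coeff \<sigma> n)) \<le> K"
    unfolding Bseq_def by blast
  have le: "norm ((hyp_coeff a b p n - L * rising_coeff (a + b) n) * x ^ n) \<le> K * (rising_coeff \<sigma> n * norm x ^ n)" for n
  proof -
    have "norm (hyp_coeff a b p n - L * rising_coeff (a + b) n) \<le> K * rising_coeff \<sigma> n"
      using K[of n] pos[of n] by (simp add: norm_divide field_simps)
    then show ?thesis by (auto simp: norm_mult norm_power mult.assoc[symmetric] intro: mult_right_mono)
  qed
  have "summable (\<lambda>n. K * (rising_coeff \<sigma> n * norm x ^ n))"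
    using rising_coeff_sums_real[of "norm x" \<sigma>] assms(2) by (intro summable_mult sums_summable) auto
  then have "summable (\<lambda>n. (hyp_coeff a b p n - L * rising_coeff (a + b) n) * x ^ n)"
    by (rule summable_comparison_test'[of _ 0]) (rule le)
  from summable_add[OF this summable_mult[OF sums_summable[OF rising_coeff_sums[OF assms(2), of "a + b"]], of L]]
  have "summable (\<lambda>n. (hyp_coeff a b p n - L * rising_coeff (a + b) n) * x ^ n + L * (rising_coeff (a + b) n * x ^ n))" .
  then show ?thesis by (simp add: algebra_simps)
qed

text \<open>Replacing the coefficients by their asymptotic equivalents changes the sum by a term that is negligible against
  \<open>(1 - x)\<^bsup>-(a+b+1)\<^esup>\<close>, and the equivalent series is a multiple of exactly that power.\<close>

lemma hyp_series_limit:
  assumes "Re a + Re b > -1"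
  shows "((\<lambda>x. of_real (1 - x) powr (a + b + 1) * hyp_series a b p (of_real x)) \<longlongrightarrow>
            rGamma (a + 1) * rGamma (b + 1) * Gamma (a + b + 1)) (at_left 1)"
proof -
  define L where "L = rGamma (a + 1) * rGamma (b + 1) * Gamma (a + b + 1)"
  define \<sigma> where "\<sigma> = Re a + Re b"
  define e where "e n = hyp_coeff a b p n - L * rising_coeff (a + b) n" for n
  have "((\<lambda>x. of_real ((1 - x) powr (\<sigma> + 1)) * (\<Sum>n. e n * of_real x ^ n)) \<longlongrightarrow> 0) (at_left 1)"
    using hyp_coeff_ratio[OF assms, of p] assms by (intro abelian_small_o) (auto simp: e_def L_def \<sigma>_def)
  then have "((\<lambda>x. norm (of_real ((1 - x) powr (\<sigma> + 1)) * (\<Sum>n. e n * of_real x ^ n))) \<longlongrightarrow> 0) (at_left 1)"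
    by (rule tendsto_norm_zero)
  moreover have ev: "\<forall>\<^sub>F x in at_left (1::real). x \<in> {0<..<1}"
    by (rule eventually_at_left_real) simp
  then have "\<forall>\<^sub>F x in at_left 1. norm (of_real ((1 - x) powr (\<sigma> + 1)) * (\<Sum>n. e n * of_real x ^ n)) =
     norm (of_real (1 - x) powr (a + b + 1) * hyp_series a b p (of_real x) - L)"
  proof eventually_elim
    case (elim x)
    have x: "norm (complex_of_real x) < 1" using elim by simp
    have w: "complex_of_real (1 - x) \<noteq> 0" using elim by (simp del: of_real_diff)
    have "(\<lambda>n. e n * of_real x ^ n) sums (hyp_series a b p (of_real x) - L * (1 - of_real x) powr (- (a + b + 1)))"
      unfolding e_def left_diff_distrib hyp_series_def mult.assoc
      by (intro sums_diff sums_mult summable_sums hyp_coeff_summable[OF assms x] rising_coeff_sums[OF x])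
    then have s: "(\<Sum>n. e n * of_real x ^ n) = hyp_series a b p (of_real x) - L * of_real (1 - x) powr (- (a + b + 1))"
      by (simp add: sums_unique[symmetric])
    have "norm (complex_of_real ((1 - x) powr (\<sigma> + 1))) = norm (of_real (1 - x) powr (a + b + 1))"
      using elim by (simp add: norm_powr_real_powr \<sigma>_def del: of_real_diff)
    then have "norm (of_real ((1 - x) powr (\<sigma> + 1)) * (\<Sum>n. e n * of_real x ^ n)) =
       norm (of_real (1 - x) powr (a + b + 1) * (hyp_series a b p (of_real x) - L * of_real (1 - x) powr (- (a + b + 1))))"
      unfolding s norm_mult by simp
    also have "of_real (1 - x) powr (a + b + 1) * (hyp_series a b p (of_real x) - L * of_real (1 - x) powr (- (a + b + 1)))
       = of_real (1 - x) powr (a + b + 1) * hyp_series a b p (of_real x) - L"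
    proof -
      have "W powr s * W powr (- s) = 1" if "W \<noteq> 0" for W s :: complex
        using that by (simp flip: powr_add)
      from this[OF w] have "of_real (1 - x) powr (a + b + 1) * of_real (1 - x) powr (- (a + b + 1)) = (1 :: complex)" .
      then show ?thesis by (simp add: right_diff_distrib mult.left_commute del: of_real_diff)
    qed
    finally show ?case .
  qed
  ultimately have "((\<lambda>x. norm (of_real (1 - x) powr (a + b + 1) * hyp_series a b p (of_real x) - L)) \<longlongrightarrow> 0) (at_left 1)"
    by (rule Lim_transform_eventually)
  then show ?thesis unfolding L_def[symmetric] by (simp add: tendsto_norm_zero_iff LIM_zero_iff)
qed

section \<open>Hypergeometric solutions of the radial equation\<close>

lemma hyp_coeff_rec:
  "of_nat (Suc n) * (of_nat (Suc n) + of_nat p) * hyp_coeff a b p (Suc n)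
     = (of_nat n + (a + 1 + of_nat p)) * (of_nat n + (b + 1)) * hyp_coeff a b p n"
proof -
  have "of_nat (Suc n) * (of_nat (Suc n) + of_nat p) * hyp_coeff a b p (Suc n) =
     (rising_coeff a (Suc (n + p)) * of_nat (Suc (n + p))) * (rising_coeff b (Suc n) * of_nat (Suc n))"
  proof -
    have e: "of_nat (Suc n) + of_nat p = (of_nat (Suc (n + p)) :: complex)" by simp
    show ?thesis unfolding hyp_coeff_def e add_Suc by (simp only: mult_ac)
  qed
  also have "\<dots> = (rising_coeff a (n + p) * (a + 1 + of_nat (n + p))) * (rising_coeff b n * (b + 1 + of_nat n))"
    unfolding rising_coeff_Suc ..
  finally show ?thesis by (simp add: hyp_coeff_def algebra_simps)
qed

text \<open>With \<open>\<theta> = x d/dx\<close> the recurrence of the coefficients reads \<open>\<theta> (\<theta> + p) G = x (\<theta> + a + 1 + p) (\<theta> + b + 1) G\<close>.\<close>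

lemma hyp_series_ode:
  assumes ab: "Re a + Re b > -1"
  shows "\<exists>G' G''. \<forall>x. norm x < 1 \<longrightarrow> (hyp_series a b p has_field_derivative G' x) (at x) \<and>
     (G' has_field_derivative G'' x) (at x) \<and>
     (x \<noteq> 0 \<longrightarrow> x * (1 - x) * G'' x + (of_nat p + 1 - (a + b + of_nat p + 3) * x) * G' x
         - (a + 1 + of_nat p) * (b + 1) * hyp_series a b p x = 0)"
proof -
  define d where "d = hyp_coeff a b p"
  note sm = hyp_coeff_summable[OF ab, of _ p, folded d_def]
  define G' where "G' x = (\<Sum>n. diffs d n * x ^ n)" for x
  define G'' where "G'' x = (\<Sum>n. diffs (diffs d) n * x ^ n)" for x
  have sm1: "summable (\<lambda>n. diffs d n * x ^ n)" if "norm x < 1" for x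
    by (rule termdiff_converges[OF that]) (rule sm)
  have sm2: "summable (\<lambda>n. diffs (diffs d) n * x ^ n)" if "norm x < 1" for x
    by (rule termdiff_converges[OF that]) (rule sm1)
  have G: "(hyp_series a b p has_field_derivative G' x) (at x)" if "norm x < 1" for x
    unfolding hyp_series_def[abs_def] G'_def d_def[symmetric] using termdiffs_strong'[OF sm that] .
  have dG: "(G' has_field_derivative G'' x) (at x)" if "norm x < 1" for x
    unfolding G'_def G''_def using termdiffs_strong'[OF sm1 that] .
  have ode: "x * (1 - x) * G'' x + (of_nat p + 1 - (a + b + of_nat p + 3) * x) * G' x
         - (a + 1 + of_nat p) * (b + 1) * hyp_series a b p x = 0" if x: "norm x < 1" "x \<noteq> 0" for x
  proof -
    have S0: "(\<lambda>n. d n * x ^ n) sums hyp_series a b p x"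
      unfolding hyp_series_def d_def[symmetric] by (rule summable_sums[OF sm[OF x(1)]])
    have S1: "(\<lambda>n. of_nat n * d n * x ^ n) sums (x * G' x)"
    proof -
      have "(\<lambda>n. x * (of_nat n * d n * x ^ (n - Suc 0))) sums (x * G' x)"
        unfolding G'_def by (intro sums_mult diffs_equiv sm1 x)
      moreover have "x * (of_nat n * d n * x ^ (n - Suc 0)) = of_nat n * d n * x ^ n" for n by (cases n) auto
      ultimately show ?thesis by simp
    qed
    have S2: "(\<lambda>n. of_nat n * (of_nat n - 1) * d n * x ^ n) sums (x\<^sup>2 * G'' x)"
    proof -
      have "(\<lambda>n. x * (of_nat n * diffs d n * x ^ (n - Suc 0))) sums (x * G'' x)"
        unfolding G''_def by (intro sums_mult diffs_equiv sm2 x)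
      moreover have "x * (of_nat n * diffs d n * x ^ (n - Suc 0)) = of_nat n * diffs d n * x ^ n" for n by (cases n) auto
      ultimately have "(\<lambda>n. of_nat n * diffs d n * x ^ n) sums (x * G'' x)" by simp
      then have "(\<lambda>n. x * (of_nat n * diffs d n * x ^ n)) sums (x * (x * G'' x))" by (rule sums_mult)
      then have "(\<lambda>n. of_nat (Suc n) * (of_nat (Suc n) - 1) * d (Suc n) * x ^ Suc n) sums (x * (x * G'' x))"
        by (simp add: diffs_def mult_ac del: of_nat_Suc) (simp add: mult_ac)
      then show ?thesis
        by (subst (asm) sums_Suc_iff) (simp add: power2_eq_square mult_ac)
    qed
    have lhs: "(\<lambda>n. of_nat n * (of_nat n + of_nat p) * d n * x ^ n) sums (x\<^sup>2 * G'' x + (1 + of_nat p) * (x * G' x))"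
      using sums_add[OF S2 sums_mult[OF S1, of "1 + of_nat p"]] by (simp add: algebra_simps)
    define s0 where "s0 = x * (x\<^sup>2 * G'' x + (a + b + of_nat p + 3) * (x * G' x) + (a + 1 + of_nat p) * (b + 1) * hyp_series a b p x)"
    have "(\<lambda>n. x * (of_nat n * (of_nat n - 1) * d n * x ^ n + (a + b + of_nat p + 3) * (of_nat n * d n * x ^ n) + (a + 1 + of_nat p) * (b + 1) * (d n * x ^ n))) sums s0"
      unfolding s0_def by (intro sums_mult sums_add S0 S1 S2)
    moreover have "x * (of_nat n * (of_nat n - 1) * d n * x ^ n + (a + b + of_nat p + 3) * (of_nat n * d n * x ^ n) + (a + 1 + of_nat p) * (b + 1) * (d n * x ^ n))
      = of_nat (Suc n) * (of_nat (Suc n) + of_nat p) * d (Suc n) * x ^ Suc n" for n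
      unfolding d_def hyp_coeff_rec by (simp add: algebra_simps)
    ultimately have "(\<lambda>n. of_nat (Suc n) * (of_nat (Suc n) + of_nat p) * d (Suc n) * x ^ Suc n) sums s0" by (simp only:)
    then have "(\<lambda>n. of_nat n * (of_nat n + of_nat p) * d n * x ^ n) sums s0"
      by (subst (asm) sums_Suc_iff) simp
    with lhs have "x\<^sup>2 * G'' x + (1 + of_nat p) * (x * G' x) = s0" by (rule sums_unique2)
    then have "x * (x * (1 - x) * G'' x + (of_nat p + 1 - (a + b + of_nat p + 3) * x) * G' x
         - (a + 1 + of_nat p) * (b + 1) * hyp_series a b p x) = 0"
      unfolding s0_def by (simp add: algebra_simps power2_eq_square)
    then show ?thesis using x(2) by simp
  qed
  show ?thesis by (intro exI[of _ G'] exI[of _ G''] allI impI conjI G dG ode)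
qed

definition radial_factor :: "complex \<Rightarrow> complex \<Rightarrow> nat \<Rightarrow> real \<Rightarrow> complex" where
  "radial_factor a b p r = c_const a b * of_real (1 - r\<^sup>2) powr (a + b + 1) * of_real r ^ p * hyp_series a b p ((of_real r)\<^sup>2)"

text \<open>Write the function as \<open>E H\<close> with \<open>E = c (1 - r\<^sup>2)\<^bsup>a+b+1\<^esup> r\<^sup>p\<close> and let \<open>e\<close> be the logarithmic derivative
  of \<open>E\<close>. Division by \<open>E\<close> turns the radial equation into the hypergeometric equation at \<open>x = r\<^sup>2\<close>; the
  identities \<open>c1\<close> and \<open>c0\<close> match the coefficients of \<open>G'\<close> and \<open>G\<close>.\<close>

lemma radial_factor_solution:
  assumes ab: "Re a + Re b > -1"
  shows "radial_solution a b (int p) (radial_factor a b p)"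
proof -
  obtain G' G'' where GG: "\<forall>x. norm x < 1 \<longrightarrow> (hyp_series a b p has_field_derivative G' x) (at x) \<and>
     (G' has_field_derivative G'' x) (at x) \<and>
     (x \<noteq> 0 \<longrightarrow> x * (1 - x) * G'' x + (of_nat p + 1 - (a + b + of_nat p + 3) * x) * G' x
         - (a + 1 + of_nat p) * (b + 1) * hyp_series a b p x = 0)"
    using hyp_series_ode[OF ab, of p] by (elim exE)
  have G: "(hyp_series a b p has_field_derivative G' x) (at x)" if "norm x < 1" for x
    using GG[rule_format, OF that] by (elim conjE)
  have G': "(G' has_field_derivative G'' x) (at x)" if "norm x < 1" for x
    using GG[rule_format, OF that] by (elim conjE)
  have ode: "x * (1 - x) * G'' x + (of_nat p + 1 - (a + b + of_nat p + 3) * x) * G' x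
         - (a + 1 + of_nat p) * (b + 1) * hyp_series a b p x = 0" if "norm x < 1" "x \<noteq> 0" for x
    using GG[rule_format, OF that(1)] that(2) by (elim conjE) (rule mp)
  define s where "s = a + b + 1"
  define P :: complex where "P = of_nat p"
  define H where "H = hyp_series a b p"
  define E where "E r = c_const a b * of_real (1 - r\<^sup>2) powr s * of_real r ^ p" for r :: real
  define R where "R r = complex_of_real r" for r
  define w where "w r = 1 - (R r)\<^sup>2" for r
  define e where "e r = P / R r - 2 * s * R r / w r" for r
  define e' where "e' r = - P / (R r)\<^sup>2 - 2 * s / w r - 4 * s * (R r)\<^sup>2 / (w r)\<^sup>2" for r
  define f' where "f' r = E r * (e r * H ((R r)\<^sup>2) + 2 * R r * G' ((R r)\<^sup>2))" for r
  define f'' where "f'' r = E r * ((e r)\<^sup>2 * H ((R r)\<^sup>2) + e' r * H ((R r)\<^sup>2) + 4 * R r * e r * G' ((R r)\<^sup>2)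
      + 2 * G' ((R r)\<^sup>2) + 4 * (R r)\<^sup>2 * G'' ((R r)\<^sup>2))" for r
  have f: "radial_factor a b p = (\<lambda>r. E r * H ((R r)\<^sup>2))"
    by (simp add: radial_factor_def E_def H_def R_def s_def fun_eq_iff)
  have sq: "1 - r\<^sup>2 > 0" if "0 \<le> r" "r < 1" for r :: real
    using that by (simp add: power_less_one_iff abs_square_less_1)
  have wR: "w r = of_real (1 - r\<^sup>2)" for r by (simp add: w_def R_def)
  have nz: "R r \<noteq> 0" "w r \<noteq> 0" "norm ((R r)\<^sup>2) < 1" if "r \<in> {0<..<1}" for r
  proof -
    have r: "0 < r" "r < 1" using that by auto
    have s: "r\<^sup>2 < 1" using sq[of r] r by simp
    show "R r \<noteq> 0" "norm ((R r)\<^sup>2) < 1" using r s by (auto simp: R_def norm_power)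
    show "w r \<noteq> 0" unfolding wR of_real_eq_0_iff using s by simp
  qed
  have R': "(R has_vector_derivative 1) (at r)" for r
    unfolding R_def using has_vector_derivative_of_real[OF DERIV_ident] by simp
  have R2: "((\<lambda>r. (R r)\<^sup>2) has_vector_derivative 2 * R r) (at r)" for r
    using has_vector_derivative_mult[OF R' R', of r] by (simp add: power2_eq_square)
  have w': "(w has_vector_derivative - 2 * R r) (at r)" for r
    unfolding w_def using has_vector_derivative_diff[OF has_vector_derivative_const R2, of 1 r] by simp
  have Edef: "E r = c_const a b * exp (s * of_real (ln (1 - r\<^sup>2))) * R r ^ p" if "0 \<le> r" "r < 1" for r
  proof -
    have "complex_of_real (1 - r\<^sup>2) \<noteq> 0" unfolding of_real_eq_0_iff using sq[OF that] by simp
    then show ?thesis unfolding E_def R_def powr_def Ln_of_real[OF sq[OF that]] by (simp del: of_real_diff)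
  qed
  have Ed: "(E has_vector_derivative E r * e r) (at r)" if r: "r \<in> {0<..<1}" for r
  proof -
    have r': "0 < r" "r < 1" using r by auto
    note s1 = sq[of r]
    have "((\<lambda>r. ln (1 - r\<^sup>2)) has_real_derivative - (2 * r / (1 - r\<^sup>2))) (at r)"
      using s1 r' by (auto intro!: derivative_eq_intros simp: field_simps)
    then have "((\<lambda>r. complex_of_real (ln (1 - r\<^sup>2))) has_vector_derivative of_real (- (2 * r / (1 - r\<^sup>2)))) (at r)"
      by (rule has_vector_derivative_of_real)
    then have "((\<lambda>r. s * complex_of_real (ln (1 - r\<^sup>2))) has_vector_derivative s * of_real (- (2 * r / (1 - r\<^sup>2)))) (at r)"
      by (rule has_vector_derivative_mult_right)
    then have 1: "((\<lambda>r. exp (s * complex_of_real (ln (1 - r\<^sup>2)))) has_vector_derivative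
        (s * of_real (- (2 * r / (1 - r\<^sup>2)))) * exp (s * of_real (ln (1 - r\<^sup>2)))) (at r)"
      by (rule field_vector_diff_chain_at[OF _ DERIV_exp, unfolded o_def])
    have "((\<lambda>z. z ^ p) has_field_derivative of_nat p * R r ^ (p - Suc 0)) (at (R r))"
      by (auto intro!: derivative_eq_intros)
    then have "((\<lambda>r. R r ^ p) has_vector_derivative 1 * (of_nat p * R r ^ (p - Suc 0))) (at r)"
      by (rule field_vector_diff_chain_at[OF R', unfolded o_def])
    moreover have "1 * (of_nat p * R r ^ (p - Suc 0)) = R r ^ p * (P / R r)"
      using nz[OF r] by (cases p) (auto simp: P_def field_simps)
    ultimately have 2: "((\<lambda>r. R r ^ p) has_vector_derivative R r ^ p * (P / R r)) (at r)" by simp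
    have "((\<lambda>r. c_const a b * exp (s * of_real (ln (1 - r\<^sup>2))) * R r ^ p) has_vector_derivative
       (c_const a b * exp (s * of_real (ln (1 - r\<^sup>2)))) * (R r ^ p * (P / R r)) +
       (c_const a b * ((s * of_real (- (2 * r / (1 - r\<^sup>2)))) * exp (s * of_real (ln (1 - r\<^sup>2))))) * R r ^ p) (at r)"
      by (intro has_vector_derivative_mult has_vector_derivative_mult_right 1 2)
    also have "complex_of_real (- (2 * r / (1 - r\<^sup>2))) = - (2 * R r / w r)"
      unfolding wR R_def by (simp only: of_real_minus of_real_divide of_real_mult of_real_numeral)
    also have "(c_const a b * exp (s * of_real (ln (1 - r\<^sup>2)))) * (R r ^ p * (P / R r)) +
       (c_const a b * ((s * - (2 * R r / w r)) * exp (s * of_real (ln (1 - r\<^sup>2))))) * R r ^ p = E r * e r"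
      using r' by (simp add: Edef e_def algebra_simps)
    finally have "((\<lambda>r. c_const a b * exp (s * of_real (ln (1 - r\<^sup>2))) * R r ^ p) has_vector_derivative E r * e r) (at r)" .
    then show ?thesis
      by (rule has_vector_derivative_transform_within_open[of _ _ _ "{0<..<1}"]) (use r in \<open>auto simp: Edef\<close>)
  qed
  have Hd: "((\<lambda>r. H ((R r)\<^sup>2)) has_vector_derivative 2 * R r * G' ((R r)\<^sup>2)) (at r)" if r: "r \<in> {0<..<1}" for r
    using field_vector_diff_chain_at[OF R2 G[OF nz(3)[OF r]], unfolded o_def] by (simp add: H_def)
  have Gd: "((\<lambda>r. G' ((R r)\<^sup>2)) has_vector_derivative 2 * R r * G'' ((R r)\<^sup>2)) (at r)" if r: "r \<in> {0<..<1}" for r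
    using field_vector_diff_chain_at[OF R2 G'[OF nz(3)[OF r]], unfolded o_def] by simp
  have ed: "(e has_vector_derivative e' r) (at r)" if r: "r \<in> {0<..<1}" for r
  proof -
    have 1: "((\<lambda>r. P / R r) has_vector_derivative - P / (R r)\<^sup>2) (at r)"
    proof -
      have "((\<lambda>z. P / z) has_field_derivative - P / (R r)\<^sup>2) (at (R r))"
        using nz[OF r] by (auto intro!: derivative_eq_intros simp: power2_eq_square)
      from field_vector_diff_chain_at[OF R' this, unfolded o_def] show ?thesis by simp
    qed
    have 2: "((\<lambda>r. 1 / w r) has_vector_derivative 2 * R r / (w r)\<^sup>2) (at r)"
    proof -
      have "((\<lambda>z. 1 / z) has_field_derivative - 1 / (w r)\<^sup>2) (at (w r))"
        using nz[OF r] by (auto intro!: derivative_eq_intros simp: power2_eq_square)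
      from field_vector_diff_chain_at[OF w' this, unfolded o_def] show ?thesis by simp
    qed
    have "((\<lambda>r. P / R r - (2 * s * R r) * (1 / w r)) has_vector_derivative
        - P / (R r)\<^sup>2 - ((2 * s * R r) * (2 * R r / (w r)\<^sup>2) + (2 * s * 1) * (1 / w r))) (at r)"
      by (intro has_vector_derivative_diff has_vector_derivative_mult has_vector_derivative_mult_right 1 2 R')
    then show ?thesis by (simp add: e_def[abs_def] e'_def power2_eq_square algebra_simps)
  qed
  have fd: "(radial_factor a b p has_vector_derivative f' r) (at r)" if r: "r \<in> {0<..<1}" for r
    unfolding f using has_vector_derivative_mult[OF Ed[OF r] Hd[OF r]]
    by (simp add: f'_def algebra_simps)
  have fd': "(f' has_vector_derivative f'' r) (at r)" if r: "r \<in> {0<..<1}" for r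
  proof -
    have "((\<lambda>r. E r * (e r * H ((R r)\<^sup>2) + 2 * R r * G' ((R r)\<^sup>2))) has_vector_derivative
      E r * ((e r * (2 * R r * G' ((R r)\<^sup>2)) + e' r * H ((R r)\<^sup>2)) + (2 * R r * (2 * R r * G'' ((R r)\<^sup>2)) + 2 * 1 * G' ((R r)\<^sup>2)))
      + (E r * e r) * (e r * H ((R r)\<^sup>2) + 2 * R r * G' ((R r)\<^sup>2))) (at r)"
      by (intro has_vector_derivative_mult has_vector_derivative_add has_vector_derivative_mult_right Ed Hd Gd ed R' r)
    then show ?thesis by (simp add: f'_def[abs_def] f''_def power2_eq_square algebra_simps)
  qed
  have eq: "of_real (1 - r\<^sup>2) / 4 * (f'' r + f' r / of_real r - (of_int (int p))\<^sup>2 / (of_real r)\<^sup>2 * radial_factor a b p r)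
          + (a + b) * of_real r * f' r / 2 + (a - b) * of_int (int p) / 2 * radial_factor a b p r - a * b * radial_factor a b p r = 0"
    if r: "r \<in> {0<..<1}" for r
  proof -
    define x y where "x = R r" and "y = w r"
    note n = nz[OF r, folded x_def y_def]
    have y: "y = 1 - x\<^sup>2" by (simp add: y_def w_def x_def)
    define g0 g1 g2 where "g0 = H (x\<^sup>2)" and "g1 = G' (x\<^sup>2)" and "g2 = G'' (x\<^sup>2)"
    have o: "x\<^sup>2 * y * g2 + (P + 1 - (a + b + P + 3) * x\<^sup>2) * g1 - (a + 1 + P) * (b + 1) * g0 = 0"
      using ode[OF n(3)] n(1) by (simp add: g0_def g1_def g2_def H_def P_def y)
    define A where "A = P / x - 2 * s * x / y"
    define A' where "A' = - P / x\<^sup>2 - 2 * s / y - 4 * s * x\<^sup>2 / y\<^sup>2"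
    have c1: "y * (A * x + 1) + (a + b) * x\<^sup>2 = P + 1 - (a + b + P + 3) * x\<^sup>2"
    proof -
      have "y * (A * x) = y * P - 2 * s * x\<^sup>2" using n by (simp add: A_def field_simps power2_eq_square)
      then show ?thesis unfolding distrib_left by (simp add: y s_def algebra_simps)
    qed
    have c0: "y / 4 * (A\<^sup>2 + A' + A / x - P\<^sup>2 / x\<^sup>2) + (a + b) * x * A / 2 + (a - b) * P / 2 - a * b = - (a + 1 + P) * (b + 1)"
    proof -
      have c00: "A\<^sup>2 + A' + A / x - P\<^sup>2 / x\<^sup>2 = - 4 * s * (P + 1) / y + 4 * (s\<^sup>2 - s) * x\<^sup>2 / y\<^sup>2"
        using n by (simp add: A_def A'_def field_simps power2_eq_square)
      have "y / 4 * (A\<^sup>2 + A' + A / x - P\<^sup>2 / x\<^sup>2) = - s * (P + 1) + (s\<^sup>2 - s) * (x\<^sup>2 / y)"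
        unfolding c00 using n by (simp add: field_simps power2_eq_square)
      moreover have "x * A = P - 2 * s * (x\<^sup>2 / y)" using n by (simp add: A_def field_simps power2_eq_square)
      then have "(a + b) * x * A / 2 = (s - 1) * (P - 2 * s * (x\<^sup>2 / y)) / 2" by (simp add: s_def mult.assoc)
      ultimately have "y / 4 * (A\<^sup>2 + A' + A / x - P\<^sup>2 / x\<^sup>2) + (a + b) * x * A / 2 + (a - b) * P / 2 - a * b
         = - s * (P + 1) + (s\<^sup>2 - s) * (x\<^sup>2 / y) + (s - 1) * (P - 2 * s * (x\<^sup>2 / y)) / 2 + (a - b) * P / 2 - a * b"
        by (simp only:)
      also have "\<dots> = - (a + 1 + P) * (b + 1)" by (simp add: s_def field_simps power2_eq_square)
      finally show ?thesis .
    qed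
    define F1 where "F1 = A * g0 + 2 * x * g1"
    define F2 where "F2 = A\<^sup>2 * g0 + A' * g0 + 4 * x * A * g1 + 2 * g1 + 4 * x\<^sup>2 * g2"
    have "F2 + F1 / x - P\<^sup>2 / x\<^sup>2 * g0 = (A\<^sup>2 + A' + A / x - P\<^sup>2 / x\<^sup>2) * g0 + 4 * (A * x + 1) * g1 + 4 * x\<^sup>2 * g2"
      using n(1) by (simp add: F1_def F2_def add_divide_distrib algebra_simps)
    then have "y / 4 * (F2 + F1 / x - P\<^sup>2 / x\<^sup>2 * g0) + (a + b) * x * F1 / 2 + (a - b) * P / 2 * g0 - a * b * g0
      = y / 4 * ((A\<^sup>2 + A' + A / x - P\<^sup>2 / x\<^sup>2) * g0 + 4 * (A * x + 1) * g1 + 4 * x\<^sup>2 * g2) + (a + b) * x * F1 / 2 + (a - b) * P / 2 * g0 - a * b * g0"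
      by (simp only:)
    also have "\<dots> = (y / 4 * (A\<^sup>2 + A' + A / x - P\<^sup>2 / x\<^sup>2) + (a + b) * x * A / 2 + (a - b) * P / 2 - a * b) * g0
        + (y * (A * x + 1) + (a + b) * x\<^sup>2) * g1 + x\<^sup>2 * y * g2"
      by (simp add: F1_def algebra_simps power2_eq_square add_divide_distrib)
    also have "\<dots> = 0" unfolding c0 c1 using o by (simp add: algebra_simps)
    finally have z: "y / 4 * (F2 + F1 / x - P\<^sup>2 / x\<^sup>2 * g0) + (a + b) * x * F1 / 2 + (a - b) * P / 2 * g0 - a * b * g0 = 0" .
    have "f' r = E r * F1" "f'' r = E r * F2" "radial_factor a b p r = E r * g0"
      by (simp_all add: f'_def f''_def f F1_def F2_def A_def A'_def g0_def g1_def g2_def e_def e'_def x_def y_def)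
    moreover have "y / 4 * (E r * F2 + E r * F1 / x - P\<^sup>2 / x\<^sup>2 * (E r * g0)) + (a + b) * x * (E r * F1) / 2 + (a - b) * P / 2 * (E r * g0) - a * b * (E r * g0)
       = E r * (y / 4 * (F2 + F1 / x - P\<^sup>2 / x\<^sup>2 * g0) + (a + b) * x * F1 / 2 + (a - b) * P / 2 * g0 - a * b * g0)"
      by (simp add: algebra_simps)
    moreover have "complex_of_real (1 - r\<^sup>2) = y" "complex_of_real r = x"
      by (simp_all only: y_def wR x_def R_def)
    ultimately show ?thesis using z by (simp add: P_def del: of_real_diff)
  qed
  have Hc: "isCont (\<lambda>r. H ((R r)\<^sup>2)) r" "isCont (\<lambda>r. G' ((R r)\<^sup>2)) r" if "0 \<le> r" "r < 1" for r
  proof -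
    have n: "norm ((R r)\<^sup>2) < 1" using sq[OF that] by (simp add: R_def norm_power)
    have c: "isCont (\<lambda>r. (R r)\<^sup>2) r" unfolding R_def by (intro continuous_intros)
    show "isCont (\<lambda>r. H ((R r)\<^sup>2)) r" "isCont (\<lambda>r. G' ((R r)\<^sup>2)) r"
      unfolding H_def using isCont_o2[OF c DERIV_isCont[OF G[OF n]]] isCont_o2[OF c DERIV_isCont[OF G'[OF n]]] by auto
  qed
  have Ec: "isCont E r" if "0 \<le> r" "r < 1" for r
    unfolding E_def using sq[OF that] by (intro continuous_intros) (auto simp del: of_real_diff)
  have cont: "continuous_on {0..<1} (radial_factor a b p)"
    unfolding f by (intro continuous_at_imp_continuous_on ballI isCont_mult Ec Hc) auto
  have lim: "((\<lambda>r. of_real r * f' r) \<longlongrightarrow> 0) (at_right 0)"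
  proof -
    define g where "g r = E r * ((P - 2 * s * (R r)\<^sup>2 / w r) * H ((R r)\<^sup>2) + 2 * (R r)\<^sup>2 * G' ((R r)\<^sup>2))" for r
    have "isCont g 0"
      unfolding g_def w_def
      by (intro isCont_mult isCont_add isCont_diff isCont_divide Ec Hc) (auto simp: R_def intro!: continuous_intros)
    then have gl: "(g \<longlongrightarrow> g 0) (at_right 0)"
      by (simp add: isCont_def filterlim_at_split)
    have g0: "g 0 = 0" by (cases p) (auto simp: g_def R_def E_def P_def)
    have "\<forall>\<^sub>F r in at_right (0::real). r \<in> {0<..<1}"
      by (rule eventually_at_right_real) simp
    then have ev: "\<forall>\<^sub>F r in at_right 0. g r = of_real r * f' r"
    proof eventually_elim
      case (elim r)
      have "R r * e r = P - 2 * s * (R r)\<^sup>2 / w r" using nz[OF elim] by (simp add: e_def field_simps power2_eq_square)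
      moreover have "X * ((x * y) * h + 2 * x\<^sup>2 * g) = x * (X * (y * h + 2 * x * g))" for X x y h g :: complex
        by (simp add: algebra_simps power2_eq_square)
      ultimately have "g r = R r * f' r" unfolding g_def f'_def by metis
      then show ?case by (simp only: R_def)
    qed
    show ?thesis using Lim_transform_eventually[OF gl ev] unfolding g0 .
  qed
  show ?thesis
    unfolding radial_solution_def using cont lim fd fd' eq by blast
qed

text \<open>The equation is invariant under exchanging \<open>a\<close> with \<open>b\<close> and \<open>k\<close> with \<open>-k\<close>, which covers negative indices.\<close>

definition radial_coeff :: "complex \<Rightarrow> complex \<Rightarrow> int \<Rightarrow> real \<Rightarrow> complex" where
  "radial_coeff a b k = (if k \<ge> 0 then radial_factor a b (nat k) else radial_factor b a (nat (- k)))"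

lemma radial_solution_swap:
  assumes "radial_solution a b k f"
  shows "radial_solution b a (- k) f"
proof -
  have "(a - b) * of_int k / 2 * X = (b - a) * of_int (- k) / 2 * X" for X by (simp add: algebra_simps)
  then show ?thesis
    using assms unfolding radial_solution_def by (simp add: add.commute[of a b] mult.commute[of a b])
qed

lemma radial_coeff_solution:
  assumes "Re a + Re b > -1"
  shows "radial_solution a b k (radial_coeff a b k)"
proof (cases "k \<ge> 0")
  case True
  then show ?thesis using radial_factor_solution[OF assms, of "nat k"] by (simp add: radial_coeff_def)
next
  case False
  then show ?thesis
    using radial_solution_swap[OF radial_factor_solution[of b a "nat (- k)"]] assms
    by (simp add: radial_coeff_def add.commute)
qed

text \<open>The constant \<open>c_const a b\<close> is the reciprocal of the limit of the remaining factors.\<close>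

lemma radial_factor_limit:
  assumes ab: "Re a + Re b > -1" and a: "a + 1 \<notin> \<int>\<^sub>\<le>\<^sub>0" and b: "b + 1 \<notin> \<int>\<^sub>\<le>\<^sub>0"
  shows "(radial_factor a b p \<longlongrightarrow> 1) (at_left 1)"
proof -
  have nz: "a + b + 1 \<notin> \<int>\<^sub>\<le>\<^sub>0"
  proof
    assume "a + b + 1 \<in> \<int>\<^sub>\<le>\<^sub>0"
    then have "Re (a + b + 1) \<le> 0" by (elim nonpos_Ints_cases') simp
    then show False using ab by simp
  qed
  have sq: "filterlim (\<lambda>r::real. r\<^sup>2) (at_left 1) (at_left 1)" by real_asymp
  have "((\<lambda>r. c_const a b * of_real r ^ p * (of_real (1 - r\<^sup>2) powr (a + b + 1) * hyp_series a b p (of_real (r\<^sup>2)))) \<longlongrightarrow>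
      c_const a b * of_real 1 ^ p * (rGamma (a + 1) * rGamma (b + 1) * Gamma (a + b + 1))) (at_left 1)"
    by (intro tendsto_mult tendsto_const tendsto_power tendsto_of_real tendsto_ident_at
        filterlim_compose[OF hyp_series_limit[OF ab] sq])
  moreover have "c_const a b * (rGamma (a + 1) * rGamma (b + 1) * Gamma (a + b + 1)) = 1"
    using a b nz by (simp add: c_const_def rGamma_inverse_Gamma Gamma_eq_zero_iff field_simps)
  ultimately show ?thesis
    unfolding radial_factor_def[abs_def] by (simp add: mult_ac)
qed

lemma radial_coeff_limit:
  assumes "Re a + Re b > -1" "a + 1 \<notin> \<int>\<^sub>\<le>\<^sub>0" "b + 1 \<notin> \<int>\<^sub>\<le>\<^sub>0"
  shows "(radial_coeff a b k \<longlongrightarrow> 1) (at_left 1)"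
  using radial_factor_limit[of a b] radial_factor_limit[of b a] assms by (simp add: radial_coeff_def add.commute)

section \<open>Fourier coefficients of the one-variable Poisson kernel\<close>

lemma integral_sums_uniform:
  fixes f :: "nat \<Rightarrow> real \<Rightarrow> complex"
  assumes c: "\<And>n. continuous_on {a..b} (f n)" and M: "\<And>n t. t \<in> {a..b} \<Longrightarrow> norm (f n t) \<le> M n" and s: "summable M"
  shows "(\<lambda>n. integral {a..b} (f n)) sums integral {a..b} (\<lambda>t. \<Sum>n. f n t)"
proof -
  have u: "uniform_limit {a..b} (\<lambda>n t. \<Sum>i<n. f i t) (\<lambda>t. \<Sum>i. f i t) sequentially"
    by (rule Weierstrass_m_test) (use M s in auto)
  obtain I J where I: "\<And>n. ((\<lambda>t. \<Sum>i<n. f i t) has_integral I n) {a..b}"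
    and J: "((\<lambda>t. \<Sum>i. f i t) has_integral J) {a..b}" and l: "(I \<longlongrightarrow> J) sequentially"
    by (rule uniform_limit_integral[OF u]) (auto intro!: continuous_intros c)
  have In: "I n = (\<Sum>i<n. integral {a..b} (f i))" for n
    using I[of n] by (subst integral_sum[symmetric]) (auto intro!: integrable_continuous_real c simp: integral_unique)
  have "I = (\<lambda>n. \<Sum>i<n. integral {a..b} (f i))" by (rule ext) (rule In)
  then show ?thesis using l integral_unique[OF J] by (simp only: sums_def)
qed

lemma integral_power_series_circle:
  fixes d :: "nat \<Rightarrow> complex" and e h :: "real \<Rightarrow> complex"
  assumes s: "summable (\<lambda>n. norm (d n))" and e: "continuous_on {0..2*pi} e" "\<And>t. norm (e t) = 1"
    and h: "continuous_on {0..2*pi} h"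
  shows "(\<lambda>n. d n * integral {0..2*pi} (\<lambda>t. e t ^ n * h t)) sums integral {0..2*pi} (\<lambda>t. (\<Sum>n. d n * e t ^ n) * h t)"
proof -
  have "bounded (h ` {0..2*pi})" by (rule compact_imp_bounded[OF compact_continuous_image[OF h compact_Icc]])
  then obtain B where B: "\<And>t. t \<in> {0..2*pi} \<Longrightarrow> norm (h t) \<le> B"
    unfolding bounded_iff by (metis imageI)
  have sd: "summable (\<lambda>n. d n * e t ^ n)" for t
    by (rule summable_norm_cancel) (use s in \<open>simp add: norm_mult norm_power e\<close>)
  have "(\<lambda>n. integral {0..2*pi} (\<lambda>t. d n * (e t ^ n * h t))) sums integral {0..2*pi} (\<lambda>t. \<Sum>n. d n * (e t ^ n * h t))"
  proof (rule integral_sums_uniform[where M = "\<lambda>n. norm (d n) * B"])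
    show "continuous_on {0..2 * pi} (\<lambda>t. d n * (e t ^ n * h t))" for n by (intro continuous_intros h e)
    show "norm (d n * (e t ^ n * h t)) \<le> norm (d n) * B" if "t \<in> {0..2 * pi}" for n t
      using B[OF that] by (simp add: norm_mult norm_power mult_left_mono e)
    show "summable (\<lambda>n. norm (d n) * B)" by (rule summable_mult2[OF s])
  qed
  moreover have "(\<Sum>n. d n * (e t ^ n * h t)) = (\<Sum>n. d n * e t ^ n) * h t" for t
    using suminf_mult2[OF sd, of t "h t"] by (simp add: mult.assoc)
  ultimately show ?thesis by (simp add: integral_mult_right)
qed

text \<open>The one-variable Poisson kernel with \<open>\<zeta> = 1\<close>.\<close>

definition disc_kernel :: "complex \<Rightarrow> complex \<Rightarrow> complex \<Rightarrow> complex" where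
  "disc_kernel a b z = c_const a b * (of_real (1 - (norm z)\<^sup>2) powr (a + b + 1) /
     ((1 - z) powr (a + 1) * (1 - cnj z) powr (b + 1)))"

lemma continuous_disc_kernel: "continuous_on (ball 0 1) (disc_kernel a b)"
proof -
  have 1: "0 < Re (1 - z)" "0 < Re (1 - cnj z)" "0 < 1 - (norm z)\<^sup>2" if "z \<in> ball 0 1" for z :: complex
    using that complex_Re_le_cmod[of z] by (auto simp: abs_square_less_1)
  have nz: "1 - z \<noteq> 0" "1 - cnj z \<noteq> 0" "complex_of_real (1 - (norm z)\<^sup>2) \<noteq> 0" if "z \<in> ball 0 1" for z :: complex
    using 1[OF that] by (auto simp del: of_real_diff simp: complex_eq_iff)
  show ?thesis
    unfolding disc_kernel_def
    by (intro continuous_on_mult continuous_on_const continuous_on_divide continuous_on_powr_complex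
          continuous_on_of_real continuous_on_diff continuous_on_power continuous_on_norm continuous_on_id continuous_on_cnj ballI)
       (use 1 nz in \<open>auto simp del: of_real_diff simp: less_imp_le\<close>)
qed

text \<open>Both powers are expanded in binomial series and integrated term by term. Orthogonality keeps the pairs of exponents
  with difference \<open>k\<close>, and these make up the hypergeometric series in \<open>r\<^sup>2\<close>.\<close>

lemma disc_kernel_coeff:
  assumes ab: "Re a + Re b > -1" and r: "0 \<le> r" "r < 1"
  shows "(1 / (2 * pi)) *\<^sub>R integral {0..2*pi} (\<lambda>t. disc_kernel a b (of_real r * cis t) * cis t powi (- k)) = radial_coeff a b k r"
proof -
  define A B where "A = rising_coeff a" and "B = rising_coeff b"
  define W where "W = c_const a b * of_real (1 - r\<^sup>2) powr (a + b + 1)"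
  define f where "f n = A n * of_real r ^ n" for n
  define g where "g n = B n * of_real r ^ n" for n
  have nr: "norm (complex_of_real r) < 1" using r by simp
  have sf: "summable (\<lambda>n. norm (f n))" and sg: "summable (\<lambda>n. norm (g n))"
    using rising_coeff_summable_norm[OF nr] by (simp_all add: f_def g_def A_def B_def)
  have K: "disc_kernel a b (of_real r * cis t) = W * ((\<Sum>n. f n * cis t ^ n) * (\<Sum>n. g n * cis (- t) ^ n))" for t
  proof -
    have n: "norm (of_real r * cis t) < 1" "norm (of_real r * cis (- t)) < 1" using nr by (simp_all add: norm_mult)
    have "(\<Sum>n. f n * cis t ^ n) = (1 - of_real r * cis t) powr (- (a + 1))"
      using sums_unique[OF rising_coeff_sums[OF n(1), of a]] by (simp add: f_def A_def power_mult_distrib mult.assoc)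
    moreover have "(\<Sum>n. g n * cis (- t) ^ n) = (1 - of_real r * cis (- t)) powr (- (b + 1))"
      using sums_unique[OF rising_coeff_sums[OF n(2), of b]] by (simp add: g_def B_def power_mult_distrib mult.assoc)
    moreover have "cnj (of_real r * cis t) = of_real r * cis (- t)" by (simp add: cis_cnj)
    ultimately show ?thesis
      using r by (simp add: disc_kernel_def W_def norm_mult powr_minus divide_inverse mult_ac del: minus_add_distrib cis_cnj complex_cnj_mult)
  qed
  have cg: "continuous_on {0..2*pi} (\<lambda>t. \<Sum>n. g n * cis (- t) ^ n)"
  proof (rule uniform_limit_theorem)
    show "uniform_limit {0..2*pi} (\<lambda>n t. \<Sum>i<n. g i * cis (- t) ^ i) (\<lambda>t. \<Sum>i. g i * cis (- t) ^ i) sequentially"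
      by (rule Weierstrass_m_test[OF _ sg]) (simp add: norm_mult norm_power)
    show "\<forall>\<^sub>F n in sequentially. continuous_on {0..2 * pi} (\<lambda>t. \<Sum>i<n. g i * cis (- t) ^ i)"
      by (intro always_eventually allI continuous_intros)
  qed simp
  \<comment> \<open>The inner series is integrated first, against a fixed exponential of the outer one.\<close>
  have inner: "integral {0..2*pi} (\<lambda>t. cis t ^ n * ((\<Sum>m. g m * cis (- t) ^ m) * cis t powi (- k))) =
     (if int n \<ge> k then of_real (2 * pi) * g (nat (int n - k)) else 0)" for n
  proof -
    have "(\<lambda>m. g m * integral {0..2*pi} (\<lambda>t. cis (- t) ^ m * (cis t ^ n * cis t powi (- k))))
        sums integral {0..2*pi} (\<lambda>t. (\<Sum>m. g m * cis (- t) ^ m) * (cis t ^ n * cis t powi (- k)))"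
      by (rule integral_power_series_circle[OF sg]) (auto intro!: continuous_intros)
    moreover have "cis (- t) ^ m * (cis t ^ n * cis t powi (- k)) = cis t powi (int n - k - int m)" for t m
      unfolding Complex.DeMoivre cis_power_int cis_mult by (rule arg_cong[where f = cis]) (simp add: algebra_simps)
    ultimately have "(\<lambda>m. g m * (if int n - k - int m = 0 then of_real (2 * pi) else 0))
        sums integral {0..2*pi} (\<lambda>t. (\<Sum>m. g m * cis (- t) ^ m) * (cis t ^ n * cis t powi (- k)))"
      by (simp only: integral_cis_powi)
    moreover have "(\<lambda>m. g m * (if int n - k - int m = 0 then of_real (2 * pi) else 0))
        sums (if int n \<ge> k then of_real (2 * pi) * g (nat (int n - k)) else 0)"
    proof (cases "int n \<ge> k")
      case True
      have "(\<lambda>m. g m * (if int n - k - int m = 0 then of_real (2 * pi) else 0)) =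
         (\<lambda>m. if m = nat (int n - k) then of_real (2 * pi) * g m else 0)"
        using True by (auto simp: fun_eq_iff)
      then show ?thesis using True sums_single[of "nat (int n - k)" "\<lambda>m. of_real (2 * pi) * g m"] by simp
    next
      case False
      then have "(\<lambda>m. g m * (if int n - k - int m = 0 then of_real (2 * pi) else 0)) = (\<lambda>m. 0)"
        by (auto simp: fun_eq_iff)
      then show ?thesis using False by simp
    qed
    ultimately show ?thesis by (simp add: sums_unique2 mult_ac)
  qed
  have "(\<lambda>n. f n * integral {0..2*pi} (\<lambda>t. cis t ^ n * ((\<Sum>m. g m * cis (- t) ^ m) * cis t powi (- k))))
      sums integral {0..2*pi} (\<lambda>t. (\<Sum>n. f n * cis t ^ n) * ((\<Sum>m. g m * cis (- t) ^ m) * cis t powi (- k)))"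
    by (rule integral_power_series_circle[OF sf]) (auto intro!: continuous_intros cg)
  then have outer: "(\<lambda>n. f n * (if int n \<ge> k then of_real (2 * pi) * g (nat (int n - k)) else 0))
      sums integral {0..2*pi} (\<lambda>t. (\<Sum>n. f n * cis t ^ n) * ((\<Sum>m. g m * cis (- t) ^ m) * cis t powi (- k)))"
    unfolding inner .
  have r2: "norm ((complex_of_real r)\<^sup>2) < 1" using r by (simp add: norm_power abs_square_less_1)
  have val: "(\<lambda>n. f n * (if int n \<ge> k then of_real (2 * pi) * g (nat (int n - k)) else 0)) sums
     (of_real (2 * pi) * (of_real r ^ nat \<bar>k\<bar> * (if k \<ge> 0 then hyp_series a b (nat k) ((of_real r)\<^sup>2) else hyp_series b a (nat (- k)) ((of_real r)\<^sup>2))))"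
  proof (cases "k \<ge> 0")
    case True
    define p where "p = nat k"
    have k: "k = int p" using True by (simp add: p_def)
    have "(\<lambda>n. of_real (2 * pi) * (of_real r ^ p * (hyp_coeff a b p n * ((of_real r)\<^sup>2) ^ n))) sums
       (of_real (2 * pi) * (of_real r ^ p * hyp_series a b p ((of_real r)\<^sup>2)))"
      unfolding hyp_series_def by (intro sums_mult summable_sums hyp_coeff_summable ab r2)
    moreover have "of_real (2 * pi) * (of_real r ^ p * (hyp_coeff a b p n * ((of_real r)\<^sup>2) ^ n)) =
        f (n + p) * (if int (n + p) \<ge> k then of_real (2 * pi) * g (nat (int (n + p) - k)) else 0)" for n
    proof -
      have "k \<le> int (n + p)" "nat (int (n + p) - k) = n" by (simp_all add: k)
      then show ?thesis
        by (simp only: f_def g_def A_def B_def hyp_coeff_def power_add power2_eq_square power_mult_distrib if_True mult_ac)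
    qed
    ultimately have "(\<lambda>n. f (n + p) * (if int (n + p) \<ge> k then of_real (2 * pi) * g (nat (int (n + p) - k)) else 0)) sums
       (of_real (2 * pi) * (of_real r ^ p * hyp_series a b p ((of_real r)\<^sup>2)))" by (simp only:)
    then show ?thesis
      by (subst (asm) sums_iff_shift) (use True in \<open>simp add: k\<close>)
  next
    case False
    define p where "p = nat (- k)"
    have k: "k = - int p" using False by (simp add: p_def)
    have "(\<lambda>n. of_real (2 * pi) * (of_real r ^ p * (hyp_coeff b a p n * ((of_real r)\<^sup>2) ^ n))) sums
       (of_real (2 * pi) * (of_real r ^ p * hyp_series b a p ((of_real r)\<^sup>2)))"
      unfolding hyp_series_def by (intro sums_mult summable_sums hyp_coeff_summable r2) (use ab in simp)
    moreover have "of_real (2 * pi) * (of_real r ^ p * (hyp_coeff b a p n * ((of_real r)\<^sup>2) ^ n)) =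
        f n * (if int n \<ge> k then of_real (2 * pi) * g (nat (int n - k)) else 0)" for n
    proof -
      have "k \<le> int n" "nat (int n - k) = n + p" by (simp_all add: k nat_int_add)
      then show ?thesis
        by (simp only: f_def g_def A_def B_def hyp_coeff_def power_add power2_eq_square power_mult_distrib if_True mult_ac)
    qed
    ultimately have S: "(\<lambda>n. f n * (if int n \<ge> k then of_real (2 * pi) * g (nat (int n - k)) else 0)) sums
       (of_real (2 * pi) * (of_real r ^ p * hyp_series b a p ((of_real r)\<^sup>2)))" by (simp only:)
    have "nat \<bar>k\<bar> = p" "nat (- k) = p" by (simp_all add: k)
    then show ?thesis using S False by (simp only: if_False)
  qed
  have "integral {0..2*pi} (\<lambda>t. disc_kernel a b (of_real r * cis t) * cis t powi (- k)) =
     W * integral {0..2*pi} (\<lambda>t. (\<Sum>n. f n * cis t ^ n) * ((\<Sum>m. g m * cis (- t) ^ m) * cis t powi (- k)))"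
    unfolding K by (simp add: mult.assoc integral_mult_right)
  also have "\<dots> = of_real (2 * pi) * radial_coeff a b k r"
    unfolding sums_unique2[OF outer val]
    by (simp add: radial_coeff_def radial_factor_def W_def c_const_def add.commute mult_ac)
  finally show ?thesis by (simp add: scaleR_conv_of_real)
qed

section \<open>Complex measures on the torus\<close>

text \<open>Four finite measures standing for the complex measure \<open>N1 - N2 + \<i> (N3 - N4)\<close>. The representation is not
  unique, which leaves room for both Jordan parts and weak limits.\<close>

locale torus_charge =
  fixes N1 N2 N3 N4 :: "(complex ^ 'n::finite) measure"
  assumes fin: "finite_measure N1" "finite_measure N2" "finite_measure N3" "finite_measure N4"
    and sets: "sets N1 = sets torus_borel" "sets N2 = sets torus_borel" "sets N3 = sets torus_borel" "sets N4 = sets torus_borel"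
begin

definition charge_integral :: "(complex ^ 'n \<Rightarrow> complex) \<Rightarrow> complex" where
  "charge_integral f = (\<integral>z. f z \<partial>N1) - (\<integral>z. f z \<partial>N2) + \<i> * ((\<integral>z. f z \<partial>N3) - (\<integral>z. f z \<partial>N4))"

definition charge_bound :: real where
  "charge_bound = measure N1 torus + measure N2 torus + measure N3 torus + measure N4 torus"

lemma charge_bound_nonneg: "0 \<le> charge_bound"
  by (simp add: charge_bound_def)

lemma charge_integral_add:
  "continuous_on torus f \<Longrightarrow> continuous_on torus g \<Longrightarrow> charge_integral (\<lambda>z. f z + g z) = charge_integral f + charge_integral g"
  unfolding charge_integral_def
  by (simp add: integrable_on_torus fin sets algebra_simps)

lemma charge_integral_scale: "charge_integral (\<lambda>z. c * f z) = c * charge_integral f"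
  unfolding charge_integral_def by (simp add: algebra_simps)

lemma charge_integral_cong:
  assumes "\<And>z. z \<in> torus \<Longrightarrow> f z = g z"
  shows "charge_integral f = charge_integral g"
proof -
  have "(\<integral>z. f z \<partial>N) = (\<integral>z. g z \<partial>N)" if "sets N = sets torus_borel" for N
    using sets_eq_imp_space_eq[OF that] assms by (intro Bochner_Integration.integral_cong refl) simp
  then show ?thesis unfolding charge_integral_def by (simp add: sets)
qed

lemma charge_integral_diff:
  "continuous_on torus f \<Longrightarrow> continuous_on torus g \<Longrightarrow> charge_integral (\<lambda>z. f z - g z) = charge_integral f - charge_integral g"
  unfolding charge_integral_def
  by (simp add: integrable_on_torus fin sets algebra_simps)

lemma norm_charge_integral_le:
  assumes f: "continuous_on torus f" and B: "\<And>z. z \<in> torus \<Longrightarrow> norm (f z) \<le> B"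
  shows "norm (charge_integral f) \<le> charge_bound * B"
proof -
  note b = norm_integral_torus_le[OF fin(1) sets(1) f B] norm_integral_torus_le[OF fin(2) sets(2) f B]
    norm_integral_torus_le[OF fin(3) sets(3) f B] norm_integral_torus_le[OF fin(4) sets(4) f B]
  have "norm (charge_integral f) \<le> norm ((\<integral>z. f z \<partial>N1) - (\<integral>z. f z \<partial>N2)) + norm ((\<integral>z. f z \<partial>N3) - (\<integral>z. f z \<partial>N4))"
    unfolding charge_integral_def by (rule norm_triangle_le) (simp add: norm_mult)
  also have "\<dots> \<le> (norm (\<integral>z. f z \<partial>N1) + norm (\<integral>z. f z \<partial>N2)) + (norm (\<integral>z. f z \<partial>N3) + norm (\<integral>z. f z \<partial>N4))"
    by (intro add_mono norm_triangle_ineq4)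
  also have "\<dots> \<le> charge_bound * B" using b unfolding charge_bound_def by (simp add: distrib_right)
  finally show ?thesis .
qed

end

lemma Fubini_torus:
  fixes G :: "complex ^ 'n::finite \<Rightarrow> complex ^ 'n \<Rightarrow> complex"
  assumes M: "finite_measure M" "sets M = sets torus_borel" and N: "finite_measure N" "sets N = sets torus_borel"
    and G: "continuous_on (torus \<times> torus) (\<lambda>p. G (fst p) (snd p))"
  shows "(\<integral>x. (\<integral>y. G x y \<partial>N) \<partial>M) = (\<integral>y. (\<integral>x. G x y \<partial>M) \<partial>N)"
proof -
  interpret M: finite_measure M by fact
  interpret N: finite_measure N by fact
  interpret P: pair_sigma_finite M N ..
  interpret F: finite_measure "M \<Otimes>\<^sub>M N"
    using finite_measure_pair_measure[OF N(1) M(1)] .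
  have sp: "space M = torus" "space N = torus" using sets_eq_imp_space_eq[OF M(2)] sets_eq_imp_space_eq[OF N(2)] by simp_all
  let ?T = "torus \<times> torus :: ((complex ^ 'n) \<times> (complex ^ 'n)) set"
  have cT: "compact ?T" by (intro compact_Times compact_torus)
  have "bounded ((\<lambda>p. G (fst p) (snd p)) ` ?T)" by (rule compact_imp_bounded[OF compact_continuous_image[OF G cT]])
  then obtain B where B': "\<forall>w\<in>(\<lambda>p. G (fst p) (snd p)) ` ?T. norm w \<le> B" unfolding bounded_iff by (elim exE)
  have B: "norm (G (fst p) (snd p)) \<le> B" if "p \<in> ?T" for p
    using B'[rule_format, OF imageI[OF that]] .
  have h: "(\<lambda>p. indicator ?T p *\<^sub>R G (fst p) (snd p)) \<in> borel_measurable borel"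
    by (rule borel_measurable_continuous_on_indicator[OF _ G]) (simp add: borel_closed compact_imp_closed[OF cT])
  have idm: "(\<lambda>x. x) \<in> M \<rightarrow>\<^sub>M borel" "(\<lambda>x. x) \<in> N \<rightarrow>\<^sub>M borel"
    unfolding measurable_cong_sets[OF M(2) refl] measurable_cong_sets[OF N(2) refl] by (rule measurable_restrict_space1, simp)+
  have "(\<lambda>p. (fst p, snd p)) \<in> M \<Otimes>\<^sub>M N \<rightarrow>\<^sub>M borel \<Otimes>\<^sub>M borel"
    by (intro measurable_Pair measurable_compose[OF measurable_fst idm(1)] measurable_compose[OF measurable_snd idm(2)])
  then have pm: "(\<lambda>p. p) \<in> M \<Otimes>\<^sub>M N \<rightarrow>\<^sub>M borel" by (simp add: borel_prod)
  have "(\<lambda>p. indicator ?T p *\<^sub>R G (fst p) (snd p)) \<in> borel_measurable (M \<Otimes>\<^sub>M N)"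
    using measurable_compose[OF pm h] by simp
  then have "(\<lambda>p. G (fst p) (snd p)) \<in> borel_measurable (M \<Otimes>\<^sub>M N)"
    by (rule measurable_cong[THEN iffD1, rotated]) (auto simp: space_pair_measure sp)
  then have "integrable (M \<Otimes>\<^sub>M N) (case_prod G)"
    using B by (intro F.integrable_const_bound[where B = B] AE_I2) (auto simp: space_pair_measure sp split_beta)
  then show ?thesis by (rule P.Fubini_integral[symmetric])
qed

context torus_charge
begin

text \<open>Continuity in the parameter follows from uniform continuity of \<open>G\<close> on the compact product.\<close>

lemma charge_integral_swap:
  fixes G :: "complex ^ 'n \<Rightarrow> complex ^ 'n \<Rightarrow> complex"
  assumes G: "continuous_on (torus \<times> torus) (\<lambda>p. G (fst p) (snd p))"
  shows "(\<integral>x. charge_integral (G x) \<partial>torus_haar) = charge_integral (\<lambda>y. \<integral>x. G x y \<partial>torus_haar)"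
    and "continuous_on torus (\<lambda>x. charge_integral (G x))"
proof -
  have Gx: "continuous_on torus (G x)" if "x \<in> torus" for x
  proof -
    have "continuous_on torus (\<lambda>y. (x, y))" by (rule continuous_on_Pair[OF continuous_on_const continuous_on_id])
    then have "continuous_on torus (\<lambda>y. G (fst (x, y)) (snd (x, y)))"
      by (rule continuous_on_compose2[OF G]) (use that in auto)
    then show ?thesis by simp
  qed
  have fh: "finite_measure (torus_haar :: (complex ^ 'n) measure)"
    by (rule prob_space.axioms(1)[OF prob_space_torus_haar])
  have u: "uniformly_continuous_on (torus \<times> torus) (\<lambda>p. G (fst p) (snd p))"
    by (rule compact_uniformly_continuous[OF G compact_Times[OF compact_torus compact_torus]])
  have ex: "\<exists>d>0. \<forall>x\<in>torus. \<forall>x'\<in>torus. dist x' x < d \<longrightarrow> (\<forall>y\<in>torus. norm (G x' y - G x y) < e)" if e: "e > 0" for e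
  proof -
    obtain d where d: "d > 0" and d': "\<forall>p\<in>torus \<times> torus. \<forall>p'\<in>torus \<times> torus. dist p' p < d \<longrightarrow>
       dist (G (fst p') (snd p')) (G (fst p) (snd p)) < e"
      using u[unfolded uniformly_continuous_on_def, rule_format, OF e] by (elim exE conjE)
    have "norm (G x' y - G x y) < e" if "x \<in> torus" "x' \<in> torus" "dist x' x < d" "y \<in> torus" for x x' y
      using d'[rule_format, of "(x, y)" "(x', y)"] that by (simp add: dist_Pair_Pair dist_norm)
    then show ?thesis using d by blast
  qed
  have est: "dist (\<Lambda> (G x')) (\<Lambda> (G x)) < e"
    if "x \<in> torus" "x' \<in> torus" "\<forall>y\<in>torus. norm (G x' y - G x y) < e / (C + 1)" "e > 0" "C \<ge> 0"
      and L: "\<And>f g. continuous_on torus f \<Longrightarrow> continuous_on torus g \<Longrightarrow> \<Lambda> (\<lambda>z. f z - g z) = \<Lambda> f - \<Lambda> g"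
      and b: "\<And>f B. continuous_on torus f \<Longrightarrow> (\<And>z. z \<in> torus \<Longrightarrow> norm (f z) \<le> B) \<Longrightarrow> norm (\<Lambda> f) \<le> C * B"
    for x x' e C and \<Lambda> :: "(complex ^ 'n \<Rightarrow> complex) \<Rightarrow> complex"
  proof -
    have "norm (\<Lambda> (\<lambda>y. G x' y - G x y)) \<le> C * (e / (C + 1))"
      by (rule b) (use that in \<open>auto intro!: continuous_on_diff Gx less_imp_le\<close>)
    also have "\<dots> < e" using that(4,5) by (simp add: field_simps)
    finally show ?thesis using L[OF Gx[OF that(2)] Gx[OF that(1)]] by (simp add: dist_norm)
  qed
  have cont_gen: "continuous_on torus (\<lambda>x. \<Lambda> (G x))"
    if "C \<ge> 0" and L: "\<And>f g. continuous_on torus f \<Longrightarrow> continuous_on torus g \<Longrightarrow> \<Lambda> (\<lambda>z. f z - g z) = \<Lambda> f - \<Lambda> g"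
      and b: "\<And>f B. continuous_on torus f \<Longrightarrow> (\<And>z. z \<in> torus \<Longrightarrow> norm (f z) \<le> B) \<Longrightarrow> norm (\<Lambda> f) \<le> C * B"
    for C and \<Lambda> :: "(complex ^ 'n \<Rightarrow> complex) \<Rightarrow> complex"
    unfolding continuous_on_iff
  proof (intro ballI allI impI)
    fix x :: "complex ^ 'n" and e :: real assume x: "x \<in> torus" and e: "0 < e"
    then have "e / (C + 1) > 0" using that(1) by simp
    from ex[OF this] obtain d where d: "d > 0" "\<forall>x\<in>torus. \<forall>x'\<in>torus. dist x' x < d \<longrightarrow> (\<forall>y\<in>torus. norm (G x' y - G x y) < e / (C + 1))"
      by blast
    show "\<exists>d>0. \<forall>x'\<in>torus. dist x' x < d \<longrightarrow> dist (\<Lambda> (G x')) (\<Lambda> (G x)) < e"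
    proof (intro exI[of _ d] conjI ballI impI)
      fix x' :: "complex ^ 'n" assume x': "x' \<in> torus" "dist x' x < d"
      show "dist (\<Lambda> (G x')) (\<Lambda> (G x)) < e"
        by (rule est[where \<Lambda> = \<Lambda> and C = C]) (use d x x' e that(1) in \<open>auto intro: L b\<close>)
    qed (rule d(1))
  qed
  show "continuous_on torus (\<lambda>x. charge_integral (G x))"
    by (rule cont_gen[OF charge_bound_nonneg charge_integral_diff norm_charge_integral_le])
  have ci: "continuous_on torus (\<lambda>x. \<integral>y. G x y \<partial>N)" if N: "finite_measure N" "sets N = sets torus_borel" for N
    by (rule cont_gen[where C = "measure N torus"])
       (auto simp: integrable_on_torus[OF N] intro: norm_integral_torus_le[OF N])
  have ii: "integrable torus_haar (\<lambda>x. \<integral>y. G x y \<partial>N)" if "finite_measure N" "sets N = sets torus_borel" for N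
    by (rule integrable_on_torus[OF fh sets_torus_haar ci[OF that]])
  note F = Fubini_torus[OF fh sets_torus_haar _ _ G]
  show "(\<integral>x. charge_integral (G x) \<partial>torus_haar) = charge_integral (\<lambda>y. \<integral>x. G x y \<partial>torus_haar)"
    unfolding charge_integral_def
    by (simp add: ii fin sets F)
qed

end

text \<open>The functions \<open>max 0 (1 - m dist(z, C))\<close> decrease to the indicator function of \<open>C\<close>.\<close>

lemma integral_distance_cutoff_tendsto:
  fixes C :: "(complex ^ 'n::finite) set"
  assumes N: "finite_measure N" "sets N = sets torus_borel" and C: "closed C" "C \<noteq> {}"
  shows "(\<lambda>m. \<integral>z. complex_of_real (max 0 (1 - real m * infdist z C)) \<partial>N) \<longlonglongrightarrow> of_real (measure N (torus \<inter> C))"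
proof -
  interpret finite_measure N by fact
  have sp: "space N = torus" using sets_eq_imp_space_eq[OF N(2)] by simp
  have CN: "torus \<inter> C \<in> sets N" unfolding N(2) using C by (auto simp: sets_restrict_space)
  have c: "continuous_on torus (\<lambda>z. complex_of_real (max 0 (1 - real m * infdist z C)))" for m
    by (intro continuous_intros)
  have "(\<lambda>m. \<integral>z. complex_of_real (max 0 (1 - real m * infdist z C)) \<partial>N) \<longlonglongrightarrow> (\<integral>z. complex_of_real (indicator (torus \<inter> C) z) \<partial>N)"
  proof (rule integral_dominated_convergence[where w = "\<lambda>_. 1"])
    show "(\<lambda>z. complex_of_real (indicator (torus \<inter> C) z)) \<in> borel_measurable N"
      using CN by measurable
    show "(\<lambda>z. complex_of_real (max 0 (1 - real m * infdist z C))) \<in> borel_measurable N" for m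
      using measurable_on_torus[OF c] measurable_cong_sets[OF N(2) refl] by blast
    show "AE z in N. (\<lambda>m. complex_of_real (max 0 (1 - real m * infdist z C))) \<longlonglongrightarrow> complex_of_real (indicator (torus \<inter> C) z)"
    proof (rule AE_I2)
      fix z assume z: "z \<in> space N"
      show "(\<lambda>m. complex_of_real (max 0 (1 - real m * infdist z C))) \<longlonglongrightarrow> complex_of_real (indicator (torus \<inter> C) z)"
      proof (cases "z \<in> C")
        case True
        then show ?thesis using z sp by simp
      next
        case False
        then have d: "infdist z C > 0" using in_closed_iff_infdist_zero[OF C] infdist_nonneg[of z C] by (simp add: less_le)
        obtain M :: nat where M: "1 / infdist z C < real M" using reals_Archimedean2 by blast
        have "max 0 (1 - real m * infdist z C) = 0" if "m \<ge> M" for m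
        proof -
          have "1 < real M * infdist z C" using M d by (simp add: field_simps)
          also have "\<dots> \<le> real m * infdist z C" using that d by (intro mult_right_mono) auto
          finally show ?thesis by simp
        qed
        then have "\<forall>\<^sub>F m in sequentially. complex_of_real (max 0 (1 - real m * infdist z C)) = complex_of_real (indicator (torus \<inter> C) z)"
          using False unfolding eventually_sequentially by (intro exI[of _ M]) auto
        then show ?thesis by (rule tendsto_eventually)
      qed
    qed
    show "AE z in N. norm (complex_of_real (max 0 (1 - real m * infdist z C))) \<le> 1" for m
      by (rule AE_I2) (auto simp: infdist_nonneg)
  qed simp
  moreover have "(\<integral>z. complex_of_real (indicator (torus \<inter> C) z) \<partial>N) = of_real (measure N (torus \<inter> C))"
    using CN sets.sets_into_space[OF CN] by (simp add: Int_absorb1 Int_absorb2)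
  ultimately show ?thesis by simp
qed

lemma complex_measure_parts:
  assumes "complex_measure M \<mu>"
  shows "countably_additive_on M (\<lambda>A. Re (\<mu> A))" "countably_additive_on M (\<lambda>A. - Re (\<mu> A))"
    "countably_additive_on M (\<lambda>A. Im (\<mu> A))" "countably_additive_on M (\<lambda>A. - Im (\<mu> A))"
  using assms unfolding complex_measure_def countably_additive_on_def
  by (auto intro!: sums_minus sums_Re sums_Im)

lemma complex_measure_charge:
  fixes \<mu> :: "(complex ^ 'n::finite) set \<Rightarrow> complex"
  assumes \<mu>: "complex_measure torus_borel \<mu>"
  obtains N1 N2 N3 N4 where "torus_charge N1 N2 N3 N4"
    "\<And>f. complex_measure_integral torus_borel \<mu> f = torus_charge.charge_integral N1 N2 N3 N4 f"
    "\<And>A. A \<in> sets torus_borel \<Longrightarrow> \<mu> A = of_real (measure N1 A - measure N2 A) + \<i> * of_real (measure N3 A - measure N4 A)"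
proof
  let ?T = "torus_borel :: (complex ^ 'n) measure"
  note p = complex_measure_parts[OF \<mu>]
  show c: "torus_charge (jordan_pos ?T (\<lambda>A. Re (\<mu> A))) (jordan_pos ?T (\<lambda>A. - Re (\<mu> A)))
     (jordan_pos ?T (\<lambda>A. Im (\<mu> A))) (jordan_pos ?T (\<lambda>A. - Im (\<mu> A)))"
    by (intro torus_charge.intro finite_measure_jordan_pos sets_jordan_pos p)
  show "complex_measure_integral ?T \<mu> f = torus_charge.charge_integral (jordan_pos ?T (\<lambda>A. Re (\<mu> A))) (jordan_pos ?T (\<lambda>A. - Re (\<mu> A)))
     (jordan_pos ?T (\<lambda>A. Im (\<mu> A))) (jordan_pos ?T (\<lambda>A. - Im (\<mu> A))) f" for f
    unfolding complex_measure_integral_def torus_charge.charge_integral_def[OF c] ..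
  show "\<mu> A = of_real (measure (jordan_pos ?T (\<lambda>A. Re (\<mu> A))) A - measure (jordan_pos ?T (\<lambda>A. - Re (\<mu> A))) A)
     + \<i> * of_real (measure (jordan_pos ?T (\<lambda>A. Im (\<mu> A))) A - measure (jordan_pos ?T (\<lambda>A. - Im (\<mu> A))) A)"
    if "A \<in> sets ?T" for A
    unfolding jordan_decomposition[OF p(1) that] jordan_decomposition[OF p(3) that] by (rule complex_eq)
qed

text \<open>Equal Fourier coefficients give equal integrals of continuous functions, hence equal values on closed
  sets; these generate the Borel sets and are stable under intersection.\<close>

lemma complex_measure_eqI_fourier:
  fixes \<mu> \<nu> :: "(complex ^ 'n::finite) set \<Rightarrow> complex"
  assumes \<mu>: "complex_measure torus_borel \<mu>" and \<nu>: "complex_measure torus_borel \<nu>"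
    and eq: "\<And>k. complex_measure_integral torus_borel \<mu> (mon k) = complex_measure_integral torus_borel \<nu> (mon k)"
  shows "\<mu> = \<nu>"
proof -
  obtain M1 M2 M3 M4 where M: "torus_charge M1 M2 M3 M4"
    and Mi: "\<And>f. complex_measure_integral torus_borel \<mu> f = torus_charge.charge_integral M1 M2 M3 M4 f"
    and Mm: "\<And>A. A \<in> sets torus_borel \<Longrightarrow> \<mu> A = of_real (measure M1 A - measure M2 A) + \<i> * of_real (measure M3 A - measure M4 A)"
    using complex_measure_charge[OF \<mu>] by metis
  obtain N1 N2 N3 N4 where N: "torus_charge N1 N2 N3 N4"
    and Ni: "\<And>f. complex_measure_integral torus_borel \<nu> f = torus_charge.charge_integral N1 N2 N3 N4 f"
    and Nm: "\<And>A. A \<in> sets torus_borel \<Longrightarrow> \<nu> A = of_real (measure N1 A - measure N2 A) + \<i> * of_real (measure N3 A - measure N4 A)"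
    using complex_measure_charge[OF \<nu>] by metis
  interpret M: torus_charge M1 M2 M3 M4 by fact
  interpret N: torus_charge N1 N2 N3 N4 by fact
  have int: "M.charge_integral f = N.charge_integral f" if f: "continuous_on torus f" for f
  proof -
    have "M.charge_integral f - N.charge_integral f = 0"
    proof (rule functional_eq_0_if_monomials[where \<Lambda> = "\<lambda>f. M.charge_integral f - N.charge_integral f" and C = "M.charge_bound + N.charge_bound", OF _ _ _ _ f])
      fix g :: "complex ^ 'n \<Rightarrow> complex" and B assume g: "continuous_on torus g" and B: "\<And>z. z \<in> torus \<Longrightarrow> norm (g z) \<le> B"
      have "norm (M.charge_integral g - N.charge_integral g) \<le> norm (M.charge_integral g) + norm (N.charge_integral g)"
        by (rule norm_triangle_ineq4)
      also have "\<dots> \<le> (M.charge_bound + N.charge_bound) * B"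
        using M.norm_charge_integral_le[OF g B] N.norm_charge_integral_le[OF g B] by (simp add: distrib_right)
      finally show "norm (M.charge_integral g - N.charge_integral g) \<le> (M.charge_bound + N.charge_bound) * B" .
    qed (use eq in \<open>auto simp: M.charge_integral_add N.charge_integral_add M.charge_integral_scale N.charge_integral_scale Mi Ni right_diff_distrib\<close>)
    then show ?thesis by simp
  qed
  have T: "torus \<inter> A \<in> sets torus_borel" if "A \<in> sets borel" for A :: "(complex ^ 'n) set"
    using that by (auto simp: sets_restrict_space)
  have empty: "\<mu> {} = 0" "\<nu> {} = 0" using Mm[of "{}"] Nm[of "{}"] by auto
  have closed: "\<mu> (torus \<inter> C) = \<nu> (torus \<inter> C)" if C: "closed C" for C
  proof (cases "C = {}")
    case False
    let ?f = "\<lambda>m z. complex_of_real (max 0 (1 - real m * infdist z C))"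
    have cf: "continuous_on torus (?f m)" for m by (intro continuous_intros)
    have TC: "torus \<inter> C \<in> sets torus_borel" using C by (intro T) simp
    have "(\<lambda>m. M.charge_integral (?f m)) \<longlonglongrightarrow> \<mu> (torus \<inter> C)"
      unfolding M.charge_integral_def Mm[OF TC] of_real_diff
      by (intro tendsto_intros integral_distance_cutoff_tendsto M.fin M.sets C False)
    moreover have "(\<lambda>m. N.charge_integral (?f m)) \<longlonglongrightarrow> \<nu> (torus \<inter> C)"
      unfolding N.charge_integral_def Nm[OF TC] of_real_diff
      by (intro tendsto_intros integral_distance_cutoff_tendsto N.fin N.sets C False)
    ultimately show ?thesis using int[OF cf] by (simp add: LIMSEQ_unique)
  qed (simp add: empty)
  have bor: "\<mu> (torus \<inter> A) = \<nu> (torus \<inter> A)" if "A \<in> sigma_sets UNIV (Collect closed)" for A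
  proof (rule sigma_sets_induct_disjoint[OF _ _ that, of "\<lambda>A. \<mu> (torus \<inter> A) = \<nu> (torus \<inter> A)"])
    show "Int_stable (Collect closed)" by (auto simp: Int_stable_def)
    show "Collect closed \<subseteq> Pow UNIV" by auto
    show "\<mu> (torus \<inter> A) = \<nu> (torus \<inter> A)" if "A \<in> Collect closed" for A using that closed by auto
    show "\<mu> (torus \<inter> {}) = \<nu> (torus \<inter> {})" by (simp add: empty)
  next
    fix A :: "(complex ^ 'n) set" assume A: "A \<in> sigma_sets UNIV (Collect closed)" and e: "\<mu> (torus \<inter> A) = \<nu> (torus \<inter> A)"
    have Ab: "A \<in> sets borel" using A by (simp add: borel_eq_closed)
    have tt: "\<mu> torus = \<nu> torus" using closed[of UNIV] by simp
    have d: "measure L (torus \<inter> (UNIV - A)) = measure L torus - measure L (torus \<inter> A)" if "finite_measure L" "sets L = sets torus_borel" for L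
    proof -
      interpret L: finite_measure L by fact
      have "torus \<inter> (UNIV - A) = torus - torus \<inter> A" by auto
      then show ?thesis using T[OF Ab] that(2) by (simp add: L.finite_measure_Diff)
    qed
    have T': "torus \<inter> (UNIV - A) \<in> sets torus_borel" by (rule T) (use Ab in auto)
    have "\<mu> (torus \<inter> (UNIV - A)) = \<mu> torus - \<mu> (torus \<inter> A)"
      unfolding Mm[OF T'] Mm[OF T[OF Ab]] Mm[OF torus_in_sets] by (simp add: d M.fin M.sets algebra_simps)
    moreover have "\<nu> (torus \<inter> (UNIV - A)) = \<nu> torus - \<nu> (torus \<inter> A)"
      unfolding Nm[OF T'] Nm[OF T[OF Ab]] Nm[OF torus_in_sets] by (simp add: d N.fin N.sets algebra_simps)
    ultimately show "\<mu> (torus \<inter> (UNIV - A)) = \<nu> (torus \<inter> (UNIV - A))" using tt e by simp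
  next
    fix A :: "nat \<Rightarrow> (complex ^ 'n) set" assume dis: "disjoint_family A" and r: "range A \<subseteq> sigma_sets UNIV (Collect closed)"
      and e: "\<And>i. \<mu> (torus \<inter> A i) = \<nu> (torus \<inter> A i)"
    have Ab: "A i \<in> sets borel" for i using r by (auto simp: borel_eq_closed)
    have rT: "range (\<lambda>i. torus \<inter> A i) \<subseteq> sets torus_borel" using T[OF Ab] by auto
    have dT: "disjoint_family (\<lambda>i. torus \<inter> A i)" using dis by (auto simp: disjoint_family_on_def)
    have m: "(\<lambda>i. \<mu> (torus \<inter> A i)) sums \<mu> (\<Union>i. torus \<inter> A i)" using \<mu> rT dT unfolding complex_measure_def by blast
    have n: "(\<lambda>i. \<nu> (torus \<inter> A i)) sums \<nu> (\<Union>i. torus \<inter> A i)" using \<nu> rT dT unfolding complex_measure_def by blast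
    have "torus \<inter> (\<Union>i. A i) = (\<Union>i. torus \<inter> A i)" by auto
    then show "\<mu> (torus \<inter> (\<Union>i. A i)) = \<nu> (torus \<inter> (\<Union>i. A i))"
      using sums_unique2[OF m[unfolded e] n] by simp
  qed
  show ?thesis
  proof
    fix A
    show "\<mu> A = \<nu> A"
    proof (cases "A \<in> sets (torus_borel :: (complex ^ 'n) measure)")
      case True
      then obtain B where "A = torus \<inter> B" "B \<in> sets borel" by (auto simp: sets_restrict_space)
      then show ?thesis using bor[of B] by (simp add: borel_eq_closed)
    qed (use \<mu> \<nu> in \<open>auto simp: complex_measure_def\<close>)
  qed
qed

section \<open>Fourier coefficients of Poisson integrals\<close>

lemma poisson_kernel_disc_kernel:
  assumes "\<zeta> \<in> torus"
  shows "poisson_kernel \<alpha> \<beta> z \<zeta> = (\<Prod>j\<in>UNIV. disc_kernel (\<alpha> $ j) (\<beta> $ j) (z $ j * cnj (\<zeta> $ j)))"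
  unfolding poisson_kernel_def disc_kernel_def
  by (rule prod.cong) (simp_all add: norm_mult torus_norm[OF assms])

lemma continuous_poisson_kernel:
  fixes \<alpha> \<beta> :: "complex ^ 'n::finite"
  assumes r: "\<And>j. 0 \<le> r j \<and> r j < 1"
  shows "continuous_on (torus \<times> torus) (\<lambda>p. poisson_kernel \<alpha> \<beta> (polar_point r (fst p)) (snd p))"
proof -
  have "continuous_on (torus \<times> torus) (\<lambda>p. \<Prod>j\<in>UNIV. disc_kernel (\<alpha> $ j) (\<beta> $ j) (polar_point r (fst p) $ j * cnj (snd p $ j)))"
  proof (rule continuous_on_prod)
    fix j
    show "continuous_on (torus \<times> torus) (\<lambda>p. disc_kernel (\<alpha> $ j) (\<beta> $ j) (polar_point r (fst p) $ j * cnj (snd p $ j)))"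
    proof (rule continuous_on_compose2[OF continuous_disc_kernel])
      show "continuous_on (torus \<times> torus) (\<lambda>p. polar_point r (fst p) $ j * cnj (snd p $ j))"
        unfolding polar_point_def vec_lambda_beta by (intro continuous_intros)
      show "(\<lambda>p. polar_point r (fst p) $ j * cnj (snd p $ j)) ` (torus \<times> torus) \<subseteq> ball 0 1"
        using r[of j] by (auto simp: polar_point_def norm_mult torus_norm)
    qed
  qed
  then show ?thesis
    by (rule continuous_on_eq) (auto simp: poisson_kernel_disc_kernel)
qed

definition radial_prod :: "complex ^ 'n::finite \<Rightarrow> complex ^ 'n \<Rightarrow> ('n \<Rightarrow> int) \<Rightarrow> ('n \<Rightarrow> real) \<Rightarrow> complex" where
  "radial_prod \<alpha> \<beta> k r = (\<Prod>j\<in>UNIV. radial_coeff (\<alpha> $ j) (\<beta> $ j) (k j) (r j))"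

text \<open>Rotating by \<open>\<zeta>\<close> turns the kernel into a product of one-variable kernels, whose coefficients are known.\<close>

lemma fourier_poisson_kernel:
  fixes \<alpha> \<beta> :: "complex ^ 'n::finite"
  assumes ab: "\<And>j. Re (\<alpha> $ j) + Re (\<beta> $ j) > -1" and r: "\<And>j. 0 \<le> r j \<and> r j < 1" and \<zeta>: "\<zeta> \<in> torus"
  shows "(\<integral>\<eta>. poisson_kernel \<alpha> \<beta> (polar_point r \<eta>) \<zeta> * mon (\<lambda>i. - k i) \<eta> \<partial>torus_haar)
     = mon (\<lambda>i. - k i) \<zeta> * radial_prod \<alpha> \<beta> k r"
proof -
  let ?G = "\<lambda>\<eta>. poisson_kernel \<alpha> \<beta> (polar_point r \<eta>) \<zeta> * mon (\<lambda>i. - k i) \<eta>"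
  let ?g = "\<lambda>j w. disc_kernel (\<alpha> $ j) (\<beta> $ j) (of_real (r j) * w) * w powi (- k j)"
  have "continuous_on torus (\<lambda>\<eta>. (\<eta>, \<zeta>))" by (rule continuous_on_Pair[OF continuous_on_id continuous_on_const])
  then have "continuous_on torus (\<lambda>\<eta>. poisson_kernel \<alpha> \<beta> (polar_point r (fst (\<eta>, \<zeta>))) (snd (\<eta>, \<zeta>)))"
    by (rule continuous_on_compose2[OF continuous_poisson_kernel[OF r]]) (use \<zeta> in auto)
  then have c: "continuous_on torus ?G" by (simp add: continuous_on_mult continuous_mon)
  have G: "?G (\<zeta> * \<eta>) = mon (\<lambda>i. - k i) \<zeta> * (\<Prod>j\<in>UNIV. ?g j (\<eta> $ j))" for \<eta>
  proof -
    have e: "polar_point r (\<zeta> * \<eta>) $ j * cnj (\<zeta> $ j) = of_real (r j) * \<eta> $ j" for j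
    proof -
      have "\<zeta> $ j * cnj (\<zeta> $ j) = 1" using torus_norm[OF \<zeta>, of j] by (simp add: complex_mult_cnj cmod_def)
      moreover have "polar_point r (\<zeta> * \<eta>) $ j * cnj (\<zeta> $ j) = (\<zeta> $ j * cnj (\<zeta> $ j)) * (of_real (r j) * \<eta> $ j)"
        by (simp add: polar_point_def mult_ac)
      ultimately show ?thesis by simp
    qed
    show ?thesis
      unfolding poisson_kernel_disc_kernel[OF \<zeta>] e mon_mult prod.distrib unfolding mon_def by (simp only: mult_ac)
  qed
  have "(\<integral>\<eta>. ?G \<eta> \<partial>torus_haar) = (\<integral>\<eta>. ?G (\<zeta> * \<eta>) \<partial>torus_haar)"
    by (rule integral_torus_haar_rotate[OF c \<zeta>, symmetric])
  also have "\<dots> = mon (\<lambda>i. - k i) \<zeta> * (\<integral>\<eta>. (\<Prod>j\<in>UNIV. ?g j (\<eta> $ j)) \<partial>torus_haar)"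
    unfolding G by simp
  also have "(\<integral>\<eta>. (\<Prod>j\<in>UNIV. ?g j (\<eta> $ j)) \<partial>torus_haar) = (\<Prod>j\<in>UNIV. (1 / (2 * pi)) *\<^sub>R integral {0..2*pi} (\<lambda>t. ?g j (cis t)))"
  proof (rule integral_torus_haar_prod)
    fix j
    show "continuous_on (sphere 0 1) (?g j)"
    proof (intro continuous_on_mult continuous_on_compose2[OF continuous_disc_kernel])
      show "(\<lambda>w. complex_of_real (r j) * w) ` sphere 0 1 \<subseteq> ball 0 1" using r[of j] by (auto simp: norm_mult)
      show "continuous_on (sphere 0 1) (\<lambda>w :: complex. w powi - k j)" by (intro continuous_intros) auto
    qed (auto intro!: continuous_intros)
  qed
  also have "\<dots> = radial_prod \<alpha> \<beta> k r"
    unfolding radial_prod_def by (rule prod.cong[OF refl], rule disc_kernel_coeff) (use ab r in auto)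
  finally show ?thesis .
qed

lemma fourier_poisson_integral:
  fixes \<alpha> \<beta> :: "complex ^ 'n::finite"
  assumes ab: "\<And>j. Re (\<alpha> $ j) + Re (\<beta> $ j) > -1" and \<mu>: "complex_measure torus_borel \<mu>"
    and r: "\<And>j. 0 \<le> r j \<and> r j < 1"
  shows "fourier_coeff (poisson_integral \<alpha> \<beta> \<mu>) k r
      = complex_measure_integral torus_borel \<mu> (mon (\<lambda>i. - k i)) * radial_prod \<alpha> \<beta> k r"
    and "continuous_on torus (\<lambda>\<eta>. poisson_integral \<alpha> \<beta> \<mu> (polar_point r \<eta>))"
proof -
  obtain N1 N2 N3 N4 where N: "torus_charge N1 N2 N3 N4"
    and Ni: "\<And>f. complex_measure_integral torus_borel \<mu> f = torus_charge.charge_integral N1 N2 N3 N4 f"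
    using complex_measure_charge[OF \<mu>] by metis
  interpret N: torus_charge N1 N2 N3 N4 by fact
  let ?P = "\<lambda>\<eta> \<zeta>. poisson_kernel \<alpha> \<beta> (polar_point r \<eta>) \<zeta>"
  have pi: "poisson_integral \<alpha> \<beta> \<mu> (polar_point r \<eta>) = N.charge_integral (?P \<eta>)" for \<eta>
    by (simp add: poisson_integral_def Ni)
  show "continuous_on torus (\<lambda>\<eta>. poisson_integral \<alpha> \<beta> \<mu> (polar_point r \<eta>))"
    unfolding pi by (rule N.charge_integral_swap(2)[OF continuous_poisson_kernel[OF r]])
  let ?m = "mon (\<lambda>i. - k i)"
  have c: "continuous_on (torus \<times> torus) (\<lambda>p. ?m (fst p) * ?P (fst p) (snd p))"
    by (intro continuous_on_mult continuous_poisson_kernel r continuous_on_compose2[OF continuous_mon]) (auto intro: continuous_intros)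
  have "fourier_coeff (poisson_integral \<alpha> \<beta> \<mu>) k r = (\<integral>\<eta>. N.charge_integral (\<lambda>\<zeta>. ?m \<eta> * ?P \<eta> \<zeta>) \<partial>torus_haar)"
    unfolding fourier_coeff_def pi N.charge_integral_scale by (simp only: mult.commute)
  also have "\<dots> = N.charge_integral (\<lambda>\<zeta>. \<integral>\<eta>. ?m \<eta> * ?P \<eta> \<zeta> \<partial>torus_haar)"
    by (rule N.charge_integral_swap(1)[OF c])
  also have "\<dots> = N.charge_integral (\<lambda>\<zeta>. radial_prod \<alpha> \<beta> k r * ?m \<zeta>)"
    by (rule N.charge_integral_cong) (use fourier_poisson_kernel[OF ab r, where k = k] in \<open>simp add: mult.commute\<close>)
  also have "\<dots> = N.charge_integral ?m * radial_prod \<alpha> \<beta> k r"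
    unfolding N.charge_integral_scale by (rule mult.commute)
  finally show "fourier_coeff (poisson_integral \<alpha> \<beta> \<mu>) k r
      = complex_measure_integral torus_borel \<mu> ?m * radial_prod \<alpha> \<beta> k r"
    by (simp only: Ni)
qed

lemma fourier_coeff_cong:
  fixes u v :: "complex ^ 'n::finite \<Rightarrow> complex"
  assumes "\<And>z. z \<in> polydisc \<Longrightarrow> u z = v z" "\<And>j. 0 \<le> r j \<and> r j < 1"
  shows "fourier_coeff u k r = fourier_coeff v k r"
  unfolding fourier_coeff_def
proof (rule Bochner_Integration.integral_cong[OF refl])
  fix \<zeta> :: "complex ^ 'n" assume "\<zeta> \<in> space torus_haar"
  then have "polar_point r \<zeta> \<in> polydisc" using assms(2) by (intro polar_point_polydisc) auto
  then show "u (polar_point r \<zeta>) * mon (\<lambda>i. - k i) \<zeta> = v (polar_point r \<zeta>) * mon (\<lambda>i. - k i) \<zeta>" using assms(1) by simp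
qed

lemma prod_radial_coeff_limit:
  fixes \<alpha> \<beta> :: "complex ^ 'n::finite"
  assumes "\<And>j. Re (\<alpha> $ j) + Re (\<beta> $ j) > -1" "\<And>j. \<alpha> $ j + 1 \<notin> \<int>\<^sub>\<le>\<^sub>0" "\<And>j. \<beta> $ j + 1 \<notin> \<int>\<^sub>\<le>\<^sub>0"
  shows "((\<lambda>s. radial_prod \<alpha> \<beta> k (\<lambda>_. s)) \<longlongrightarrow> 1) (at_left 1)"
proof -
  have "((\<lambda>s. radial_prod \<alpha> \<beta> k (\<lambda>_. s)) \<longlongrightarrow> (\<Prod>j\<in>(UNIV :: 'n set). 1)) (at_left 1)"
    unfolding radial_prod_def by (rule tendsto_prod) (rule radial_coeff_limit[OF assms])
  then show ?thesis by simp
qed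

text \<open>A radius close to \<open>1\<close> makes the radial factor of a given index nonzero, so the Fourier coefficient of the measure can be
  recovered from the Poisson integral.\<close>

lemma poisson_measure_unique:
  fixes \<alpha> \<beta> :: "complex ^ 'n::finite"
  assumes ab: "\<And>j. Re (\<alpha> $ j) + Re (\<beta> $ j) > -1" "\<And>j. \<alpha> $ j + 1 \<notin> \<int>\<^sub>\<le>\<^sub>0" "\<And>j. \<beta> $ j + 1 \<notin> \<int>\<^sub>\<le>\<^sub>0"
    and \<mu>: "complex_measure torus_borel \<mu>" and \<nu>: "complex_measure torus_borel \<nu>"
    and eq: "\<And>z. z \<in> polydisc \<Longrightarrow> poisson_integral \<alpha> \<beta> \<mu> z = poisson_integral \<alpha> \<beta> \<nu> z"
  shows "\<mu> = \<nu>"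
proof (rule complex_measure_eqI_fourier[OF \<mu> \<nu>])
  fix l :: "'n \<Rightarrow> int"
  define k where "k = (\<lambda>i. - l i)"
  let ?p = "\<lambda>s. radial_prod \<alpha> \<beta> k (\<lambda>_. s)"
  have "\<forall>\<^sub>F s in at_left 1. ?p s \<noteq> 0"
    by (rule tendsto_imp_eventually_ne[OF prod_radial_coeff_limit[OF ab]]) simp
  moreover have "\<forall>\<^sub>F s in at_left (1::real). s \<in> {0<..<1}"
    by (rule eventually_at_left_real) simp
  ultimately have "\<forall>\<^sub>F s in at_left 1. ?p s \<noteq> 0 \<and> s \<in> {0<..<1}" by (rule eventually_conj)
  then obtain s where s: "?p s \<noteq> 0" "s \<in> {0<..<1}"
    using eventually_happens'[OF trivial_limit_at_left_real] by blast
  have r: "0 \<le> s \<and> s < 1" using s by auto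
  have "complex_measure_integral torus_borel \<mu> (mon (\<lambda>i. - k i)) * ?p s = complex_measure_integral torus_borel \<nu> (mon (\<lambda>i. - k i)) * ?p s"
    using fourier_coeff_cong[of "poisson_integral \<alpha> \<beta> \<mu>" "poisson_integral \<alpha> \<beta> \<nu>" "\<lambda>_. s" k] eq r
      fourier_poisson_integral(1)[OF ab(1) \<mu>, of "\<lambda>_. s" k] fourier_poisson_integral(1)[OF ab(1) \<nu>, of "\<lambda>_. s" k] by simp
  then show "complex_measure_integral torus_borel \<mu> (mon l) = complex_measure_integral torus_borel \<nu> (mon l)"
    using s by (simp add: k_def)
qed

text \<open>The radii are replaced one coordinate at a time. Products are compared instead of quotients because the radial
  solutions may have zeros.\<close>

lemma fourier_coeff_proportional:
  fixes \<alpha> \<beta> :: "complex ^ 'n::finite"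
  assumes ab: "\<And>j. Re (\<alpha> $ j) + Re (\<beta> $ j) > -1"
    and u: "separately_harmonic \<alpha> \<beta> u"
    and r: "\<And>j. 0 \<le> r j \<and> r j < 1" and r': "\<And>j. 0 \<le> r' j \<and> r' j < 1"
  shows "fourier_coeff u k r * radial_prod \<alpha> \<beta> k r'
      = fourier_coeff u k r' * radial_prod \<alpha> \<beta> k r"
proof -
  let ?\<phi> = "\<lambda>j. radial_coeff (\<alpha> $ j) (\<beta> $ j) (k j)"
  obtain u' u'' where C2: "C2_derivatives u u' u''"
    using u unfolding separately_harmonic_def C2_on_def C2_derivatives_def by blast
  have L: "L_op j (\<alpha> $ j) (\<beta> $ j) u z = 0" if "z \<in> polydisc" for j z
    using u that by (simp add: separately_harmonic_def)
  have one: "fourier_coeff u k (R(j := x)) * ?\<phi> j y = fourier_coeff u k (R(j := y)) * ?\<phi> j x"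
    if R: "\<And>i. 0 \<le> R i \<and> R i < 1" and x: "0 \<le> x" "x < 1" and y: "0 \<le> y" "y < 1" for R j x y
  proof (rule radial_solution_proportional[where f = "\<lambda>x. fourier_coeff u k (R(j := x))"])
    have "\<bar>R i\<bar> < 1" for i using R[of i] by simp
    then show "radial_solution (\<alpha> $ j) (\<beta> $ j) (k j) (\<lambda>x. fourier_coeff u k (R(j := x)))"
      by (rule C2_derivatives.fourier_coeff_radial_solution[OF C2 _ L])
  qed (use x y radial_coeff_solution[OF ab] in auto)
  have "fourier_coeff u k (\<lambda>i. if i \<in> S then r i else r' i) * (\<Prod>j\<in>S. ?\<phi> j (r' j)) = fourier_coeff u k r' * (\<Prod>j\<in>S. ?\<phi> j (r j))"
    if "finite S" for S
    using that
  proof (induction S rule: finite_induct)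
    case empty
    then show ?case by simp
  next
    case (insert j S)
    define R where "R = (\<lambda>i. if i \<in> S then r i else r' i)"
    have R: "0 \<le> R i \<and> R i < 1" for i using r r' by (simp add: R_def)
    have "(\<lambda>i. if i \<in> insert j S then r i else r' i) = R(j := r j)" "R(j := r' j) = R"
      using insert.hyps by (auto simp: R_def fun_eq_iff)
    then have "fourier_coeff u k (\<lambda>i. if i \<in> insert j S then r i else r' i) * ?\<phi> j (r' j) = fourier_coeff u k R * ?\<phi> j (r j)"
      using one[of R "r j" "r' j" j] R r[of j] r'[of j] by simp
    then have "fourier_coeff u k (\<lambda>i. if i \<in> insert j S then r i else r' i) * ?\<phi> j (r' j) * (\<Prod>j\<in>S. ?\<phi> j (r' j))
       = (fourier_coeff u k R * (\<Prod>j\<in>S. ?\<phi> j (r' j))) * ?\<phi> j (r j)"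
      by (simp add: mult_ac)
    also have "\<dots> = fourier_coeff u k r' * (\<Prod>j\<in>S. ?\<phi> j (r j)) * ?\<phi> j (r j)"
      using insert.IH by (simp add: R_def)
    finally show ?case using insert.hyps by (simp add: mult_ac)
  qed
  from this[of UNIV] show ?thesis by (simp add: radial_prod_def)
qed

section \<open>Existence of the boundary measure\<close>

text \<open>The Jordan parts of the measure usually differ from the four given ones, but integrals only depend on the
  differences.\<close>

lemma complex_measure_of_charge:
  assumes "torus_charge N1 N2 N3 N4"
  defines "\<mu> \<equiv> \<lambda>A. if A \<in> sets torus_borel then of_real (measure N1 A - measure N2 A) + \<i> * of_real (measure N3 A - measure N4 A) else 0"
  shows "complex_measure torus_borel \<mu>"
    and "continuous_on torus f \<Longrightarrow> complex_measure_integral torus_borel \<mu> f = torus_charge.charge_integral N1 N2 N3 N4 f"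
proof -
  interpret N: torus_charge N1 N2 N3 N4 by fact
  have s: "(\<lambda>i. of_real (measure L (A i)) :: complex) sums of_real (measure L (\<Union>i. A i))"
    if "finite_measure L" "sets L = sets torus_borel" "range A \<subseteq> sets torus_borel" "disjoint_family A" for L and A :: "nat \<Rightarrow> (complex ^ 'a) set"
    using finite_measure.finite_measure_UNION[OF that(1), of A] that by (simp add: sums_of_real_iff)
  show \<mu>: "complex_measure torus_borel \<mu>"
    unfolding complex_measure_def
  proof (intro conjI allI impI)
    fix A :: "nat \<Rightarrow> (complex ^ 'a) set" assume A: "range A \<subseteq> sets torus_borel" "disjoint_family A"
    then have "A i \<in> sets torus_borel" "(\<Union>i. A i) \<in> sets torus_borel" for i by auto
    then have "\<mu> (A i) = of_real (measure N1 (A i)) - of_real (measure N2 (A i)) + \<i> * (of_real (measure N3 (A i)) - of_real (measure N4 (A i)))"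
      "\<mu> (\<Union>i. A i) = of_real (measure N1 (\<Union>i. A i)) - of_real (measure N2 (\<Union>i. A i)) + \<i> * (of_real (measure N3 (\<Union>i. A i)) - of_real (measure N4 (\<Union>i. A i)))" for i
      by (simp_all add: \<mu>_def)
    then show "(\<lambda>i. \<mu> (A i)) sums \<mu> (\<Union>i. A i)"
      by (simp only:) (intro sums_add sums_diff sums_mult s N.fin N.sets A)
  qed (simp add: \<mu>_def)
  show "complex_measure_integral torus_borel \<mu> f = N.charge_integral f" if f: "continuous_on torus f"
  proof -
    obtain J1 J2 J3 J4 where J: "torus_charge J1 J2 J3 J4"
      and Ji: "\<And>f. complex_measure_integral torus_borel \<mu> f = torus_charge.charge_integral J1 J2 J3 J4 f"
      and Jm: "\<And>A. A \<in> sets torus_borel \<Longrightarrow> \<mu> A = of_real (measure J1 A - measure J2 A) + \<i> * of_real (measure J3 A - measure J4 A)"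
      using complex_measure_charge[OF \<mu>] by metis
    interpret J: torus_charge J1 J2 J3 J4 by fact
    have e: "measure J1 A - measure J2 A = measure N1 A - measure N2 A \<and> measure J3 A - measure J4 A = measure N3 A - measure N4 A"
      if "A \<in> sets torus_borel" for A
      using Jm[OF that] that by (simp add: \<mu>_def complex_eq_iff)
    obtain B where B: "\<And>z. z \<in> torus \<Longrightarrow> norm (f z) \<le> B" using bounded_on_torus[OF f] by blast
    have "(\<integral>x. f x \<partial>J1) - (\<integral>x. f x \<partial>J2) = (\<integral>x. f x \<partial>N1) - (\<integral>x. f x \<partial>N2)"
      by (rule integral_diff_eq[OF J.fin(1,2) N.fin(1,2) J.sets(1,2) N.sets(1,2) _ measurable_on_torus[OF f], of B]) (use e B in auto)
    moreover have "(\<integral>x. f x \<partial>J3) - (\<integral>x. f x \<partial>J4) = (\<integral>x. f x \<partial>N3) - (\<integral>x. f x \<partial>N4)"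
      by (rule integral_diff_eq[OF J.fin(3,4) N.fin(3,4) J.sets(3,4) N.sets(3,4) _ measurable_on_torus[OF f], of B]) (use e B in auto)
    ultimately show ?thesis unfolding Ji J.charge_integral_def N.charge_integral_def by simp
  qed
qed

lemma torus_haar_cis_vec: "torus_haar = distr (uniform_measure lborel angles) torus_borel cis_vec"
  unfolding torus_haar_def cis_vec_def[abs_def] ..

text \<open>Positive and negative parts of the real and the imaginary part are treated separately, passing to a subsequence
  each time.\<close>

lemma weak_limit_of_dilations:
  fixes w :: "nat \<Rightarrow> complex ^ 'n::finite \<Rightarrow> complex"
  assumes w: "\<And>m. continuous_on torus (w m)"
    and C: "\<And>m. (\<integral>\<^sup>+\<zeta>. ennreal (norm (w m \<zeta>)) \<partial>torus_haar) \<le> ennreal C"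
  shows "\<exists>R N1 N2 N3 N4. strict_mono (R :: nat \<Rightarrow> nat) \<and> torus_charge N1 N2 N3 N4 \<and>
    (\<forall>f. continuous_on torus f \<longrightarrow> (\<lambda>i. \<integral>\<zeta>. w (R i) \<zeta> * f \<zeta> \<partial>torus_haar) \<longlonglongrightarrow> torus_charge.charge_integral N1 N2 N3 N4 f)"
proof -
  let ?U = "uniform_measure lborel (angles :: (real ^ 'n) set)"
  have cm: "cis_vec \<in> ?U \<rightarrow>\<^sub>M torus_borel"
    using cis_vec_measurable by (simp add: cis_vec_def[abs_def] cong: measurable_cong_sets)
  define T where "T g m f = (\<integral>\<zeta>. complex_of_real (g (w m \<zeta>)) * f \<zeta> \<partial>torus_haar)" for g :: "complex \<Rightarrow> real" and m and f :: "complex ^ 'n \<Rightarrow> complex"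
  have part: "\<exists>r N. strict_mono (r :: nat \<Rightarrow> nat) \<and> finite_measure N \<and> sets N = sets (torus_borel :: (complex ^ 'n) measure) \<and>
     (\<forall>f :: complex ^ 'n \<Rightarrow> complex. continuous_on torus f \<longrightarrow> (\<lambda>i. T g (q (r i)) f) \<longlonglongrightarrow> (\<integral>\<zeta>. f \<zeta> \<partial>N))"
    if g: "continuous_on UNIV g" "\<And>z. 0 \<le> g z" "\<And>z. g z \<le> norm z" for g and q :: "nat \<Rightarrow> nat"
  proof -
    define D where "D m = density ?U (\<lambda>\<theta>. ennreal (g (w m (cis_vec \<theta>))))" for m
    have gw: "continuous_on torus (\<lambda>\<zeta>. g (w m \<zeta>))" for m
      by (rule continuous_on_compose2[OF g(1) w]) auto
    have gm: "(\<lambda>\<theta>. g (w m (cis_vec \<theta>))) \<in> borel_measurable ?U" for m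
      using measurable_compose[OF cm measurable_on_torus[OF gw]] .
    have nm: "(\<lambda>\<zeta>. ennreal (norm (w m \<zeta>))) \<in> borel_measurable torus_borel" for m
      using measurable_on_torus[OF continuous_on_norm[OF w]] by measurable
    have "sets (D m) = sets borel" for m by (simp add: D_def)
    moreover have "emeasure (D m) UNIV \<le> ennreal C" for m
    proof -
      have "emeasure (D m) UNIV = (\<integral>\<^sup>+\<theta>. ennreal (g (w m (cis_vec \<theta>))) \<partial>?U)"
        unfolding D_def using gm by (subst emeasure_density) auto
      also have "\<dots> \<le> (\<integral>\<^sup>+\<theta>. ennreal (norm (w m (cis_vec \<theta>))) \<partial>?U)"
        by (intro nn_integral_mono ennreal_leI g)
      also have "\<dots> = (\<integral>\<^sup>+\<zeta>. ennreal (norm (w m \<zeta>)) \<partial>torus_haar)"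
        unfolding torus_haar_cis_vec by (rule nn_integral_distr[OF cm, symmetric]) (use nm in simp)
      finally show ?thesis using C[of m] by simp
    qed
    ultimately obtain r N where r: "strict_mono r" "finite_measure N" "sets N = sets (torus_borel :: (complex ^ 'n) measure)"
      and lim: "\<forall>f :: complex ^ 'n \<Rightarrow> complex. continuous_on torus f \<longrightarrow> (\<lambda>i. \<integral>\<theta>. f (cis_vec \<theta>) \<partial>D (q (r i))) \<longlonglongrightarrow> (\<integral>\<zeta>. f \<zeta> \<partial>N)"
      using torus_weak_compactness[of "\<lambda>i. D (q i)" C] by blast
    have "T g m f = (\<integral>\<theta>. f (cis_vec \<theta>) \<partial>D m)" if f: "continuous_on torus f" for m f
    proof -
      have c: "continuous_on torus (\<lambda>\<zeta>. complex_of_real (g (w m \<zeta>)) * f \<zeta>)" by (intro continuous_intros gw f)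
      have "T g m f = (\<integral>\<theta>. complex_of_real (g (w m (cis_vec \<theta>))) * f (cis_vec \<theta>) \<partial>?U)"
        unfolding T_def torus_haar_cis_vec by (rule integral_distr[OF cm measurable_on_torus[OF c]])
      also have "\<dots> = (\<integral>\<theta>. g (w m (cis_vec \<theta>)) *\<^sub>R f (cis_vec \<theta>) \<partial>?U)" by (simp add: scaleR_conv_of_real)
      also have "\<dots> = (\<integral>\<theta>. f (cis_vec \<theta>) \<partial>D m)"
        unfolding D_def using g(2) by (intro integral_density[symmetric] gm measurable_compose[OF cm measurable_on_torus[OF f]]) auto
      finally show ?thesis .
    qed
    then show ?thesis using r lim by (intro exI[of _ r] exI[of _ N]) auto
  qed
  define g1 g2 g3 g4 :: "complex \<Rightarrow> real"
    where "g1 z = max 0 (Re z)" and "g2 z = max 0 (- Re z)" and "g3 z = max 0 (Im z)" and "g4 z = max 0 (- Im z)" for z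
  have gc: "continuous_on UNIV g1" "continuous_on UNIV g2" "continuous_on UNIV g3" "continuous_on UNIV g4"
    unfolding g1_def g2_def g3_def g4_def by (intro continuous_intros)+
  have g0: "0 \<le> g1 z" "0 \<le> g2 z" "0 \<le> g3 z" "0 \<le> g4 z" for z
    by (simp_all add: g1_def g2_def g3_def g4_def)
  have gn: "g1 z \<le> norm z" "g2 z \<le> norm z" "g3 z \<le> norm z" "g4 z \<le> norm z" for z
    using abs_Re_le_cmod[of z] abs_Im_le_cmod[of z] by (auto simp: g1_def g2_def g3_def g4_def)
  obtain r1 N1 where 1: "strict_mono r1" "finite_measure N1" "sets N1 = sets (torus_borel :: (complex ^ 'n) measure)"
    "\<And>f. continuous_on torus f \<Longrightarrow> (\<lambda>i. T g1 (r1 i) f) \<longlonglongrightarrow> (\<integral>\<zeta>. f \<zeta> \<partial>N1)"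
    using part[OF gc(1) g0(1) gn(1), of "\<lambda>i. i"] by blast
  obtain r2 N2 where 2: "strict_mono r2" "finite_measure N2" "sets N2 = sets (torus_borel :: (complex ^ 'n) measure)"
    "\<And>f. continuous_on torus f \<Longrightarrow> (\<lambda>i. T g2 (r1 (r2 i)) f) \<longlonglongrightarrow> (\<integral>\<zeta>. f \<zeta> \<partial>N2)"
    using part[OF gc(2) g0(2) gn(2), of r1] by blast
  obtain r3 N3 where 3: "strict_mono r3" "finite_measure N3" "sets N3 = sets (torus_borel :: (complex ^ 'n) measure)"
    "\<And>f. continuous_on torus f \<Longrightarrow> (\<lambda>i. T g3 (r1 (r2 (r3 i))) f) \<longlonglongrightarrow> (\<integral>\<zeta>. f \<zeta> \<partial>N3)"
    using part[OF gc(3) g0(3) gn(3), of "\<lambda>i. r1 (r2 i)"] by blast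
  obtain r4 N4 where 4: "strict_mono r4" "finite_measure N4" "sets N4 = sets (torus_borel :: (complex ^ 'n) measure)"
    "\<And>f. continuous_on torus f \<Longrightarrow> (\<lambda>i. T g4 (r1 (r2 (r3 (r4 i)))) f) \<longlonglongrightarrow> (\<integral>\<zeta>. f \<zeta> \<partial>N4)"
    using part[OF gc(4) g0(4) gn(4), of "\<lambda>i. r1 (r2 (r3 i))"] by blast
  define R where "R i = r1 (r2 (r3 (r4 i)))" for i
  have "strict_mono R" using 1(1) 2(1) 3(1) 4(1) by (simp add: R_def strict_mono_def)
  moreover have ch: "torus_charge N1 N2 N3 N4" by (intro torus_charge.intro 1 2 3 4)
  moreover have "(\<lambda>i. \<integral>\<zeta>. w (R i) \<zeta> * f \<zeta> \<partial>torus_haar) \<longlonglongrightarrow> torus_charge.charge_integral N1 N2 N3 N4 f"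
    if f: "continuous_on torus f" for f
  proof -
    have s: "strict_mono (\<lambda>i. r2 (r3 (r4 i)))" "strict_mono (\<lambda>i. r3 (r4 i))"
      using 2(1) 3(1) 4(1) by (simp_all add: strict_mono_def)
    have l: "(\<lambda>i. T g1 (R i) f) \<longlonglongrightarrow> (\<integral>\<zeta>. f \<zeta> \<partial>N1)" "(\<lambda>i. T g2 (R i) f) \<longlonglongrightarrow> (\<integral>\<zeta>. f \<zeta> \<partial>N2)"
      "(\<lambda>i. T g3 (R i) f) \<longlonglongrightarrow> (\<integral>\<zeta>. f \<zeta> \<partial>N3)" "(\<lambda>i. T g4 (R i) f) \<longlonglongrightarrow> (\<integral>\<zeta>. f \<zeta> \<partial>N4)"
      using LIMSEQ_subseq_LIMSEQ[OF 1(4)[OF f] s(1)] LIMSEQ_subseq_LIMSEQ[OF 2(4)[OF f] s(2)]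
        LIMSEQ_subseq_LIMSEQ[OF 3(4)[OF f] 4(1)] 4(4)[OF f] by (simp_all add: o_def R_def)
    have fh: "finite_measure (torus_haar :: (complex ^ 'n) measure)"
      by (rule prob_space.axioms(1)[OF prob_space_torus_haar])
    have i: "integrable torus_haar (\<lambda>\<zeta>. complex_of_real (g (w m \<zeta>)) * f \<zeta>)" if "continuous_on UNIV g" for g m
      by (rule integrable_on_torus[OF fh sets_torus_haar])
         (intro continuous_on_mult continuous_on_of_real f continuous_on_compose2[OF that w], simp)
    have "T g1 m f - T g2 m f + \<i> * (T g3 m f - T g4 m f) = (\<integral>\<zeta>. w m \<zeta> * f \<zeta> \<partial>torus_haar)" for m
    proof -
      have d: "z = (of_real (g1 z) - of_real (g2 z)) + \<i> * (of_real (g3 z) - of_real (g4 z))" for z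
        by (auto simp: complex_eq_iff g1_def g2_def g3_def g4_def)
      have "w m \<zeta> * f \<zeta> = (of_real (g1 (w m \<zeta>)) * f \<zeta> - of_real (g2 (w m \<zeta>)) * f \<zeta>)
          + \<i> * (of_real (g3 (w m \<zeta>)) * f \<zeta> - of_real (g4 (w m \<zeta>)) * f \<zeta>)" for \<zeta>
        by (subst d[of "w m \<zeta>"]) (simp add: algebra_simps)
      then have "(\<integral>\<zeta>. w m \<zeta> * f \<zeta> \<partial>torus_haar) = (\<integral>\<zeta>. (of_real (g1 (w m \<zeta>)) * f \<zeta> - of_real (g2 (w m \<zeta>)) * f \<zeta>)
          + \<i> * (of_real (g3 (w m \<zeta>)) * f \<zeta> - of_real (g4 (w m \<zeta>)) * f \<zeta>) \<partial>torus_haar)" by (simp only:)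
      also have "\<dots> = T g1 m f - T g2 m f + \<i> * (T g3 m f - T g4 m f)"
        unfolding T_def by (simp add: i gc)
      finally show ?thesis by simp
    qed
    then have "(\<lambda>i. \<integral>\<zeta>. w (R i) \<zeta> * f \<zeta> \<partial>torus_haar) = (\<lambda>i. T g1 (R i) f - T g2 (R i) f + \<i> * (T g3 (R i) f - T g4 (R i) f))"
      by simp
    then show ?thesis
      unfolding torus_charge.charge_integral_def[OF ch] by (simp only:) (intro tendsto_intros l)
  qed
  ultimately show ?thesis by blast
qed

lemma polydisc_polar:
  assumes "z \<in> polydisc"
  obtains r \<eta> where "\<And>j. 0 \<le> r j \<and> r j < 1" "\<eta> \<in> torus" "z = polar_point r \<eta>"
proof (rule that)
  show "0 \<le> norm (z $ j) \<and> norm (z $ j) < 1" for j using assms by (simp add: polydisc_def)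
  show "(\<chi> j. if z $ j = 0 then 1 else sgn (z $ j)) \<in> torus" by (simp add: torus_def norm_sgn)
  show "z = polar_point (\<lambda>j. norm (z $ j)) (\<chi> j. if z $ j = 0 then 1 else sgn (z $ j))"
    by (simp add: polar_point_def vec_eq_iff sgn_eq)
qed

lemma polydisc_eqI_fourier:
  fixes u v :: "complex ^ 'n::finite \<Rightarrow> complex"
  assumes u: "\<And>r. (\<And>j. 0 \<le> r j \<and> r j < 1) \<Longrightarrow> continuous_on torus (\<lambda>\<eta>. u (polar_point r \<eta>))"
    and v: "\<And>r. (\<And>j. 0 \<le> r j \<and> r j < 1) \<Longrightarrow> continuous_on torus (\<lambda>\<eta>. v (polar_point r \<eta>))"
    and eq: "\<And>k r. (\<And>j. 0 \<le> r j \<and> r j < 1) \<Longrightarrow> fourier_coeff u k r = fourier_coeff v k r"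
    and z: "z \<in> polydisc"
  shows "u z = v z"
proof -
  obtain r \<eta> where r: "\<And>j. 0 \<le> r j \<and> r j < 1" and \<eta>: "\<eta> \<in> torus" and z: "z = polar_point r \<eta>"
    by (rule polydisc_polar[OF z]) blast
  have fh: "finite_measure (torus_haar :: (complex ^ 'n) measure)"
    by (rule prob_space.axioms(1)[OF prob_space_torus_haar])
  have "u (polar_point r \<eta>) - v (polar_point r \<eta>) = 0"
  proof (rule continuous_eq_0_if_fourier_0[OF _ _ \<eta>])
    show "continuous_on torus (\<lambda>\<eta>. u (polar_point r \<eta>) - v (polar_point r \<eta>))" by (intro continuous_on_diff u v r)
    fix k :: "'n \<Rightarrow> int"
    have i: "integrable torus_haar (\<lambda>\<eta>. u (polar_point r \<eta>) * mon k \<eta>)" "integrable torus_haar (\<lambda>\<eta>. v (polar_point r \<eta>) * mon k \<eta>)"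
      by (intro integrable_on_torus[OF fh sets_torus_haar] continuous_on_mult u v r continuous_mon)+
    show "(\<integral>\<eta>. (u (polar_point r \<eta>) - v (polar_point r \<eta>)) * mon k \<eta> \<partial>torus_haar) = 0"
      using eq[of r "\<lambda>j. - k j"] r i by (simp add: fourier_coeff_def left_diff_distrib)
  qed
  then show ?thesis by (simp add: z)
qed

text \<open>Along a sequence of radii tending to \<open>1\<close> the rescaled restrictions of \<open>u\<close> converge weakly to a measure, whose Fourier coefficients
  are forced by proportionality; comparing coefficients on every torus identifies \<open>u\<close> with its Poisson integral.\<close>

theorem theorem3p16:
  fixes \<alpha> \<beta> :: "complex ^ 'n::finite"
    and u :: "complex ^ 'n \<Rightarrow> complex"
  assumes "\<And>j. Re (\<alpha> $ j) + Re (\<beta> $ j) > -1"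
    and "\<And>j (k::nat). k \<ge> 1 \<Longrightarrow> \<alpha> $ j \<noteq> - of_nat k"
    and "\<And>j (k::nat). k \<ge> 1 \<Longrightarrow> \<beta> $ j \<noteq> - of_nat k"
    and "separately_harmonic \<alpha> \<beta> u"
    and "(SUP r\<in>{0..<1::real}. \<integral>\<^sup>+\<zeta>. ennreal (norm (u (r *\<^sub>R \<zeta>))) \<partial>torus_haar) < \<infinity>"
  shows "\<exists>!\<mu>. complex_measure torus_borel \<mu> \<and>
           (\<forall>z\<in>polydisc. u z = poisson_integral \<alpha> \<beta> \<mu> z)"
proof -
  note ab = assms(1)
  have a: "\<alpha> $ j + 1 \<notin> \<int>\<^sub>\<le>\<^sub>0" and b: "\<beta> $ j + 1 \<notin> \<int>\<^sub>\<le>\<^sub>0" for j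
    using assms(2,3) by (auto simp: nonpos_Ints_iff)
  obtain u' u'' where "C2_derivatives u u' u''"
    using assms(4) unfolding separately_harmonic_def C2_on_def C2_derivatives_def by blast
  then interpret C2_derivatives u u' u'' .
  have cu: "continuous_on torus (\<lambda>\<eta>. u (polar_point r \<eta>))" if "\<And>j. 0 \<le> r j \<and> r j < 1" for r
    by (rule continuous_on_polar[OF cont_u]) (use that in \<open>simp add: abs_less_iff less_le_trans[of _ 0]\<close>)
  obtain C where C: "(SUP r\<in>{0..<1::real}. \<integral>\<^sup>+\<zeta>. ennreal (norm (u (r *\<^sub>R \<zeta>))) \<partial>torus_haar) = ennreal C"
    using assms(5) by (auto simp: less_top_ennreal)
  define s where "s m = 1 - 1 / (real m + 2)" for m :: nat
  have s: "0 \<le> s m \<and> s m < 1" for m by (simp add: s_def field_simps)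
  have sc: "s m *\<^sub>R \<zeta> = polar_point (\<lambda>_. s m) \<zeta>" for m \<zeta>
    unfolding vec_eq_iff polar_point_def vector_scaleR_component vec_lambda_beta by (simp add: scaleR_conv_of_real)
  have bound: "(\<integral>\<^sup>+\<zeta>. ennreal (norm (u (polar_point (\<lambda>_. s m) \<zeta>))) \<partial>torus_haar) \<le> ennreal C" for m
    unfolding C[symmetric] sc[symmetric] using s by (intro SUP_upper) auto
  have cs: "continuous_on torus (\<lambda>\<zeta>. u (polar_point (\<lambda>_. s m) \<zeta>))" for m
    by (rule cu) (rule s)
  obtain R N1 N2 N3 N4 where R: "strict_mono (R :: nat \<Rightarrow> nat)" and N: "torus_charge N1 N2 N3 N4"
    and lim: "\<forall>f. continuous_on torus f \<longrightarrow> (\<lambda>i. \<integral>\<zeta>. u (polar_point (\<lambda>_. s (R i)) \<zeta>) * f \<zeta> \<partial>torus_haar)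
      \<longlonglongrightarrow> torus_charge.charge_integral N1 N2 N3 N4 f"
    using weak_limit_of_dilations[of "\<lambda>m \<zeta>. u (polar_point (\<lambda>_. s m) \<zeta>)" C, OF cs bound] by (elim exE conjE)
  define \<mu> where "\<mu> A = (if A \<in> sets torus_borel then of_real (measure N1 A - measure N2 A) + \<i> * of_real (measure N3 A - measure N4 A) else 0)" for A
  have \<mu>: "complex_measure torus_borel \<mu>"
    and \<mu>_int: "\<And>f. continuous_on torus f \<Longrightarrow> complex_measure_integral torus_borel \<mu> f = torus_charge.charge_integral N1 N2 N3 N4 f"
    using complex_measure_of_charge[OF N] unfolding \<mu>_def[abs_def] by auto
  have "(\<lambda>m. s (R m)) \<longlonglongrightarrow> 1"
  proof -
    have "s \<longlonglongrightarrow> 1" unfolding s_def by real_asymp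
    then show ?thesis using LIMSEQ_subseq_LIMSEQ[OF _ R] by (simp add: o_def)
  qed
  then have s1: "filterlim (\<lambda>m. s (R m)) (at_left 1) sequentially"
    using s by (intro tendsto_imp_filterlim_at_left) (auto intro!: always_eventually)
  \<comment> \<open>Proportionality with the polyradius \<open>(s, \<dots>, s)\<close>, and \<open>s \<rightarrow> 1\<close> along the sequence.\<close>
  have coeff: "fourier_coeff u k r = complex_measure_integral torus_borel \<mu> (mon (\<lambda>i. - k i)) * radial_prod \<alpha> \<beta> k r"
    if r: "\<And>j. 0 \<le> r j \<and> r j < 1" for k r
  proof -
    have "(\<lambda>m. fourier_coeff u k r * radial_prod \<alpha> \<beta> k (\<lambda>_. s (R m))) \<longlonglongrightarrow> fourier_coeff u k r * 1"
      by (intro tendsto_mult tendsto_const filterlim_compose[OF prod_radial_coeff_limit[OF ab a b] s1])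
    moreover have "(\<lambda>m. fourier_coeff u k (\<lambda>_. s (R m)) * radial_prod \<alpha> \<beta> k r) \<longlonglongrightarrow>
        complex_measure_integral torus_borel \<mu> (mon (\<lambda>i. - k i)) * radial_prod \<alpha> \<beta> k r"
      unfolding \<mu>_int[OF continuous_mon] fourier_coeff_def by (intro tendsto_mult tendsto_const lim[rule_format] continuous_mon)
    moreover have "fourier_coeff u k r * radial_prod \<alpha> \<beta> k (\<lambda>_. s (R m))
       = fourier_coeff u k (\<lambda>_. s (R m)) * radial_prod \<alpha> \<beta> k r" for m
      by (rule fourier_coeff_proportional[OF ab assms(4) r]) (rule s)
    ultimately show ?thesis by (simp add: LIMSEQ_unique)
  qed
  have ex: "u z = poisson_integral \<alpha> \<beta> \<mu> z" if "z \<in> polydisc" for z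
    using cu fourier_poisson_integral(2)[OF ab \<mu>] _ that
  proof (rule polydisc_eqI_fourier)
    show "fourier_coeff u k r = fourier_coeff (poisson_integral \<alpha> \<beta> \<mu>) k r" if "\<And>j. 0 \<le> r j \<and> r j < 1" for k r
      unfolding coeff[OF that] fourier_poisson_integral(1)[OF ab \<mu> that] ..
  qed
  show ?thesis
  proof (rule ex1I[of _ \<mu>])
    show "complex_measure torus_borel \<mu> \<and> (\<forall>z\<in>polydisc. u z = poisson_integral \<alpha> \<beta> \<mu> z)" using \<mu> ex by blast
    fix \<nu> assume \<nu>: "complex_measure torus_borel \<nu> \<and> (\<forall>z\<in>polydisc. u z = poisson_integral \<alpha> \<beta> \<nu> z)"
    show "\<nu> = \<mu>"
      by (rule poisson_measure_unique[OF ab a b]) (use \<nu> \<mu> ex in auto)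
  qed
qed

end
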